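(* Fix a prime $p$ and let $t=1/p$. Let $1 \leq n \leq m$, and let $A \in M_{n \times m}(\mathbb{Z}_p)$ be random with i.i.d. entries distributed according to the additive Haar probability measure on $\mathbb{Z}_p$. Then for any $\lambda \in \mathrm{Sig}_n^+$, $$\Pr(\mathrm{SN}(A) = \lambda) = \frac{P_\lambda(1,\ldots,t^{n-1};t)\,Q_\lambda(t^{m-n+1},t^{m-n+2},\ldots;t)}{\Pi_{(0,t)}(1,\ldots,t^{n-1};t^{m-n+1},t^{m-n+2},\ldots)}.$$
   Context: $p$-adic notation. $\mathbb{Q}_p,\mathbb{Z}_p$ are the $p$-adic numbers and integers. For $n\le m$ and $A\in M_{n\times m}(\mathbb{Q}_p)$ of full rank there are $U\in\mathrm{GL}_n(\mathbb{Z}_p)$, $V\in\mathrm{GL}_m(\mathbb{Z}_p)$ with $UAV=\mathrm{diag}_{n\times m}(p^{\lambda_1},\ldots,p^{\lambda_n})$ for a unique weakly decreasing integer tuple $\lambda$; write $\mathrm{SN}(A)=\lambda$. Signatures. $\mathrm{Sig}_n$ is the set of weakly decreasing $n$-tuples of integers, $\mathrm{Sig}_n^+$ those with all parts $\ge 0$, $()$ is the empty signature, $0[n]=(0,\ldots,0)\in\mathrm{Sig}_n$. $|\lambda|=\sum_i\lambda_i$, $m_i(\lambda)=\#\{j:\lambda_j=i\}$. For $\lambda\in\mathrm{Sig}_n,\mu\in\mathrm{Sig}_{n-1}$, $\mu\prec_P\lambda$ means $\lambda_i\ge\mu_i\ge\lambda_{i+1}$ for $1\le i\le n-1$. For $\lambda,\nu\in\mathrm{Sig}_n$,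 $\nu\prec_Q\lambda$ means $\lambda_i\ge\nu_i$ for $1\le i\le n$ and $\nu_i\ge\lambda_{i+1}$ for $1\le i\le n-1$. Hall-Littlewood polynomials (the case $q=0$ of Macdonald polynomials). In one variable, $$P_{\lambda/\mu}(x;t)=x^{|\lambda|-|\mu|}\prod_{i\in\mathbb{Z}:\,m_i(\mu)=m_i(\lambda)+1}(1-t^{m_i(\mu)})\ \text{ if }\mu\prec_P\lambda,\qquad Q_{\lambda/\nu}(x;t)=x^{|\lambda|-|\nu|}\prod_{i\in\mathbb{Z}:\,m_i(\lambda)=m_i(\nu)+1}(1-t^{m_i(\lambda)})\ \text{ if }\nu\prec_Q\lambda,$$ and $0$ otherwise. For $\lambda\in\mathrm{Sig}_n$, $$P_\lambda(x_1,\ldots,x_n;t)=\sum_{()=\lambda^{(0)}\prec_P\cdots\prec_P\lambda^{(n)}=\lambda}\ \prod_{i=1}^nP_{\lambda^{(i)}/\lambda^{(i-1)}}(x_i;t),$$ and for $\lambda\in\mathrm{Sig}_n^+$, $$Q_\lambda(y_1,\ldots,y_r;t)=\sum_{0[n]=\lambda^{(0)}\prec_Q\cdots\prec_Q\lambda^{(r)}=\lambda}\ \prod_{i=1}^rQ_{\lambda^{(i)}/\lambda^{(i-1)}}(y_i;t).$$ For infinitely many nonnegative reals with $\sum_i y_i<\infty$, $Q_\lambda(y_1,y_2,\ldots;t)=\lim_{r\to\infty}Q_\lambda(y_1,\ldots,y_r;t)$. Cauchy kernel: $\Pi_{(0,t)}(x_1,\ldots,x_a;y_1,y_2,\ldots)=\prod_{i,j}\frac{1-t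 x_iy_j}{1-x_iy_j}$. *)

theory Defs
  imports
    "HOL-Probability.Probability"
    "HOL-Computational_Algebra.Polynomial_Factorial"
    "Berlekamp_Zassenhaus.Finite_Field"
    "Jordan_Normal_Form.Matrix"
begin

section \<open>The $p$-adic integers and numbers\<close>

text \<open>
  The prime is the cardinality of a type of class \<open>prime_card\<close>. A $p$-adic integer is a
  coherent sequence of residues, the \<open>k\<close>-th one being taken modulo $p^k$, i.e. an element of the
  inverse limit of the rings $\mathbb{Z}/p^k$.
\<close>

typedef (overloaded) 'p padic_int =
  "{x :: nat \<Rightarrow> int. \<forall>k. x k \<in> {0..<int CARD('p::prime_card) ^ k} \<and>
      x (Suc k) mod int CARD('p) ^ k = x k}"
  morphisms residue_seq Abs_padic_int
proof -
  have "0 < CARD('p)" using prime_card[where 'a='p] prime_gt_0_nat by blast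
  then show ?thesis by (intro exI[of _ "\<lambda>_. 0"]) auto
qed

setup_lifting type_definition_padic_int

lemma p_pos: "0 < int CARD('p::prime_card)"
  using prime_card[where 'a='p] prime_gt_0_nat by auto

lemma p_gt_1: "1 < int CARD('p::prime_card)"
  using prime_card[where 'a='p] prime_gt_1_nat by auto

lemma mod_pow_Suc: "(a mod int c ^ Suc k) mod int c ^ k = a mod int c ^ k"
  by (rule mod_mod_cancel) simp

lemma residue_seq_mod_self [simp]:
  fixes x :: "'p::prime_card padic_int"
  shows "residue_seq x k mod int CARD('p) ^ k = residue_seq x k"
  using residue_seq[of x] by (intro mod_pos_pos_trivial) auto

lemma residue_seq_mod_le:
  fixes x :: "'p::prime_card padic_int"
  assumes "j \<le> k"
  shows "residue_seq x k mod int CARD('p) ^ j = residue_seq x j"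
  using assms
proof (induction k rule: dec_induct)
  case (step k)
  have "residue_seq x (Suc k) mod int CARD('p) ^ j
      = (residue_seq x (Suc k) mod int CARD('p) ^ k) mod int CARD('p) ^ j"
    using step(1) by (intro mod_mod_cancel[symmetric] le_imp_power_dvd)
  then show ?case using step residue_seq[of x] by auto
qed simp

instantiation padic_int :: (prime_card) comm_ring_1
begin

lift_definition zero_padic_int :: "'a padic_int" is "\<lambda>_. 0"
  using p_pos[where 'p='a] by auto

lift_definition one_padic_int :: "'a padic_int" is "\<lambda>k. 1 mod int CARD('a) ^ k"
  using p_pos[where 'p='a] by (auto simp only: mod_pow_Suc) auto

lift_definition plus_padic_int :: "'a padic_int \<Rightarrow> 'a padic_int \<Rightarrow> 'a padic_int"
  is "\<lambda>x y k. (x k + y k) mod int CARD('a) ^ k"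
  using p_pos[where 'p='a] by (auto simp only: mod_pow_Suc) (auto, metis mod_add_eq)

lift_definition minus_padic_int :: "'a padic_int \<Rightarrow> 'a padic_int \<Rightarrow> 'a padic_int"
  is "\<lambda>x y k. (x k - y k) mod int CARD('a) ^ k"
  using p_pos[where 'p='a] by (auto simp only: mod_pow_Suc) (auto, metis mod_diff_eq)

lift_definition uminus_padic_int :: "'a padic_int \<Rightarrow> 'a padic_int"
  is "\<lambda>x k. (- x k) mod int CARD('a) ^ k"
  using p_pos[where 'p='a] by (auto simp only: mod_pow_Suc) (auto, metis mod_minus_eq)

lift_definition times_padic_int :: "'a padic_int \<Rightarrow> 'a padic_int \<Rightarrow> 'a padic_int"
  is "\<lambda>x y k. (x k * y k) mod int CARD('a) ^ k"
  using p_pos[where 'p='a] by (auto simp only: mod_pow_Suc) (auto, metis mod_mult_eq)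

instance
proof
  fix a b c :: "'a padic_int"
  show "a * b * c = a * (b * c)"
    by transfer (auto simp: mod_simps ac_simps)
  show "a * b = b * a" by transfer (auto simp: ac_simps)
  show "1 * a = a" by transfer (auto simp: mod_simps)
  show "a + b + c = a + (b + c)" by transfer (auto simp: mod_simps ac_simps)
  show "a + b = b + a" by transfer (auto simp: ac_simps)
  show "0 + a = a" by transfer auto
  show "- a + a = 0" by transfer (auto simp: mod_simps)
  show "a - b = a + - b" by transfer (auto simp: mod_simps)
  show "(a + b) * c = a * c + b * c"
    by transfer (auto simp: mod_simps distrib_right)
  have "(0::int) \<noteq> 1 mod int CARD('a) ^ 1" using p_gt_1[where 'p='a] by simp
  then show "(0::'a padic_int) \<noteq> 1"
    by transfer metis
qed

end

instance padic_int :: (prime_card) idom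
proof
  fix a b :: "'a padic_int"
  let ?p = "int CARD('a)"
  have nz: "\<exists>k. residue_seq x k \<noteq> 0" if "x \<noteq> 0" for x :: "'a padic_int"
    using that by transfer auto
  assume "a \<noteq> 0" "b \<noteq> 0"
  then obtain i j where ij: "residue_seq a i \<noteq> 0" "residue_seq b j \<noteq> 0"
    using nz by meson
  define k where "k = i + j"
  have "\<not> ?p ^ i dvd residue_seq a k" "\<not> ?p ^ j dvd residue_seq b k"
    using ij residue_seq_mod_le[of i k a] residue_seq_mod_le[of j k b]
    by (auto simp: k_def dvd_eq_mod_eq_0)
  moreover have "?p ^ i dvd residue_seq a k \<or> ?p ^ j dvd residue_seq b k"
    if "?p ^ k dvd residue_seq a k * residue_seq b k"
    using prime_elem_power_dvd_cases[OF that, of i "Suc j"] prime_card_int[where 'a='a]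
    by (auto simp: k_def intro: dvd_mult_right)
  ultimately have "\<not> ?p ^ k dvd residue_seq a k * residue_seq b k" by blast
  then have "residue_seq (a * b) k \<noteq> 0"
    by (simp add: times_padic_int.rep_eq dvd_eq_mod_eq_0)
  then show "a * b \<noteq> 0" by (auto simp: zero_padic_int.rep_eq)
qed

type_synonym 'p padic = "'p padic_int fract"

text \<open>The $p$-adic topology, whose basic neighbourhoods of \<open>x\<close> are the cosets $x + p^k\mathbb{Z}_p$.\<close>

instantiation padic_int :: (prime_card) topological_space
begin

definition open_padic_int :: "'a padic_int set \<Rightarrow> bool" where
  "open_padic_int U \<longleftrightarrow>
     (\<forall>x\<in>U. \<exists>k. {y. residue_seq y k = residue_seq x k} \<subseteq> U)"

instance
proof
  show "open (UNIV :: 'a padic_int set)" by (auto simp: open_padic_int_def)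
next
  fix S T :: "'a padic_int set"
  assume "open S" "open T"
  show "open (S \<inter> T)"
    unfolding open_padic_int_def
  proof
    fix x assume "x \<in> S \<inter> T"
    then obtain i j where ij: "{y. residue_seq y i = residue_seq x i} \<subseteq> S"
        "{y. residue_seq y j = residue_seq x j} \<subseteq> T"
      using \<open>open S\<close> \<open>open T\<close> unfolding open_padic_int_def by blast
    have "residue_seq y i = residue_seq x i \<and> residue_seq y j = residue_seq x j"
      if "residue_seq y (max i j) = residue_seq x (max i j)" for y :: "'a padic_int"
      using that residue_seq_mod_le[of i "max i j" x] residue_seq_mod_le[of i "max i j" y]
        residue_seq_mod_le[of j "max i j" x] residue_seq_mod_le[of j "max i j" y] by simp
    then show "\<exists>k. {y. residue_seq y k = residue_seq x k} \<subseteq> S \<inter> T"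
      using ij by (intro exI[of _ "max i j"]) blast
  qed
next
  fix K :: "'a padic_int set set"
  assume K: "\<forall>S\<in>K. open S"
  show "open (\<Union>K)"
    unfolding open_padic_int_def
  proof
    fix x assume "x \<in> \<Union>K"
    then obtain S where S: "S \<in> K" "x \<in> S" by auto
    then obtain k where "{y. residue_seq y k = residue_seq x k} \<subseteq> S"
      using K unfolding open_padic_int_def by meson
    then show "\<exists>k. {y. residue_seq y k = residue_seq x k} \<subseteq> \<Union>K"
      using S(1) by (meson Union_upper order_trans)
  qed
qed

end

definition haar_prob :: "'a::{topological_space, ab_group_add} measure \<Rightarrow> bool" where
  "haar_prob \<mu> \<longleftrightarrow> prob_space \<mu> \<and> sets \<mu> = sets borel \<and>
     (\<forall>a. \<forall>S\<in>sets borel. emeasure \<mu> ((+) a ` S) = emeasure \<mu> S)"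


section \<open>Signatures and singular numbers\<close>

definition Sig :: "nat \<Rightarrow> int list set" where
  "Sig n = {lam. length lam = n \<and> sorted_wrt (\<ge>) lam}"

definition Sig_nonneg :: "nat \<Rightarrow> int list set" where
  "Sig_nonneg n = {lam \<in> Sig n. \<forall>i\<in>set lam. 0 \<le> i}"

definition GL :: "nat \<Rightarrow> 'a::semiring_1 mat set" where
  "GL n = {U \<in> carrier_mat n n. invertible_mat U}"

text \<open>
  \<open>has_SN A lam\<close> is the assertion $\mathrm{SN}(A) = \mathit{lam}$. It is a relation because
  $\mathrm{SN}$ is only defined on matrices of full rank; no \<open>lam\<close> is related to any other matrix.
\<close>

definition has_SN :: "'p::prime_card padic mat \<Rightarrow> int list \<Rightarrow> bool" where
  "has_SN A lam \<longleftrightarrow> (let n = dim_row A; m = dim_col A in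
     n \<le> m \<and> lam \<in> Sig n \<and>
     (\<exists>U \<in> GL n. \<exists>V \<in> GL m.
        map_mat to_fract (U :: 'p padic_int mat) * A * map_mat to_fract (V :: 'p padic_int mat)
          = mat n m (\<lambda>(i, j). if i = j then of_nat CARD('p) powi (lam ! i) else 0)))"


section \<open>Hall-Littlewood polynomials\<close>

text \<open>
  Signatures are lists, and list indices as well as the indices of the variables start at \<open>0\<close>.
  If \<open>prec_P \<mu> lam\<close> or \<open>prec_Q \<mu> lam\<close> then both lists are automatically weakly
  decreasing. The multiplicity $m_i(\mathit{lam})$ is \<open>count_list lam i\<close>.
\<close>

definition prec_P :: "int list \<Rightarrow> int list \<Rightarrow> bool" where
  "prec_P \<mu> lam \<longleftrightarrow> length lam = Suc (length \<mu>) \<and>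
     (\<forall>i < length \<mu>. \<mu> ! i \<le> lam ! i \<and> lam ! Suc i \<le> \<mu> ! i)"

definition prec_Q :: "int list \<Rightarrow> int list \<Rightarrow> bool" where
  "prec_Q \<nu> lam \<longleftrightarrow> length lam = length \<nu> \<and>
     (\<forall>i < length \<nu>. \<nu> ! i \<le> lam ! i) \<and>
     (\<forall>i. Suc i < length \<nu> \<longrightarrow> lam ! Suc i \<le> \<nu> ! i)"

definition skew_P :: "int list \<Rightarrow> int list \<Rightarrow> real \<Rightarrow> real \<Rightarrow> real" where
  "skew_P lam \<mu> x t =
     (if prec_P \<mu> lam
      then x powi (sum_list lam - sum_list \<mu>) *
           (\<Prod>i | count_list \<mu> i = count_list lam i + 1. 1 - t ^ count_list \<mu> i)
      else 0)"

definition skew_Q :: "int list \<Rightarrow> int list \<Rightarrow> real \<Rightarrow> real \<Rightarrow> real" where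
  "skew_Q lam \<nu> x t =
     (if prec_Q \<nu> lam
      then x powi (sum_list lam - sum_list \<nu>) *
           (\<Prod>i | count_list lam i = count_list \<nu> i + 1. 1 - t ^ count_list lam i)
      else 0)"

text \<open>Chains of \<open>r\<close> steps of \<open>R\<close>, as lists of length \<open>r + 1\<close>.\<close>

definition chains ::
  "(int list \<Rightarrow> int list \<Rightarrow> bool) \<Rightarrow> nat \<Rightarrow> int list \<Rightarrow> int list \<Rightarrow> int list list set" where
  "chains R r \<alpha> \<beta> =
     {c. length c = Suc r \<and> c ! 0 = \<alpha> \<and> c ! r = \<beta> \<and> (\<forall>i < r. R (c ! i) (c ! Suc i))}"

text \<open>\<open>hl_P lam x t\<close> is $P_{\mathit{lam}}$ in the variables \<open>x 0, \<dots>, x (length lam - 1)\<close>.\<close>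

definition hl_P :: "int list \<Rightarrow> (nat \<Rightarrow> real) \<Rightarrow> real \<Rightarrow> real" where
  "hl_P lam x t = (\<Sum>c \<in> chains prec_P (length lam) [] lam.
     \<Prod>i < length lam. skew_P (c ! Suc i) (c ! i) (x i) t)"

definition hl_Q_fin :: "nat \<Rightarrow> int list \<Rightarrow> (nat \<Rightarrow> real) \<Rightarrow> real \<Rightarrow> real" where
  "hl_Q_fin r lam y t = (\<Sum>c \<in> chains prec_Q r (replicate (length lam) 0) lam.
     \<Prod>i < r. skew_Q (c ! Suc i) (c ! i) (y i) t)"

definition hl_Q :: "int list \<Rightarrow> (nat \<Rightarrow> real) \<Rightarrow> real \<Rightarrow> real" where
  "hl_Q lam y t = lim (\<lambda>r. hl_Q_fin r lam y t)"

definition cauchy_kernel :: "nat \<Rightarrow> (nat \<Rightarrow> real) \<Rightarrow> (nat \<Rightarrow> real) \<Rightarrow> real \<Rightarrow> real" where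
  "cauchy_kernel a x y t = (\<Prod>i<a. \<Prod>j. (1 - t * x i * y j) / (1 - x i * y j))"

end

theory Submission
  imports Defs "Jordan_Normal_Form.Determinant"
begin

text \<open>
  Both sides are evaluated in closed form. Let \<open>t = 1/p\<close>, let \<open>(t)\<^sub>j = (1 - t) \<dots> (1 - t^j)\<close>, let
  \<open>n(\<lambda>)\<close> be the sum of \<open>i \<lambda>\<^sub>i\<close> with indices starting at \<open>0\<close>, and put \<open>k = m - n + 1\<close>.

  On the right-hand side,
  \<open>P\<^sub>\<lambda>(1, \<dots>, t^(n-1)) = t^n(\<lambda>) (t)\<^sub>n / \<Prod>\<^sub>v (t)\<^sub>m\<close>, where \<open>m\<close> is the multiplicity of the value \<open>v\<close> in \<open>\<lambda>\<close>
  (\<open>hl_P_principal\<close>),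
  \<open>Q\<^sub>\<lambda>(t^k, t^(k+1), \<dots>) = t^(k|\<lambda>| + n(\<lambda>))\<close> (\<open>hl_Q_principal\<close>), and the Cauchy kernel telescopes to
  the inverse of \<open>(1 - t^k) \<dots> (1 - t^(k+n-1))\<close>. The first two formulas follow by induction on
  the number of variables from one identity for sums over the signatures that interlace with \<open>\<lambda>\<close>,
  \<open>interlace_sum\<close>. It applies to Q because, for nonnegative signatures, \<open>\<nu> \<prec>\<^sub>Q \<lambda>\<close> means
  \<open>\<nu> \<prec>\<^sub>P (\<lambda>, 0)\<close>.

  On the left-hand side, \<open>SN(A) = \<lambda>\<close> depends only on \<open>A\<close> modulo a power of \<open>p\<close> that exceeds all
  \<open>p^\<lambda>\<^sub>i\<close> (\<open>mequiv_pdiag_cong\<close>), and the residues of the entries of \<open>A\<close> are independent and uniform.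
  So the probability is an average over finitely many matrices. It is computed by a recursion
  for a more general average, over matrices with \<open>a\<close> free columns and \<open>b\<close> columns that are
  divisible by \<open>p\<close>. Consider the first free column. If it is divisible by \<open>p\<close>, it is counted among
  the other \<open>b\<close> columns. If not, row operations turn it into the first unit vector; they do not
  affect the distribution of the other columns, and column operations then split off a block \<open>1\<close>.
  In this case \<open>SN(A) = \<lambda>\<close> holds if and only if \<open>\<lambda>\<close> ends with \<open>0\<close> and the complementary block has the
  singular numbers \<open>\<lambda>\<close> without this \<open>0\<close> (\<open>mequiv_pivot_iff\<close>); the implication from left to right is a
  cancellation property of matrices over a local ring (\<open>cancel_one_plus\<close>). If there is no free
  column, then the whole matrix is divisible by \<open>p\<close>, and division by \<open>p\<close> lowers all parts of \<open>\<lambda>\<close> by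
  one. The function \<open>snf_formula\<close> solves this recursion, and for \<open>a = m\<close>, \<open>b = 0\<close> it equals the right-hand
  side.
\<close>

(* From here on, $ denotes the entries of vectors with carriers carrier_vec n only. *)
unbundle no vec_syntax

section \<open>An identity for interlacing signatures\<close>

lemma finite_prec_P: "finite {\<mu>. prec_P \<mu> lam}"
proof -
  let ?B = "{Min (set lam)..Max (set lam)}"
  have "{\<mu>. prec_P \<mu> lam} \<subseteq> {\<mu>. set \<mu> \<subseteq> ?B \<and> length \<mu> = length lam - 1}"
  proof clarify
    fix \<mu> assume p: "prec_P \<mu> lam"
    then have l: "length lam = Suc (length \<mu>)" by (simp add: prec_P_def)
    have "x \<in> ?B" if x: "x \<in> set \<mu>" for x
    proof -
      obtain i where i: "i < length \<mu>" "x = \<mu> ! i" using x unfolding in_set_conv_nth by blast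
      have "x \<le> lam ! i" "lam ! Suc i \<le> x" using p i by (auto simp: prec_P_def)
      moreover have "lam ! i \<in> set lam" "lam ! Suc i \<in> set lam" using i l by auto
      ultimately have "x \<le> Max (set lam)" "Min (set lam) \<le> x"
        by (auto intro: order_trans[OF _ Max_ge] order_trans[OF Min_le])
      then show ?thesis by simp
    qed
    then show "set \<mu> \<subseteq> ?B \<and> length \<mu> = length lam - 1" using l by auto
  qed
  then show ?thesis using finite_lists_length_eq[of ?B "length lam - 1"] finite_subset by auto
qed

lemma prec_P_singleton: "{\<mu>. prec_P \<mu> [v]} = {[]}"
  by (auto simp: prec_P_def)

lemma prec_P_Cons:
  "prec_P (w # \<mu>) (v # u # r) \<longleftrightarrow> u \<le> w \<and> w \<le> v \<and> prec_P \<mu> (u # r)"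
  unfolding prec_P_def by (auto simp: All_less_Suc2)

lemma sum_prec_P_Cons:
  fixes f :: "int list \<Rightarrow> real"
  shows "(\<Sum>\<mu> | prec_P \<mu> (v # u # r). f \<mu>) =
    (\<Sum>w\<in>{u..v}. \<Sum>\<mu> | prec_P \<mu> (u # r). f (w # \<mu>))"
proof -
  have "{\<mu>. prec_P \<mu> (v # u # r)} = (\<lambda>(w, \<mu>). w # \<mu>) ` ({u..v} \<times> {\<mu>. prec_P \<mu> (u # r)})"
  proof (rule subset_antisym; rule subsetI)
    fix \<mu> assume "\<mu> \<in> {\<mu>. prec_P \<mu> (v # u # r)}"
    then show "\<mu> \<in> (\<lambda>(w, \<mu>). w # \<mu>) ` ({u..v} \<times> {\<mu>. prec_P \<mu> (u # r)})"
      by (cases \<mu>) (auto simp: prec_P_Cons image_iff, simp add: prec_P_def)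
  qed (auto simp: prec_P_Cons)
  moreover have "inj_on (\<lambda>(w, \<mu>). w # \<mu>) ({u..v} \<times> {\<mu>. prec_P \<mu> (u # r)})"
    by (auto simp: inj_on_def)
  ultimately show ?thesis
    by (simp add: sum.reindex sum.cartesian_product case_prod_unfold)
qed

text \<open>
  The shift \<open>s\<close> makes one identity serve both specializations. It is \<open>0\<close> for P; for Q, when a variable
  is added to \<open>r\<close> others, it is \<open>r\<close> minus the length of the signature, which may be negative.
\<close>

fun interlace_wt :: "int \<Rightarrow> int list \<Rightarrow> int list \<Rightarrow> int" where
  "interlace_wt s (v # lam) (w # \<mu>) = (int (length lam) + s) * (v - w) + interlace_wt s lam \<mu>"
| "interlace_wt s _ _ = 0"

text \<open>
  The values whose multiplicity drops contribute. The value \<open>z\<close> is counted as if it had \<open>s\<close> more copies;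
  it will be the last entry of \<open>lam\<close>.
\<close>

definition drop_prod :: "real \<Rightarrow> int \<Rightarrow> int \<Rightarrow> int list \<Rightarrow> int list \<Rightarrow> real" where
  "drop_prod t s z lam \<mu> = (\<Prod>v | count_list lam v = count_list \<mu> v + 1.
     1 - t powi (int (count_list lam v) + (if v = z then s else 0)))"

lemma prod_over_drops:
  fixes g :: "int \<Rightarrow> real"
  assumes "finite S" "set lam \<subseteq> S"
  shows "(\<Prod>v | count_list lam v = count_list \<mu> v + 1. g v) =
    (\<Prod>v\<in>S. if count_list lam v = count_list \<mu> v + 1 then g v else 1)"
proof -
  have *: "{v. count_list lam v = count_list \<mu> v + 1} \<subseteq> S"
  proof
    fix v assume "v \<in> {v. count_list lam v = count_list \<mu> v + 1}"
    then have "count_list lam v \<noteq> 0" by simp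
    then have "v \<in> set lam" using count_notin by metis
    then show "v \<in> S" using assms(2) by auto
  qed
  show ?thesis
    by (rule prod.mono_neutral_cong_left[OF assms(1) *]) auto
qed

lemma drop_prod_eq:
  assumes "finite S" "set lam \<subseteq> S"
  shows "drop_prod t s z lam \<mu> = (\<Prod>v\<in>S. if count_list lam v = count_list \<mu> v + 1
     then 1 - t powi (int (count_list lam v) + (if v = z then s else 0)) else 1)"
  unfolding drop_prod_def by (rule prod_over_drops[OF assms])

lemma count_list_replicate: "count_list (replicate n x) y = (if x = y then n else 0)"
  by (induction n) auto

text \<open>
  The head \<open>v\<close> exceeds everything behind it, so it contributes a factor of its own: its multiplicity
  drops unless an extra copy (\<open>e > 0\<close>) or \<open>w = v\<close> makes up for it. For the tails, \<open>w\<close> matters only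
  if it equals their head \<open>u\<close>, and then as one extra copy of \<open>u\<close>.
\<close>

lemma drop_prod_Cons_greater:
  assumes "u < v" "\<forall>x\<in>set (u # r). x \<le> u" "\<forall>x\<in>set \<mu>. x \<le> u" "z \<le> u" "u \<le> w" "w \<le> v"
  shows "drop_prod t s z (replicate c v @ v # u # r) (replicate (c + e) v @ w # \<mu>) =
     (if e = 0 \<and> w \<noteq> v then 1 - t ^ Suc c else 1) *
     drop_prod t s z (u # r) (replicate (if w = u then 1 else 0) u @ \<mu>)"
proof -
  have nv: "v \<notin> set (u # r)" "v \<notin> set \<mu>" "v \<noteq> z" using assms by auto
  have cv: "count_list (u # r) v = 0" "count_list \<mu> v = 0"
    using nv by (auto simp del: count_list.simps simp: count_notin)
  have *: "count_list (replicate c v @ v # u # r) x = count_list (u # r) x" if "x \<in> set (u # r)" for x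
    using that nv by (auto simp: count_list_replicate)
  have **: "count_list (replicate (c + e) v @ w # \<mu>) x =
      count_list (replicate (if w = u then 1 else 0) u @ \<mu>) x" if "x \<in> set (u # r)" for x
    using that nv assms by (auto simp: count_list_replicate)
  have "drop_prod t s z (replicate c v @ v # u # r) (replicate (c + e) v @ w # \<mu>) =
    (\<Prod>x\<in>insert v (set (u # r)). if count_list (replicate c v @ v # u # r) x = count_list (replicate (c + e) v @ w # \<mu>) x + 1
     then 1 - t powi (int (count_list (replicate c v @ v # u # r) x) + (if x = z then s else 0)) else 1)"
    by (rule drop_prod_eq) auto
  also have "\<dots> = (if e = 0 \<and> w \<noteq> v then 1 - t ^ Suc c else 1) *
     (\<Prod>x\<in>set (u # r). if count_list (u # r) x = count_list (replicate (if w = u then 1 else 0) u @ \<mu>) x + 1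
     then 1 - t powi (int (count_list (u # r) x) + (if x = z then s else 0)) else 1)"
    unfolding prod.insert[OF List.finite_set nv(1)]
  proof (intro arg_cong2[of _ _ _ _ "(*)"] prod.cong refl)
    show "(if count_list (replicate c v @ v # u # r) v = count_list (replicate (c + e) v @ w # \<mu>) v + 1
     then 1 - t powi (int (count_list (replicate c v @ v # u # r) v) + (if v = z then s else 0)) else 1)
       = (if e = 0 \<and> w \<noteq> v then 1 - t ^ Suc c else 1)"
      using cv nv by (auto simp: count_list_replicate power_int_def nat_add_distrib)
  qed (simp only: * **)
  also have "(\<Prod>x\<in>set (u # r). if count_list (u # r) x = count_list (replicate (if w = u then 1 else 0) u @ \<mu>) x + 1
     then 1 - t powi (int (count_list (u # r) x) + (if x = z then s else 0)) else 1) =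
    drop_prod t s z (u # r) (replicate (if w = u then 1 else 0) u @ \<mu>)"
    by (rule drop_prod_eq[symmetric]) auto
  finally show ?thesis .
qed

text \<open>
  With \<open>d = v - u\<close> this is \<open>(1 - x) (x + \<dots> + x^(d - 1)) + x^d = x\<close>.
\<close>

lemma telescope_powers:
  fixes x :: real and u v :: int
  assumes "u < v"
  shows "(\<Sum>w\<in>{u..<v}. x powi (v - w) * (if w = u then 1 else 1 - x)) = x"
  using assms
proof (induction u rule: int_less_induct[where k = v])
  case base
  have "{v - 1..<v} = {v - 1}" by auto
  then show ?case by simp
next
  case (step i)
  have "{i - 1..<v} = insert (i - 1) (insert i {i + 1..<v})" using step by auto
  moreover have "{i..<v} = insert i {i + 1..<v}" using step by auto
  moreover have "(\<Sum>w\<in>{i + 1..<v}. x powi (v - w) * (if w = i - 1 then 1 else 1 - x)) =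
      (\<Sum>w\<in>{i + 1..<v}. x powi (v - w) * (if w = i then 1 else 1 - x))"
    by (rule sum.cong) auto
  moreover have "x powi (v - (i - 1)) = x * x powi (v - i)"
    using step power_int_add_1'[of x "v - i"] by (auto simp: algebra_simps)
  ultimately show ?case using step by (simp add: algebra_simps)
qed

lemma prec_P_le_hd:
  assumes "prec_P \<mu> lam" "sorted_wrt (\<ge>) lam" "x \<in> set \<mu>"
  shows "x \<le> hd lam"
proof -
  obtain i where i: "i < length \<mu>" "x = \<mu> ! i" using assms(3) unfolding in_set_conv_nth by blast
  then have "x \<le> lam ! i" "i < length lam" "lam \<noteq> []" using assms by (auto simp: prec_P_def)
  moreover have "lam ! i \<le> lam ! 0"
    using assms(2) calculation by (cases "i = 0") (auto simp: sorted_wrt_iff_nth_less)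
  ultimately show ?thesis by (simp add: hd_conv_nth)
qed

text \<open>
  The statement carries the data that an induction along \<open>lam\<close> has to remember about the entries
  already passed: \<open>c\<close> copies of the current value \<open>v\<close> in \<open>lam\<close>, and whether (\<open>e = 1\<close>) \<open>\<mu>\<close> has one copy
  more. An entry of \<open>\<mu>\<close> between two equal entries of \<open>lam\<close> is forced and only increases \<open>c\<close>. Between
  \<open>v\<close> and a smaller \<open>u\<close> the entry \<open>w\<close> is free; the tail then starts with \<open>c = 0\<close> and with \<open>e = 1\<close>
  if and only if \<open>w = u\<close>, and \<open>telescope_powers\<close> sums over \<open>w\<close>.
\<close>

lemma interlace_sum_padded:
  fixes t :: real
  assumes "t \<noteq> 0" "sorted_wrt (\<ge>) (v # r)" "z = last (v # r)" "e \<le> 1"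
  shows "(\<Sum>\<mu> | prec_P \<mu> (v # r). t powi interlace_wt s (v # r) \<mu> *
      drop_prod t s z (replicate c v @ v # r) (replicate (c + e) v @ \<mu>)) =
    (if e = 0 then 1 - t powi (int c + int (length (v # r)) + s) else 1)"
  using assms(2-4)
proof (induction r arbitrary: v c e)
  case Nil
  have "drop_prod t s z (replicate c v @ [v]) (replicate (c + e) v) =
    (\<Prod>x\<in>{v}. if count_list (replicate c v @ [v]) x = count_list (replicate (c + e) v) x + 1
     then 1 - t powi (int (count_list (replicate c v @ [v]) x) + (if x = z then s else 0)) else 1)"
    by (rule drop_prod_eq) auto
  then show ?case using Nil
    by (auto simp: prec_P_singleton count_list_replicate algebra_simps)
next
  case (Cons u r)
  show ?case
  proof (cases "u = v")
    case True
    have rep: "replicate c v @ v # v # r = replicate (Suc c) v @ v # r"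
      "replicate (c + e) v @ v # \<mu> = replicate (Suc (c + e)) v @ \<mu>" for \<mu> :: "int list"
      by (simp_all add: replicate_app_Cons_same)
    have "(\<Sum>\<mu> | prec_P \<mu> (v # u # r). t powi interlace_wt s (v # u # r) \<mu> *
      drop_prod t s z (replicate c v @ v # u # r) (replicate (c + e) v @ \<mu>)) =
      (\<Sum>\<mu> | prec_P \<mu> (v # r). t powi interlace_wt s (v # r) \<mu> *
      drop_prod t s z (replicate (Suc c) v @ v # r) (replicate (Suc c + e) v @ \<mu>))"
      unfolding sum_prec_P_Cons True by (simp add: rep del: replicate_Suc)
    also have "\<dots> = (if e = 0 then 1 - t powi (int (Suc c) + int (length (v # r)) + s) else 1)"
      by (rule Cons.IH) (use Cons.prems True in auto)
    finally show ?thesis by (simp add: algebra_simps)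
  next
    case False
    then have uv: "u < v" using Cons.prems by auto
    define x where "x = t powi (int (length (u # r)) + s)"
    have le: "\<forall>y\<in>set (u # r). y \<le> u" using Cons.prems by auto
    have zu: "z \<le> u" using Cons.prems(2) le last_in_set[of "u # r"] by auto
    have "(\<Sum>\<mu> | prec_P \<mu> (v # u # r). t powi interlace_wt s (v # u # r) \<mu> *
      drop_prod t s z (replicate c v @ v # u # r) (replicate (c + e) v @ \<mu>)) =
      (\<Sum>w\<in>{u..v}. x powi (v - w) * (if e = 0 \<and> w \<noteq> v then 1 - t ^ Suc c else 1) *
        (\<Sum>\<mu> | prec_P \<mu> (u # r). t powi interlace_wt s (u # r) \<mu> *
      drop_prod t s z (replicate 0 u @ u # r) (replicate (0 + (if w = u then 1 else 0)) u @ \<mu>)))"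
      unfolding sum_prec_P_Cons sum_distrib_left
    proof (intro sum.cong refl)
      fix w \<mu> assume w: "w \<in> {u..v}" and "\<mu> \<in> {\<mu>. prec_P \<mu> (u # r)}"
      then have "\<forall>y\<in>set \<mu>. y \<le> u" using prec_P_le_hd[of \<mu> "u # r"] Cons.prems by auto
      from drop_prod_Cons_greater[OF uv le this zu, of w t s c e]
      show "t powi interlace_wt s (v # u # r) (w # \<mu>) *
          drop_prod t s z (replicate c v @ v # u # r) (replicate (c + e) v @ w # \<mu>) =
        x powi (v - w) * (if e = 0 \<and> w \<noteq> v then 1 - t ^ Suc c else 1) *
        (t powi interlace_wt s (u # r) \<mu> *
         drop_prod t s z (replicate 0 u @ u # r) (replicate (0 + (if w = u then 1 else 0)) u @ \<mu>))"
        using w assms(1) by (simp add: x_def power_int_add power_int_mult)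
    qed
    also have "\<dots> = (\<Sum>w\<in>{u..v}. x powi (v - w) * (if e = 0 \<and> w \<noteq> v then 1 - t ^ Suc c else 1) *
        (if w = u then 1 else 1 - x))"
      by (intro sum.cong refl arg_cong2[of _ _ _ _ "(*)"], subst Cons.IH)
         (use Cons.prems in \<open>auto simp: x_def\<close>)
    also have "{u..v} = insert v {u..<v}" using uv by auto
    also have "(\<Sum>w\<in>insert v {u..<v}. x powi (v - w) * (if e = 0 \<and> w \<noteq> v then 1 - t ^ Suc c else 1) *
        (if w = u then 1 else 1 - x)) = (1 - x) + (\<Sum>w\<in>{u..<v}. (if e = 0 then 1 - t ^ Suc c else 1) * (x powi (v - w) *
        (if w = u then 1 else 1 - x)))"
      using uv by (subst sum.insert) (auto intro!: sum.cong)
    also have "\<dots> = (1 - x) + (if e = 0 then 1 - t ^ Suc c else 1) * x"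
      by (simp only: sum_distrib_left[symmetric] telescope_powers[OF uv])
    also have "\<dots> = (if e = 0 then 1 - t powi (int c + int (length (v # u # r)) + s) else 1)"
    proof -
      have "t powi (int c + int (length (v # u # r)) + s) = t powi (int (Suc c) + (int (length (u # r)) + s))"
        by (rule arg_cong) simp
      also have "\<dots> = t ^ Suc c * x" unfolding x_def using assms(1)
        by (subst power_int_add) (simp_all only: power_int_of_nat simp_thms)
      finally show ?thesis by (simp only: ) (simp add: algebra_simps)
    qed
    finally show ?thesis .
  qed
qed

lemma interlace_sum:
  fixes t :: real
  assumes "t \<noteq> 0" "sorted_wrt (\<ge>) lam" "lam \<noteq> []"
  shows "(\<Sum>\<mu> | prec_P \<mu> lam. t powi interlace_wt s lam \<mu> *
      drop_prod t s (last lam) lam \<mu>) = 1 - t powi (int (length lam) + s)"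
  using assms interlace_sum_padded[of t "hd lam" "tl lam" "last lam" 0 s 0]
  by (cases lam) auto

section \<open>Sums over chains\<close>

lemma chains_0: "chains R 0 \<alpha> \<beta> = (if \<alpha> = \<beta> then {[\<alpha>]} else {})"
  unfolding chains_def by (auto simp: length_Suc_conv)

lemma chains_Suc:
  "chains R (Suc r) \<alpha> \<beta> = (\<lambda>(\<gamma>, c). c @ [\<beta>]) ` (SIGMA \<gamma>:{\<gamma>. R \<gamma> \<beta>}. chains R r \<alpha> \<gamma>)"
  (is "?l = ?r")
proof (rule subset_antisym; rule subsetI)
  fix c assume c: "c \<in> ?l"
  then have l: "length c = Suc (Suc r)" and "c \<noteq> []" by (auto simp: chains_def)
  then have "last c = \<beta>" using c by (simp add: chains_def last_conv_nth)
  then have c': "c = butlast c @ [\<beta>]" using append_butlast_last_id[OF \<open>c \<noteq> []\<close>] by simp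
  have "butlast c \<in> chains R r \<alpha> (c ! r)" "R (c ! r) \<beta>"
    using c l by (auto simp: chains_def nth_butlast)
  then show "c \<in> ?r" using c' by (auto simp: image_iff intro!: exI[of _ "c ! r"] bexI[of _ "butlast c"])
next
  fix c assume "c \<in> ?r"
  then obtain \<gamma> d where d: "c = d @ [\<beta>]" "R \<gamma> \<beta>" "d \<in> chains R r \<alpha> \<gamma>" by auto
  then show "c \<in> ?l" by (auto simp: chains_def nth_append less_Suc_eq)
qed

lemma finite_chains:
  assumes "\<And>\<beta> r. finite {\<gamma>. R \<gamma> \<beta> \<and> chains R r \<alpha> \<gamma> \<noteq> {}}"
  shows "finite (chains R r \<alpha> \<beta>)"
proof (induction r arbitrary: \<beta>)
  case (Suc r)
  have "(SIGMA \<gamma>:{\<gamma>. R \<gamma> \<beta>}. chains R r \<alpha> \<gamma>) =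
    (SIGMA \<gamma>:{\<gamma>. R \<gamma> \<beta> \<and> chains R r \<alpha> \<gamma> \<noteq> {}}. chains R r \<alpha> \<gamma>)" by auto
  then show ?case unfolding chains_Suc using Suc assms by (auto intro!: finite_imageI finite_SigmaI)
qed (simp add: chains_0)

text \<open>
  Splitting off the last step of a chain. The predecessors of \<open>\<beta>\<close> may form an infinite set (their last
  entry is unbounded below for \<open>prec_Q\<close>), so they are replaced by a finite set \<open>S\<close> that contains those
  which can be reached from \<open>\<alpha>\<close>.
\<close>

lemma sum_chains_Suc:
  fixes f :: "int list list \<Rightarrow> real"
  assumes fin: "\<And>\<beta> r. finite {\<gamma>. R \<gamma> \<beta> \<and> chains R r \<alpha> \<gamma> \<noteq> {}}"
    and S: "finite S" "S \<subseteq> {\<gamma>. R \<gamma> \<beta>}" "\<And>\<gamma>. R \<gamma> \<beta> \<Longrightarrow> chains R r \<alpha> \<gamma> \<noteq> {} \<Longrightarrow> \<gamma> \<in> S"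
  shows "(\<Sum>c\<in>chains R (Suc r) \<alpha> \<beta>. f c) = (\<Sum>\<gamma>\<in>S. \<Sum>c\<in>chains R r \<alpha> \<gamma>. f (c @ [\<beta>]))"
proof -
  have "(SIGMA \<gamma>:{\<gamma>. R \<gamma> \<beta>}. chains R r \<alpha> \<gamma>) = (SIGMA \<gamma>:S. chains R r \<alpha> \<gamma>)"
    using S(2,3) by auto
  moreover have "inj_on (\<lambda>(\<gamma>, c). c @ [\<beta>]) (SIGMA \<gamma>:S. chains R r \<alpha> \<gamma>)"
    by (auto simp: inj_on_def chains_def)
  ultimately show ?thesis unfolding chains_Suc
    using S(1) finite_chains[OF fin]
    by (simp add: sum.reindex sum.Sigma case_prod_unfold)
qed

section \<open>The principal specialization of P\<close>

lemma hl_P_branch: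
  assumes "length lam = Suc n"
  shows "hl_P lam x t = (\<Sum>\<mu> | prec_P \<mu> lam. hl_P \<mu> x t * skew_P lam \<mu> (x n) t)"
proof -
  have fin: "finite {\<gamma>. prec_P \<gamma> \<beta> \<and> chains prec_P r [] \<gamma> \<noteq> {}}" for \<beta> r
    by (rule finite_subset[OF _ finite_prec_P[of \<beta>]]) auto
  have "hl_P lam x t = (\<Sum>\<mu> | prec_P \<mu> lam. \<Sum>c\<in>chains prec_P n [] \<mu>.
      \<Prod>i<Suc n. skew_P ((c @ [lam]) ! Suc i) ((c @ [lam]) ! i) (x i) t)"
    unfolding hl_P_def assms by (rule sum_chains_Suc[OF fin finite_prec_P]) auto
  also have "\<dots> = (\<Sum>\<mu> | prec_P \<mu> lam. hl_P \<mu> x t * skew_P lam \<mu> (x n) t)"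
  proof (rule sum.cong[OF refl])
    fix \<mu> assume "\<mu> \<in> {\<mu>. prec_P \<mu> lam}"
    then have l: "length \<mu> = n" using assms by (simp add: prec_P_def)
    show "(\<Sum>c\<in>chains prec_P n [] \<mu>. \<Prod>i<Suc n. skew_P ((c @ [lam]) ! Suc i) ((c @ [lam]) ! i) (x i) t)
      = hl_P \<mu> x t * skew_P lam \<mu> (x n) t"
      unfolding hl_P_def l sum_distrib_right
      by (rule sum.cong) (auto simp: chains_def nth_append)
  qed
  finally show ?thesis .
qed

definition qfact :: "real \<Rightarrow> nat \<Rightarrow> real" where
  "qfact t n = (\<Prod>i<n. 1 - t ^ Suc i)"

lemma qfact_0 [simp]: "qfact t 0 = 1" and qfact_Suc: "qfact t (Suc n) = qfact t n * (1 - t ^ Suc n)"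
  by (simp_all add: qfact_def)

lemma qfact_pos: "0 < t \<Longrightarrow> t < 1 \<Longrightarrow> 0 < qfact t n"
  unfolding qfact_def by (rule prod_pos) (simp add: power_Suc_less_one del: power_Suc)

text \<open>
  Macdonald's \<open>b\<^sub>\<lambda>(t)\<close>, with the value \<open>0\<close> treated like all others.
\<close>

definition mult_prod :: "real \<Rightarrow> int list \<Rightarrow> real" where
  "mult_prod t lam = (\<Prod>v\<in>set lam. qfact t (count_list lam v))"

lemma mult_prod_eq:
  assumes "finite S" "set lam \<subseteq> S"
  shows "mult_prod t lam = (\<Prod>v\<in>S. qfact t (count_list lam v))"
  unfolding mult_prod_def
  by (rule prod.mono_neutral_cong_left[OF assms]) (auto simp: count_notin)

lemma mult_prod_pos: "0 < t \<Longrightarrow> t < 1 \<Longrightarrow> 0 < mult_prod t lam"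
  unfolding mult_prod_def by (rule prod_pos) (simp add: qfact_pos)

text \<open>
  Macdonald's \<open>n(\<lambda>)\<close>.
\<close>

definition nstat :: "int list \<Rightarrow> int" where
  "nstat lam = (\<Sum>i<length lam. int i * lam ! i)"

lemma length_filter_ge_mono:
  assumes "list_all2 (\<le>) xs (ys :: int list)"
  shows "length (filter (\<lambda>y. a \<le> y) xs) \<le> length (filter (\<lambda>y. a \<le> y) ys)"
  using assms by (induction rule: list_all2_induct) auto

lemma length_filter_ge_split:
  "length (filter (\<lambda>y. a \<le> y) xs) = length (filter (\<lambda>y. a + 1 \<le> y) xs) + count_list xs (a :: int)"
  by (induction xs) auto

lemma prec_P_length_filter:
  assumes "prec_P \<mu> lam"
  shows "length (filter (\<lambda>y. a \<le> y) \<mu>) \<le> length (filter (\<lambda>y. a \<le> y) lam)"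
    and "length (filter (\<lambda>y. a \<le> y) lam) \<le> Suc (length (filter (\<lambda>y. a \<le> y) \<mu>))"
proof -
  have l: "length lam = Suc (length \<mu>)" "lam \<noteq> []" using assms by (auto simp: prec_P_def)
  have 1: "list_all2 (\<le>) \<mu> (butlast lam)" "list_all2 (\<le>) (tl lam) \<mu>"
    using assms l by (auto simp: list_all2_conv_all_nth prec_P_def nth_butlast nth_tl)
  have "length (filter (\<lambda>y. a \<le> y) lam) \<ge> length (filter (\<lambda>y. a \<le> y) (butlast lam))"
    by (subst (1) append_butlast_last_id[OF l(2), symmetric], subst filter_append) simp
  moreover have "length (filter (\<lambda>y. a \<le> y) lam) \<le> Suc (length (filter (\<lambda>y. a \<le> y) (tl lam)))"
    using l by (cases lam) auto
  ultimately show "length (filter (\<lambda>y. a \<le> y) \<mu>) \<le> length (filter (\<lambda>y. a \<le> y) lam)"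
      "length (filter (\<lambda>y. a \<le> y) lam) \<le> Suc (length (filter (\<lambda>y. a \<le> y) \<mu>))"
    using 1[THEN length_filter_ge_mono, of a] by linarith+
qed

text \<open>
  The multiplicity of \<open>v\<close> is the number of entries \<open>\<ge> v\<close> minus the number of entries \<open>\<ge> v + 1\<close>,
  and each of these two numbers drops by \<open>0\<close> or \<open>1\<close> from \<open>lam\<close> to \<open>\<mu>\<close>.
\<close>

lemma prec_P_count:
  assumes "prec_P \<mu> lam"
  shows "count_list \<mu> v \<le> count_list lam v + 1" "count_list lam v \<le> count_list \<mu> v + 1"
  using prec_P_length_filter[OF assms, of v] prec_P_length_filter[OF assms, of "v + 1"]
    length_filter_ge_split[of v lam] length_filter_ge_split[of v \<mu>] by linarith+

text \<open>
  Multiplicities change by at most one, and \<open>qfact\<close> changes by one factor with each change: the rising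
  values turn the factors of \<open>lam\<close> into those of \<open>\<mu>\<close>, the falling ones do the opposite.
\<close>

lemma mult_prod_step:
  assumes "prec_P \<mu> lam"
  shows "mult_prod t lam * (\<Prod>v | count_list \<mu> v = count_list lam v + 1. 1 - t ^ count_list \<mu> v)
    = mult_prod t \<mu> * drop_prod t 0 z lam \<mu>"
proof -
  let ?S = "set \<mu> \<union> set lam"
  have "mult_prod t lam * (\<Prod>v | count_list \<mu> v = count_list lam v + 1. 1 - t ^ count_list \<mu> v)
    = (\<Prod>v\<in>?S. qfact t (count_list lam v) * (if count_list \<mu> v = count_list lam v + 1 then 1 - t ^ count_list \<mu> v else 1))"
    by (subst mult_prod_eq[of ?S], simp, simp, subst prod_over_drops[of ?S], simp, simp, rule prod.distrib[symmetric])
  also have "\<dots> = (\<Prod>v\<in>?S. qfact t (count_list \<mu> v) * (if count_list lam v = count_list \<mu> v + 1 then 1 - t powi (int (count_list lam v) + (if v = z then 0 else 0)) else 1))"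
  proof (rule prod.cong[OF refl])
    fix v
    have "count_list \<mu> v = count_list lam v \<or> count_list \<mu> v = Suc (count_list lam v) \<or> count_list lam v = Suc (count_list \<mu> v)"
      using prec_P_count[OF assms, of v] by linarith
    then show "qfact t (count_list lam v) * (if count_list \<mu> v = count_list lam v + 1 then 1 - t ^ count_list \<mu> v else 1)
      = qfact t (count_list \<mu> v) * (if count_list lam v = count_list \<mu> v + 1 then 1 - t powi (int (count_list lam v) + (if v = z then 0 else 0)) else 1)"
      by (auto simp: qfact_Suc simp del: of_nat_Suc power_Suc)
  qed
  also have "\<dots> = mult_prod t \<mu> * drop_prod t 0 z lam \<mu>"
    by (subst mult_prod_eq[of ?S], simp, simp, subst drop_prod_eq[of ?S], simp, simp, rule prod.distrib)
  finally show ?thesis .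
qed

lemma interlace_wt_eq:
  assumes "length lam = Suc (length \<mu>)"
  shows "interlace_wt s lam \<mu> = (\<Sum>i<length \<mu>. (int (length \<mu>) - int i + s) * (lam ! i - \<mu> ! i))"
  using assms
proof (induction \<mu> arbitrary: lam)
  case Nil
  then show ?case by (auto simp: length_Suc_conv)
next
  case (Cons w \<mu>)
  then obtain v r where lam: "lam = v # r" "length r = Suc (length \<mu>)" by (auto simp: length_Suc_conv)
  show ?case using Cons.IH[OF lam(2)] lam
    by (simp add: sum.lessThan_Suc_shift del: sum.lessThan_Suc)
qed

lemma sum_list_eq_nth: "sum_list xs = (\<Sum>i<length xs. xs ! i)"
  by (simp add: sum_list_sum_nth atLeast0LessThan)

lemma prec_P_sorted: "prec_P \<mu> lam \<Longrightarrow> sorted_wrt (\<ge>) \<mu>"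
proof (induction \<mu> arbitrary: lam)
  case (Cons w \<mu>)
  then obtain v u r where lam: "lam = v # u # r"
    by (auto simp: prec_P_def length_Suc_conv)
  then have p: "prec_P \<mu> (u # r)" "u \<le> w" using Cons.prems by (auto simp: prec_P_Cons)
  have s: "sorted_wrt (\<ge>) \<mu>" using Cons.IH p by blast
  have "y \<le> w" if y: "y \<in> set \<mu>" for y
  proof -
    obtain a b where ab: "\<mu> = a # b" using y by (cases \<mu>) auto
    then have "a \<le> u" using p by (auto simp: prec_P_def)
    then show ?thesis using s ab y p by auto
  qed
  then show ?case using s by simp
qed simp

text \<open>
  Induction by the branching rule. Once the closed form for \<open>\<mu>\<close> is inserted, the dependence on \<open>\<mu>\<close> is
  exactly the summand of \<open>interlace_sum\<close> with \<open>s = 0\<close>, whose sum \<open>1 - t ^ n\<close> is the new factor of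
  \<open>qfact\<close>.
\<close>

lemma hl_P_principal:
  assumes t: "0 < t" "t < 1" and "sorted_wrt (\<ge>) lam"
  shows "hl_P lam (\<lambda>i. t ^ i) t = t powi nstat lam * qfact t (length lam) / mult_prod t lam"
  using assms(3)
proof (induction "length lam" arbitrary: lam)
  case 0
  then show ?case by (simp add: hl_P_def chains_0 nstat_def mult_prod_def)
next
  case (Suc n)
  let ?z = "last lam"
  have "hl_P lam (\<lambda>i. t ^ i) t = (\<Sum>\<mu> | prec_P \<mu> lam. hl_P \<mu> (\<lambda>i. t ^ i) t * skew_P lam \<mu> (t ^ n) t)"
    by (rule hl_P_branch) (simp add: Suc)
  also have "\<dots> = (\<Sum>\<mu> | prec_P \<mu> lam. t powi nstat lam * qfact t n / mult_prod t lam *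
      (t powi interlace_wt 0 lam \<mu> * drop_prod t 0 ?z lam \<mu>))"
  proof (rule sum.cong[OF refl])
    fix \<mu> assume "\<mu> \<in> {\<mu>. prec_P \<mu> lam}"
    then have p: "prec_P \<mu> lam" and l: "length \<mu> = n" "length lam = Suc (length \<mu>)"
      using Suc by (auto simp: prec_P_def)
    have "nstat \<mu> + int n * (sum_list lam - sum_list \<mu>) = nstat lam + interlace_wt 0 lam \<mu>"
      unfolding interlace_wt_eq[OF l(2)] nstat_def sum_list_eq_nth l sum.lessThan_Suc
      by (simp add: algebra_simps sum.distrib sum_distrib_left sum_subtractf)
    then have "t powi nstat \<mu> * (t ^ n) powi (sum_list lam - sum_list \<mu>) = t powi nstat lam * t powi interlace_wt 0 lam \<mu>"
      using t by (simp flip: power_int_add power_int_of_nat power_int_mult)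
    note exps = this
    have drop: "(\<Prod>v | count_list \<mu> v = count_list lam v + 1. 1 - t ^ count_list \<mu> v)
        = mult_prod t \<mu> * drop_prod t 0 ?z lam \<mu> / mult_prod t lam"
      using mult_prod_step[OF p, of t ?z] mult_prod_pos[OF t, of lam]
      by (simp add: nonzero_eq_divide_eq mult.commute)
    have "hl_P \<mu> (\<lambda>i. t ^ i) t * skew_P lam \<mu> (t ^ n) t =
        (t powi nstat \<mu> * (t ^ n) powi (sum_list lam - sum_list \<mu>)) * qfact t n *
        (drop_prod t 0 ?z lam \<mu> / mult_prod t lam)"
      using Suc.hyps(1)[OF l(1)[symmetric] prec_P_sorted[OF p]] p mult_prod_pos[OF t, of \<mu>] l(1)
      unfolding skew_P_def drop by simp
    then show "hl_P \<mu> (\<lambda>i. t ^ i) t * skew_P lam \<mu> (t ^ n) t = t powi nstat lam * qfact t n / mult_prod t lam *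
      (t powi interlace_wt 0 lam \<mu> * drop_prod t 0 ?z lam \<mu>)"
      unfolding exps by simp
  qed
  also have "\<dots> = t powi nstat lam * qfact t n / mult_prod t lam * (1 - t powi (int (length lam) + 0))"
    unfolding sum_distrib_left[symmetric]
    by (subst interlace_sum) (use t Suc in auto)
  also have "\<dots> = t powi nstat lam * qfact t (length lam) / mult_prod t lam"
    by (simp add: Suc(2)[symmetric] qfact_Suc del: of_nat_Suc)
  finally show ?case .
qed

section \<open>The principal specialization of Q\<close>

definition npos :: "int list \<Rightarrow> nat" where
  "npos lam = length (filter (\<lambda>x. 0 < x) lam)"

text \<open>
  The product \<open>(1 - t^r) (1 - t^(r-1)) \<dots>\<close> of \<open>l\<close> factors. For \<open>l > r\<close> it contains the factor \<open>1 - t^0\<close> and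
  vanishes; this accounts for the vanishing of Q in fewer variables than \<open>lam\<close> has positive parts.
\<close>

definition falling :: "real \<Rightarrow> nat \<Rightarrow> nat \<Rightarrow> real" where
  "falling t r l = (\<Prod>i<l. 1 - t ^ (r - i))"

lemma falling_0 [simp]: "falling t r 0 = 1"
  by (simp add: falling_def)

lemma falling_eq_0: "r < l \<Longrightarrow> falling t r l = 0"
  unfolding falling_def by (rule prod_zero) (auto intro!: bexI[of _ r])

lemma falling_Suc: "falling t r (Suc l) = falling t r l * (1 - t ^ (r - l))"
  by (simp add: falling_def)

lemma falling_Suc_Suc: "falling t (Suc r) (Suc l) = (1 - t ^ Suc r) * falling t r l"
  unfolding falling_def by (subst prod.lessThan_Suc_shift) simp

lemma chain_prec_Q_nonneg:
  assumes "c \<in> chains prec_Q r (replicate n 0) \<gamma>"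
  shows "length \<gamma> = n \<and> (\<forall>x\<in>set \<gamma>. 0 \<le> x)"
  using assms
proof (induction r arbitrary: c \<gamma>)
  case (Suc r)
  then obtain \<delta> d where "prec_Q \<delta> \<gamma>" "d \<in> chains prec_Q r (replicate n 0) \<delta>"
    unfolding chains_Suc by auto
  then have "prec_Q \<delta> \<gamma>" "length \<delta> = n" "\<forall>x\<in>set \<delta>. 0 \<le> x" using Suc.IH[of d \<delta>] by auto
  then show ?case
    by (auto simp: prec_Q_def in_set_conv_nth) (meson nth_mem order_trans)
qed (auto simp: chains_0 split: if_splits)

text \<open>
  This is what makes \<open>interlace_sum\<close> applicable to Q.
\<close>

lemma prec_Q_nonneg_iff_prec_P:
  "prec_Q \<nu> lam \<and> (\<forall>x\<in>set \<nu>. 0 \<le> x) \<longleftrightarrow> prec_P \<nu> (lam @ [0])"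
proof
  assume a: "prec_Q \<nu> lam \<and> (\<forall>x\<in>set \<nu>. 0 \<le> x)"
  then show "prec_P \<nu> (lam @ [0])"
    by (auto simp: prec_P_def prec_Q_def nth_append)
next
  assume a: "prec_P \<nu> (lam @ [0])"
  have "last (lam @ [0]) \<le> x" if x: "x \<in> set \<nu>" for x
  proof -
    have s: "sorted_wrt (\<ge>) \<nu>" using prec_P_sorted[OF a] .
    have ne: "\<nu> \<noteq> []" using x by auto
    have "last \<nu> \<le> x"
      using s x ne by (induction \<nu>) (auto split: if_splits)
    moreover have "0 \<le> last \<nu>" using a ne
      by (auto simp: prec_P_def last_conv_nth nth_append dest!: spec[of _ "length \<nu> - 1"])
    ultimately show ?thesis by simp
  qed
  then have "\<forall>x\<in>set \<nu>. 0 \<le> x" by simp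
  moreover have "prec_Q \<nu> lam"
    unfolding prec_Q_def
  proof (intro conjI allI impI)
    show l: "length lam = length \<nu>" using a by (simp add: prec_P_def)
    show "\<nu> ! i \<le> lam ! i" if "i < length \<nu>" for i
      using a that l by (auto simp: prec_P_def nth_append)
    show "lam ! Suc i \<le> \<nu> ! i" if i: "Suc i < length \<nu>" for i
    proof -
      have "(lam @ [0]) ! Suc i \<le> \<nu> ! i" using a i by (auto simp: prec_P_def)
      then show ?thesis using i l by (simp add: nth_append)
    qed
  qed
  ultimately show "prec_Q \<nu> lam \<and> (\<forall>x\<in>set \<nu>. 0 \<le> x)" by simp
qed

lemma hl_Q_fin_0:
  "hl_Q_fin 0 lam y t = (if lam = replicate (length lam) 0 then 1 else 0)"
  by (auto simp: hl_Q_fin_def chains_0)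

lemma hl_Q_fin_branch:
  "hl_Q_fin (Suc r) lam y t = (\<Sum>\<nu> | prec_P \<nu> (lam @ [0]). hl_Q_fin r \<nu> y t * skew_Q lam \<nu> (y r) t)"
proof -
  let ?z = "replicate (length lam) (0::int)"
  have fin: "finite {\<gamma>. prec_Q \<gamma> \<beta> \<and> chains prec_Q r ?z \<gamma> \<noteq> {}}" for \<beta> r
    by (rule finite_subset[OF _ finite_prec_P[of "\<beta> @ [0]"]])
       (auto simp flip: prec_Q_nonneg_iff_prec_P dest: chain_prec_Q_nonneg)
  have "hl_Q_fin (Suc r) lam y t = (\<Sum>\<mu> | prec_P \<mu> (lam @ [0]). \<Sum>c\<in>chains prec_Q r ?z \<mu>.
      \<Prod>i<Suc r. skew_Q ((c @ [lam]) ! Suc i) ((c @ [lam]) ! i) (y i) t)"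
    unfolding hl_Q_fin_def
    by (rule sum_chains_Suc[OF fin finite_prec_P])
       (auto simp flip: prec_Q_nonneg_iff_prec_P dest: chain_prec_Q_nonneg)
  also have "\<dots> = (\<Sum>\<mu> | prec_P \<mu> (lam @ [0]). hl_Q_fin r \<mu> y t * skew_Q lam \<mu> (y r) t)"
  proof (rule sum.cong[OF refl])
    fix \<mu> assume "\<mu> \<in> {\<mu>. prec_P \<mu> (lam @ [0])}"
    then have l: "length \<mu> = length lam" by (simp add: prec_P_def)
    show "(\<Sum>c\<in>chains prec_Q r ?z \<mu>. \<Prod>i<Suc r. skew_Q ((c @ [lam]) ! Suc i) ((c @ [lam]) ! i) (y i) t)
      = hl_Q_fin r \<mu> y t * skew_Q lam \<mu> (y r) t"
      unfolding hl_Q_fin_def l sum_distrib_right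
      by (rule sum.cong) (auto simp: chains_def nth_append)
  qed
  finally show ?thesis .
qed

lemma npos_count: "\<forall>x\<in>set lam. 0 \<le> x \<Longrightarrow> npos lam + count_list lam 0 = length lam"
  unfolding npos_def by (induction lam) auto

lemma npos_eq_0_iff: "\<forall>x\<in>set lam. 0 \<le> x \<Longrightarrow> npos lam = 0 \<longleftrightarrow> (\<forall>x\<in>set lam. x = 0)"
  unfolding npos_def by (force simp: filter_empty_conv)

text \<open>
  The two products agree away from the value \<open>0\<close>. The multiplicity of \<open>0\<close> drops from \<open>lam @ [0]\<close> to \<open>\<nu>\<close>
  precisely when \<open>\<nu>\<close> has as many positive parts as \<open>lam\<close>, and the shift \<open>s\<close> is chosen such that the
  factor contributed by \<open>0\<close> is then the last factor of \<open>falling t r (npos \<nu>)\<close>.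
\<close>

lemma falling_drop_step:
  fixes t :: real and lam \<nu> :: "int list"
  assumes p: "prec_P \<nu> (lam @ [0])" and nn: "\<forall>x\<in>set lam. 0 \<le> x" "npos lam \<noteq> 0"
  shows "falling t r (npos \<nu>) * (\<Prod>v | count_list lam v = count_list \<nu> v + 1. 1 - t ^ count_list lam v) =
    falling t r (npos lam - 1) * drop_prod t (int r - int (length lam)) 0 (lam @ [0]) \<nu>"
proof -
  let ?s = "int r - int (length lam)"
  have nn': "\<forall>x\<in>set \<nu>. 0 \<le> x" and l: "length \<nu> = length lam"
    using p prec_Q_nonneg_iff_prec_P[of \<nu> lam] by (blast, simp add: prec_P_def)
  have c0: "count_list lam 0 = length lam - npos lam" "count_list \<nu> 0 = length lam - npos \<nu>"
      "npos lam \<le> length lam" "npos \<nu> \<le> length lam"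
    using npos_count[OF nn(1)] npos_count[OF nn'] l by linarith+
  have "filter (\<lambda>x. 1 \<le> x) xs = filter (\<lambda>x. 0 < x) xs" for xs :: "int list"
    by (rule filter_cong) auto
  then have le: "npos \<nu> = npos lam \<or> Suc (npos \<nu>) = npos lam"
    using prec_P_length_filter[OF p, of 1] unfolding npos_def by auto
  define T where "T = (set lam \<union> set \<nu>) - {0}"
  have T: "finite T" "0 \<notin> T" "set lam \<subseteq> insert 0 T" "set (lam @ [0]) \<subseteq> insert 0 T"
    unfolding T_def by (simp, simp, blast, simp, blast)
  define R where "R = (\<Prod>v\<in>T.
    if count_list lam v = count_list \<nu> v + 1 then 1 - t ^ count_list lam v else 1)"
  have R1: "(\<Prod>v | count_list lam v = count_list \<nu> v + 1. 1 - t ^ count_list lam v) = R"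
  proof -
    have "count_list lam 0 \<noteq> count_list \<nu> 0 + 1" using c0 le nn(2) by arith
    then show ?thesis using T unfolding R_def
      by (subst prod_over_drops[of "insert 0 T"]) auto
  qed
  have R2: "drop_prod t ?s 0 (lam @ [0]) \<nu> =
      (if npos \<nu> = npos lam then 1 - t powi (int r + 1 - int (npos lam)) else 1) * R"
  proof -
    have "drop_prod t ?s 0 (lam @ [0]) \<nu> =
      (if count_list lam 0 = count_list \<nu> 0 then 1 - t powi (int (count_list lam 0) + 1 + ?s) else 1) * R"
    proof -
      let ?F = "\<lambda>v. if count_list (lam @ [0]) v = count_list \<nu> v + 1
          then 1 - t powi (int (count_list (lam @ [0]) v) + (if v = 0 then ?s else 0)) else 1"
      have "drop_prod t ?s 0 (lam @ [0]) \<nu> = prod ?F (insert 0 T)"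
        by (rule drop_prod_eq) (use T in simp_all)
      also have "\<dots> = ?F 0 * prod ?F T" by (rule prod.insert[OF T(1,2)])
      also have "prod ?F T = R"
        unfolding R_def by (rule prod.cong) (use T in \<open>auto simp del: of_nat_Suc power_Suc\<close>)
      also have "?F 0 = (if count_list lam 0 = count_list \<nu> 0 then 1 - t powi (int (count_list lam 0) + 1 + ?s) else 1)"
        by (auto simp: algebra_simps)
      finally show ?thesis .
    qed
    moreover have "count_list lam 0 = count_list \<nu> 0 \<longleftrightarrow> npos \<nu> = npos lam"
      using c0 by linarith
    moreover have "int (count_list lam 0) + 1 + ?s = int r + 1 - int (npos lam)"
      using c0 by linarith
    ultimately show ?thesis by (simp only:)
  qed
  have "falling t r (npos \<nu>) = falling t r (npos lam - 1) *
      (if npos \<nu> = npos lam then 1 - t powi (int r + 1 - int (npos lam)) else 1)"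
  proof (cases "npos \<nu> = npos lam")
    case True
    obtain l where l: "npos lam = Suc l" using nn(2) by (cases "npos lam") auto
    show ?thesis
    proof (cases "r < l")
      case False
      then have e: "int r + 1 - int (npos lam) = int (r - l)" using l by auto
      show ?thesis unfolding True e by (simp add: l falling_Suc)
    qed (use True l falling_eq_0 in auto)
  next
    case False
    then have "npos lam - 1 = npos \<nu>" using le by arith
    then show ?thesis using False by simp
  qed
  then show ?thesis unfolding R1 R2 by simp
qed

text \<open>
  Induction on the number of variables by the branching rule, with \<open>interlace_sum\<close> applied to
  \<open>lam @ [0]\<close> and \<open>s = r - length lam\<close>. The zero signature, which is its own only predecessor, is treated
  separately because \<open>falling_drop_step\<close> splits off a factor that exists only for a positive part.
\<close>

lemma hl_Q_fin_principal:
  assumes t: "0 < t" "t < 1" and "sorted_wrt (\<ge>) lam" "\<forall>x\<in>set lam. 0 \<le> x"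
  shows "hl_Q_fin r lam (\<lambda>j. t ^ (k + j)) t =
    t powi (int k * sum_list lam + nstat lam) * falling t r (npos lam)"
  using assms(3,4)
proof (induction r arbitrary: lam)
  case 0
  show ?case
  proof (cases "npos lam = 0")
    case True
    then have z: "\<forall>x\<in>set lam. x = 0" using npos_eq_0_iff[OF 0(2)] by simp
    then have "lam = replicate (length lam) 0" by (simp add: replicate_length_same)
    moreover have "sum_list lam = 0"
      unfolding sum_list_eq_nth by (rule sum.neutral) (use z in simp)
    moreover have "nstat lam = 0"
      unfolding nstat_def by (rule sum.neutral) (use z in simp)
    ultimately show ?thesis using True by (simp add: hl_Q_fin_0)
  next
    case False
    moreover have "lam \<noteq> replicate (length lam) 0"
      using False npos_eq_0_iff[OF 0(2)] by (metis in_set_replicate)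
    ultimately show ?thesis by (simp add: hl_Q_fin_0 falling_eq_0)
  qed
next
  case (Suc r)
  have IH: "hl_Q_fin r \<nu> (\<lambda>j. t ^ (k + j)) t = t powi (int k * sum_list \<nu> + nstat \<nu>) * falling t r (npos \<nu>)"
    if "prec_P \<nu> (lam @ [0])" for \<nu>
    using Suc.IH[of \<nu>] prec_P_sorted[OF that] that by (simp flip: prec_Q_nonneg_iff_prec_P)
  show ?case
  proof (cases "npos lam = 0")
    case True
    then have z: "\<forall>x\<in>set lam. x = 0" using npos_eq_0_iff[OF Suc.prems(2)] by simp
    have "\<nu> = lam" if "prec_P \<nu> (lam @ [0])" for \<nu>
    proof (rule nth_equalityI)
      show "length \<nu> = length lam" using that by (simp add: prec_P_def)
      fix i assume "i < length \<nu>"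
      with that z show "\<nu> ! i = lam ! i"
        by (simp add: prec_Q_def in_set_conv_nth flip: prec_Q_nonneg_iff_prec_P) (metis nth_mem order_antisym)
    qed
    moreover have q: "prec_Q lam lam" using z by (simp add: prec_Q_def all_set_conv_all_nth)
    then have "prec_P lam (lam @ [0])" using Suc.prems by (simp flip: prec_Q_nonneg_iff_prec_P)
    ultimately have s: "{\<nu>. prec_P \<nu> (lam @ [0])} = {lam}" by auto
    then have "prec_P lam (lam @ [0])" by auto
    then show ?thesis unfolding hl_Q_fin_branch s using q True
      by (simp add: IH skew_Q_def)
  next
    case False
    let ?s = "int r - int (length lam)"
    let ?C = "t powi (int k * sum_list lam + nstat lam) * falling t r (npos lam - 1)"
    have "hl_Q_fin (Suc r) lam (\<lambda>j. t ^ (k + j)) t = (\<Sum>\<nu> | prec_P \<nu> (lam @ [0]).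
        ?C * (t powi interlace_wt ?s (lam @ [0]) \<nu> * drop_prod t ?s (last (lam @ [0])) (lam @ [0]) \<nu>))"
      unfolding hl_Q_fin_branch
    proof (rule sum.cong[OF refl])
      fix \<nu> assume "\<nu> \<in> {\<nu>. prec_P \<nu> (lam @ [0])}"
      then have p: "prec_P \<nu> (lam @ [0])" and q: "prec_Q \<nu> lam" and l: "length lam = length \<nu>"
        using prec_Q_nonneg_iff_prec_P[of \<nu> lam] by (blast, blast, simp add: prec_P_def)
      have "interlace_wt ?s (lam @ [0]) \<nu> = (\<Sum>i<length \<nu>. (int r - int i) * (lam ! i - \<nu> ! i))"
        using l by (subst interlace_wt_eq) (auto simp: nth_append intro!: sum.cong)
      then have "int k * sum_list \<nu> + nstat \<nu> + int (k + r) * (sum_list lam - sum_list \<nu>) =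
          int k * sum_list lam + nstat lam + interlace_wt ?s (lam @ [0]) \<nu>"
        unfolding nstat_def sum_list_eq_nth l
        by (simp add: algebra_simps sum.distrib sum_distrib_left sum_subtractf)
      then have exps: "t powi (int k * sum_list \<nu> + nstat \<nu>) * (t ^ (k + r)) powi (sum_list lam - sum_list \<nu>) =
          t powi (int k * sum_list lam + nstat lam) * t powi interlace_wt ?s (lam @ [0]) \<nu>"
        using t by (simp flip: power_int_add power_int_of_nat power_int_mult)
      have "hl_Q_fin r \<nu> (\<lambda>j. t ^ (k + j)) t * skew_Q lam \<nu> (t ^ (k + r)) t =
         (t powi (int k * sum_list \<nu> + nstat \<nu>) * (t ^ (k + r)) powi (sum_list lam - sum_list \<nu>)) *
         (falling t r (npos \<nu>) * (\<Prod>v | count_list lam v = count_list \<nu> v + 1. 1 - t ^ count_list lam v))"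
        using IH[OF p] q by (simp add: skew_Q_def)
      also have "\<dots> = ?C * (t powi interlace_wt ?s (lam @ [0]) \<nu> * drop_prod t ?s (last (lam @ [0])) (lam @ [0]) \<nu>)"
        unfolding exps falling_drop_step[OF p Suc.prems(2) False] by simp
      finally show "hl_Q_fin r \<nu> (\<lambda>j. t ^ (k + j)) t * skew_Q lam \<nu> (t ^ (k + r)) t = \<dots>" .
    qed
    also have "\<dots> = ?C * (1 - t powi (int (length (lam @ [0])) + ?s))"
      unfolding sum_distrib_left[symmetric]
      by (subst interlace_sum) (use t Suc.prems in \<open>auto simp: sorted_wrt_append\<close>)
    also have "int (length (lam @ [0])) + ?s = int (Suc r)" by simp
    also have "?C * (1 - t powi int (Suc r)) =
        t powi (int k * sum_list lam + nstat lam) * falling t (Suc r) (npos lam)"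
      using False by (cases "npos lam") (auto simp: falling_Suc_Suc simp del: of_nat_Suc)
    finally show ?thesis .
  qed
qed

lemma falling_tendsto_1:
  assumes "0 < t" "t < 1"
  shows "(\<lambda>r. falling t r l) \<longlonglongrightarrow> 1"
proof -
  have "(\<lambda>r. 1 - t ^ (r - i)) \<longlonglongrightarrow> 1 - 0" for i
    by (intro tendsto_diff tendsto_const LIMSEQ_offset[of "\<lambda>r. t ^ (r - i)" i])
       (use assms in \<open>simp add: LIMSEQ_power_zero\<close>)
  then have "(\<lambda>r. \<Prod>i<l. 1 - t ^ (r - i)) \<longlonglongrightarrow> (\<Prod>i<l. 1)"
    by (intro tendsto_prod) simp
  then show ?thesis by (simp add: falling_def)
qed

lemma hl_Q_principal:
  assumes t: "0 < t" "t < 1" and "sorted_wrt (\<ge>) lam" "\<forall>x\<in>set lam. 0 \<le> x"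
  shows "hl_Q lam (\<lambda>j. t ^ (k + j)) t = t powi (int k * sum_list lam + nstat lam)"
  unfolding hl_Q_def hl_Q_fin_principal[OF assms]
  by (rule limI) (use tendsto_mult[OF tendsto_const falling_tendsto_1[OF t]] in simp)

section \<open>The Cauchy kernel\<close>

lemma prodinf_telescope:
  fixes t c :: real
  assumes t: "0 < t" "t < 1" and c: "0 < c" "c < 1"
  shows "(\<Prod>j. (1 - c * t ^ Suc j) / (1 - c * t ^ j)) = 1 / (1 - c)"
proof -
  have pos: "0 < 1 - c * t ^ j" for j
  proof -
    have "c * t ^ j \<le> c * 1" using t c by (intro mult_left_mono power_le_one) auto
    then show ?thesis using c by linarith
  qed
  have "(\<Prod>j\<le>J. (1 - c * t ^ Suc j) / (1 - c * t ^ j)) = (1 - c * t ^ Suc J) / (1 - c)" for J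
  proof (induction J)
    case (Suc J)
    then show ?case using pos[of "Suc J"] by (simp del: power_Suc)
  qed (use c in simp)
  moreover have "(\<lambda>J. (1 - c * t ^ Suc J) / (1 - c)) \<longlonglongrightarrow> (1 - c * 0) / (1 - c)"
    using t c by (intro tendsto_intros LIMSEQ_Suc LIMSEQ_power_zero) auto
  ultimately have "raw_has_prod (\<lambda>j. (1 - c * t ^ Suc j) / (1 - c * t ^ j)) 0 (1 / (1 - c))"
    using c unfolding raw_has_prod_def by simp
  then show ?thesis by (intro has_prod_unique[symmetric]) (simp add: has_prod_def)
qed

lemma cauchy_kernel_principal:
  assumes t: "0 < t" "t < 1" and k: "1 \<le> k"
  shows "cauchy_kernel n (\<lambda>i. t ^ i) (\<lambda>j. t ^ (k + j)) t = 1 / (\<Prod>i<n. 1 - t ^ (k + i))"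
proof -
  have "(\<Prod>j. (1 - t * t ^ i * t ^ (k + j)) / (1 - t ^ i * t ^ (k + j))) = 1 / (1 - t ^ (k + i))" for i
    using prodinf_telescope[OF t, of "t ^ (k + i)"] t k power_strict_decreasing[of 0 "k + i" t]
    by (simp add: power_add mult_ac)
  then show ?thesis unfolding cauchy_kernel_def by (simp add: prod_dividef)
qed

section \<open>Divisibility and units in the p-adic integers\<close>

lemma residue_seq_of_int:
  "residue_seq (of_int a :: 'p::prime_card padic_int) k = a mod int CARD('p) ^ k"
proof -
  have nat: "residue_seq (of_nat n :: 'p padic_int) k = int n mod int CARD('p) ^ k" for n
    by (induction n) (auto simp: zero_padic_int.rep_eq plus_padic_int.rep_eq one_padic_int.rep_eq mod_simps)
  show ?thesis
  proof (cases a rule: int_cases2)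
    case (nonneg n)
    then show ?thesis using nat by simp
  next
    case (nonpos n)
    then show ?thesis using nat[of n] by (simp add: uminus_padic_int.rep_eq mod_simps)
  qed
qed

definition pp :: "'p::prime_card padic_int" where
  "pp = of_nat CARD('p)"

lemma residue_seq_pp_power: "residue_seq (pp ^ j :: 'p::prime_card padic_int) k = int CARD('p) ^ j mod int CARD('p) ^ k"
  using residue_seq_of_int[of "int CARD('p) ^ j" k, where 'p='p] by (simp add: pp_def)

text \<open>
  If the residue modulo \<open>p^k\<close> vanishes, then the numbers \<open>residue_seq x (j + k) div p^k\<close> are the residues
  of the quotient.
\<close>

lemma pp_power_dvd_iff:
  fixes x :: "'p::prime_card padic_int"
  shows "pp ^ k dvd x \<longleftrightarrow> residue_seq x k = 0"
proof
  assume "pp ^ k dvd x"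
  then obtain y where "x = pp ^ k * y" by (elim dvdE)
  then show "residue_seq x k = 0" by (simp add: times_padic_int.rep_eq residue_seq_pp_power)
next
  assume 0: "residue_seq x k = 0"
  let ?p = "int CARD('p)"
  have p: "0 < ?p" by (rule p_pos)
  define y where "y j = residue_seq x (j + k) div ?p ^ k" for j
  have dv: "residue_seq x (j + k) = ?p ^ k * y j" for j
    using residue_seq_mod_le[of k "j + k" x] 0 by (simp add: y_def mod_0_imp_dvd)
  have y: "y \<in> {x. \<forall>k. x k \<in> {0..<?p ^ k} \<and> x (Suc k) mod ?p ^ k = x k}"
  proof (clarify, intro conjI)
    fix j
    have "residue_seq x (j + k) \<in> {0..<?p ^ (j + k)}" using residue_seq[of x] by auto
    then have "0 \<le> ?p ^ k * y j" "?p ^ k * y j < ?p ^ k * ?p ^ j"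
      unfolding dv by (auto simp: power_add mult.commute)
    then show "y j \<in> {0..<?p ^ j}" using zero_less_power[OF p, of k]
      by (auto simp: zero_le_mult_iff)
    have "(?p ^ k * y (Suc j)) mod (?p ^ k * ?p ^ j) = ?p ^ k * y j"
      using residue_seq_mod_le[of "j + k" "Suc j + k" x] dv[of j] dv[of "Suc j"] by (simp add: power_add mult_ac)
    then show "y (Suc j) mod ?p ^ j = y j" using p by (simp flip: mult_mod_right)
  qed
  have "x = pp ^ k * Abs_padic_int y"
  proof (rule residue_seq_inject[THEN iffD1], rule ext)
    fix j
    have "residue_seq (pp ^ k * Abs_padic_int y :: 'p padic_int) j = (?p ^ k * y j) mod ?p ^ j"
      by (simp add: times_padic_int.rep_eq Abs_padic_int_inverse[OF y] residue_seq_pp_power mod_simps)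
    also have "\<dots> = residue_seq x j" using residue_seq_mod_le[of j "j + k" x] by (simp add: dv)
    finally show "residue_seq x j = residue_seq (pp ^ k * Abs_padic_int y :: 'p padic_int) j" by simp
  qed
  then show "pp ^ k dvd x" by simp
qed

text \<open>
  Reduction to the residue field.
\<close>

definition red :: "'p::prime_card padic_int \<Rightarrow> 'p mod_ring" where
  "red x = of_int (residue_seq x 1)"

lemma of_int_mod_ring_eq_iff:
  "(of_int a :: 'p::prime_card mod_ring) = of_int b \<longleftrightarrow> a mod int CARD('p) = b mod int CARD('p)"
  unfolding of_int_of_int_mod_ring by transfer simp

lemma red_eq_0_iff: "red x = 0 \<longleftrightarrow> pp dvd x"
proof -
  have "red x = 0 \<longleftrightarrow> residue_seq x 1 mod int CARD('a) = 0"
    using of_int_mod_ring_eq_iff[of "residue_seq x 1" 0] by (simp add: red_def)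
  then show ?thesis using pp_power_dvd_iff[of 1 x] residue_seq_mod_self[of x 1] by simp
qed

interpretation red: comm_ring_hom red
proof -
  have *: "of_int (a mod int CARD('p)) = (of_int a :: 'p::prime_card mod_ring)" for a
    by (simp add: of_int_mod_ring_eq_iff)
  show "comm_ring_hom (red :: 'p::prime_card padic_int \<Rightarrow> _)"
    by standard (simp_all add: red_def zero_padic_int.rep_eq one_padic_int.rep_eq
      plus_padic_int.rep_eq times_padic_int.rep_eq *)
qed

text \<open>
  The inverses of the residues modulo \<open>p^k\<close> are unique, hence coherent, hence form a \<open>p\<close>-adic integer.
\<close>

lemma unit_iff_red:
  fixes x :: "'p::prime_card padic_int"
  shows "x dvd 1 \<longleftrightarrow> red x \<noteq> 0"
proof
  assume "x dvd 1"
  then obtain y where "1 = x * y" by (elim dvdE)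
  then have "red x * red y = 1" by (metis red.hom_mult red.hom_one)
  then show "red x \<noteq> 0" by auto
next
  let ?p = "int CARD('p)"
  assume "red x \<noteq> 0"
  then have nd: "\<not> ?p dvd residue_seq x 1"
    using pp_power_dvd_iff[of 1 x] residue_seq_mod_self[of x 1] by (auto simp: red_eq_0_iff)
  have cop: "coprime (residue_seq x k) (?p ^ k)" for k
  proof (cases "k = 0")
    case False
    then have "\<not> ?p dvd residue_seq x k"
      using residue_seq_mod_le[of 1 k x] nd by (auto simp: dvd_eq_mod_eq_0)
    then have "coprime ?p (residue_seq x k)" by (rule prime_imp_coprime[OF prime_card_int])
    then show ?thesis by (simp add: coprime_commute)
  qed simp
  define y where "y k = (SOME b. [residue_seq x k * b = 1] (mod ?p ^ k)) mod ?p ^ k" for k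
  have y1: "[residue_seq x k * y k = 1] (mod ?p ^ k)" for k
  proof -
    have "\<exists>b. [residue_seq x k * b = 1] (mod ?p ^ k)" using cong_solve_coprime_int[OF cop] .
    from someI_ex[OF this] show ?thesis unfolding y_def by (simp add: cong_def mod_simps)
  qed
  have y: "y \<in> {x. \<forall>k. x k \<in> {0..<?p ^ k} \<and> x (Suc k) mod ?p ^ k = x k}"
  proof (clarify, intro conjI)
    fix k
    show "y k \<in> {0..<?p ^ k}" using p_pos[where 'p='p] by (simp add: y_def)
    have "[residue_seq x (Suc k) * y (Suc k) = 1] (mod ?p ^ k)"
      using y1[of "Suc k"] by (rule cong_dvd_modulus) simp
    then have "[residue_seq x k * y (Suc k) = residue_seq x k * y k] (mod ?p ^ k)"
      using y1[of k] residue_seq_mod_le[of k "Suc k" x] by (simp add: cong_def) (metis mod_mult_left_eq)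
    then have "[y (Suc k) = y k] (mod ?p ^ k)" using cop[of k] by (simp add: cong_mult_lcancel)
    then show "y (Suc k) mod ?p ^ k = y k" by (simp add: cong_def y_def)
  qed
  have "x * Abs_padic_int y = 1"
  proof (rule residue_seq_inject[THEN iffD1], rule ext)
    fix k
    show "residue_seq (x * Abs_padic_int y) k = residue_seq (1 :: 'p padic_int) k"
      using y1[of k] by (simp add: times_padic_int.rep_eq Abs_padic_int_inverse[OF y] one_padic_int.rep_eq cong_def)
  qed
  then show "x dvd 1" by (metis dvd_triv_left)
qed

lemma pp_nonzero: "pp \<noteq> (0 :: 'p::prime_card padic_int)"
proof
  assume "pp = (0 :: 'p padic_int)"
  then have "residue_seq (pp ^ 1 :: 'p padic_int) 2 = 0" by (simp add: zero_padic_int.rep_eq)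
  then show False using p_gt_1[where 'p='p] unfolding residue_seq_pp_power by (simp add: power2_eq_square)
qed

lemma pp_not_dvd_1: "\<not> pp dvd (1 :: 'p::prime_card padic_int)"
  using red_eq_0_iff[of "1 :: 'p padic_int"] by simp

section \<open>Equivalence of matrices\<close>

lemma GL_iff: "U \<in> GL n \<longleftrightarrow> U \<in> carrier_mat n n \<and> (\<exists>W\<in>carrier_mat n n. U * W = 1\<^sub>m n \<and> W * U = 1\<^sub>m n)"
proof
  assume "U \<in> GL n"
  then obtain W where U: "U \<in> carrier_mat n n" and W: "U * W = 1\<^sub>m n" "W * U = 1\<^sub>m (dim_row W)"
    by (auto simp: GL_def invertible_mat_def inverts_mat_def)
  have "dim_row W = n" using W(2) U by (metis carrier_matD(2) index_mult_mat(3) index_one_mat(3))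
  moreover have "dim_col W = n" using W(1) by (metis index_mult_mat(3) index_one_mat(3))
  ultimately have "W \<in> carrier_mat n n" by auto
  then show "U \<in> carrier_mat n n \<and> (\<exists>W\<in>carrier_mat n n. U * W = 1\<^sub>m n \<and> W * U = 1\<^sub>m n)"
    using U W by auto
qed (auto simp: GL_def invertible_mat_def inverts_mat_def)

lemma GL_carrier: "U \<in> GL n \<Longrightarrow> U \<in> carrier_mat n n"
  by (simp add: GL_def)

lemma GL_one: "1\<^sub>m n \<in> GL n"
  unfolding GL_iff by (auto intro!: bexI[of _ "1\<^sub>m n"])

lemma GL_inverse:
  assumes "U \<in> GL n"
  obtains W where "W \<in> GL n" "U * W = 1\<^sub>m n" "W * U = 1\<^sub>m n"
  using assms unfolding GL_iff by blast

lemma GL_mult: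
  assumes "U \<in> GL n" "V \<in> GL n"
  shows "U * V \<in> GL n"
proof -
  obtain U' V' where U: "U \<in> carrier_mat n n" "U' \<in> carrier_mat n n" "U * U' = 1\<^sub>m n" "U' * U = 1\<^sub>m n"
    and V: "V \<in> carrier_mat n n" "V' \<in> carrier_mat n n" "V * V' = 1\<^sub>m n" "V' * V = 1\<^sub>m n"
    using assms unfolding GL_iff by blast
  have "(U * V) * (V' * U') = U * (V * V') * U'"
    using U(1,2) V(1,2) by (simp add: assoc_mult_mat[of _ n n _ n _ n])
  moreover have "(V' * U') * (U * V) = V' * (U' * U) * V"
    using U(1,2) V(1,2) by (simp add: assoc_mult_mat[of _ n n _ n _ n])
  ultimately have "(U * V) * (V' * U') = 1\<^sub>m n" "(V' * U') * (U * V) = 1\<^sub>m n"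
    using U V by simp_all
  then show ?thesis unfolding GL_iff using U(1,2) V(1,2)
    by (intro conjI bexI[of _ "V' * U'"] mult_carrier_mat)
qed

lemma GL_det: "U \<in> GL n \<longleftrightarrow> U \<in> carrier_mat n n \<and> Determinant.det U dvd (1 :: 'a :: comm_ring_1)"
proof
  assume "U \<in> GL n"
  then obtain W where "U \<in> carrier_mat n n" "W \<in> carrier_mat n n" "U * W = 1\<^sub>m n"
    unfolding GL_iff by blast
  then have "Determinant.det U * Determinant.det W = 1" using Determinant.det_mult[of U n W] by simp
  then show "U \<in> carrier_mat n n \<and> Determinant.det U dvd 1" using \<open>U \<in> carrier_mat n n\<close> by (metis dvd_triv_left)
next
  assume U: "U \<in> carrier_mat n n \<and> Determinant.det U dvd 1"
  then obtain d where d: "1 = Determinant.det U * d" by (auto elim: dvdE)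
  let ?W = "d \<cdot>\<^sub>m adj_mat U"
  have "U * ?W = d \<cdot>\<^sub>m (Determinant.det U \<cdot>\<^sub>m 1\<^sub>m n)" "?W * U = d \<cdot>\<^sub>m (Determinant.det U \<cdot>\<^sub>m 1\<^sub>m n)"
    using U adj_mat[of U n]
    by (simp_all add: mult_smult_distrib[of _ n n _ n] mult_smult_assoc_mat[of _ n n _ n])
  moreover have "d \<cdot>\<^sub>m (Determinant.det U \<cdot>\<^sub>m 1\<^sub>m n) = 1\<^sub>m n"
    using d by (intro eq_matI) (auto simp: mult.commute)
  ultimately have "U * ?W = 1\<^sub>m n" "?W * U = 1\<^sub>m n" by simp_all
  then show "U \<in> GL n" unfolding GL_iff using U adj_mat[of U n] by auto
qed

definition mequiv :: "'a::comm_ring_1 mat \<Rightarrow> 'a mat \<Rightarrow> bool" where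
  "mequiv A B \<longleftrightarrow> (\<exists>U\<in>GL (dim_row A). \<exists>V\<in>GL (dim_col A). U * A * V = B)"

lemma mequivI:
  assumes "A \<in> carrier_mat n m" "U \<in> GL n" "V \<in> GL m" "U * A * V = B"
  shows "mequiv A B"
  using assms by (auto simp: mequiv_def)

lemma mequivE:
  assumes "mequiv A B" "A \<in> carrier_mat n m"
  obtains U V where "U \<in> GL n" "V \<in> GL m" "U * A * V = B"
  using assms by (auto simp: mequiv_def)

lemma mequiv_refl: "mequiv A A"
  by (rule mequivI[of _ "dim_row A" "dim_col A" "1\<^sub>m (dim_row A)" "1\<^sub>m (dim_col A)"]) (auto simp: GL_one)

lemma mequiv_sym:
  assumes "mequiv A B" "A \<in> carrier_mat n m"
  shows "mequiv B A"
proof -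
  obtain U V where UV: "U \<in> GL n" "V \<in> GL m" "U * A * V = B" using mequivE[OF assms] .
  obtain U' where U': "U' \<in> GL n" "U' * U = 1\<^sub>m n" using GL_inverse[OF UV(1)] by metis
  obtain V' where V': "V' \<in> GL m" "V * V' = 1\<^sub>m m" using GL_inverse[OF UV(2)] by metis
  note c = UV(1)[THEN GL_carrier] UV(2)[THEN GL_carrier] U'(1)[THEN GL_carrier] V'(1)[THEN GL_carrier] assms(2)
  have "U' * B * V' = (U' * U) * A * (V * V')"
    unfolding UV(3)[symmetric] using c by (simp add: assoc_mult_mat[of _ n n _ n _ m] assoc_mult_mat[of _ n m _ m _ m] assoc_mult_mat[of _ n n _ m _ m])
  also have "\<dots> = A" unfolding U'(2) V'(2) using assms(2) by simp
  finally have "U' * B * V' = A" .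
  moreover have "B \<in> carrier_mat n m" unfolding UV(3)[symmetric] using c by simp
  ultimately show ?thesis using U'(1) V'(1) by (intro mequivI)
qed

lemma mequiv_trans:
  assumes "mequiv A B" "mequiv B C" "A \<in> carrier_mat n m"
  shows "mequiv A C"
proof -
  obtain U V where UV: "U \<in> GL n" "V \<in> GL m" "U * A * V = B" using mequivE[OF assms(1,3)] .
  note c = UV(1)[THEN GL_carrier] UV(2)[THEN GL_carrier] assms(3)
  have B: "B \<in> carrier_mat n m" using UV c by auto
  obtain U' V' where U'V': "U' \<in> GL n" "V' \<in> GL m" "U' * B * V' = C" using mequivE[OF assms(2) B] .
  note c' = U'V'(1)[THEN GL_carrier] U'V'(2)[THEN GL_carrier]
  have "(U' * U) * A * (V * V') = C"
    unfolding U'V'(3)[symmetric] UV(3)[symmetric] using c c'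
    by (simp add: assoc_mult_mat[of _ n n _ n _ m] assoc_mult_mat[of _ n m _ m _ m] assoc_mult_mat[of _ n n _ m _ m])
  then show ?thesis using GL_mult UV U'V' by (intro mequivI[OF assms(3)]) auto
qed

text \<open>
  Used throughout to replace a matrix by an equivalent one in front of a fixed normal form.
\<close>

lemma mequiv_left_iff:
  assumes "mequiv A B" "A \<in> carrier_mat n m"
  shows "mequiv A C \<longleftrightarrow> mequiv B C"
proof -
  have "B \<in> carrier_mat n m" using assms by (auto simp: mequiv_def dest!: GL_carrier)
  then show ?thesis using mequiv_trans mequiv_sym assms by blast
qed

lemma mequiv_mult_left:
  assumes "A \<in> carrier_mat n m" "U \<in> GL n"
  shows "mequiv A (U * A)"
  using assms by (intro mequivI[OF assms GL_one]) (auto dest: GL_carrier)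

lemma mequiv_mult_right:
  assumes "A \<in> carrier_mat n m" "V \<in> GL m"
  shows "mequiv A (A * V)"
  using assms by (intro mequivI[OF assms(1) GL_one assms(2)]) (auto dest: GL_carrier)

lemma perm_mat_GL:
  assumes "\<pi> permutes {..<n}"
  shows "(mat n n (\<lambda>(i, j). if j = \<pi> i then 1 else 0) :: 'a::comm_ring_1 mat) \<in> GL n" (is "?P \<in> _")
    and "(mat n n (\<lambda>(i, j). if i = \<pi> j then 1 else 0) :: 'a mat) \<in> GL n" (is "?Q \<in> _")
proof -
  have lt: "\<pi> i < n \<longleftrightarrow> i < n" for i using permutes_in_image[OF assms] by simp
  have inj: "\<pi> i = \<pi> j \<longleftrightarrow> i = j" for i j using permutes_inj[OF assms] by (simp add: inj_eq)
  have surj: "i = \<pi> k \<longleftrightarrow> k = inv_into UNIV \<pi> i" for i k using permutes_inv_eq[OF assms] by metis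
  have inj': "inv_into UNIV \<pi> i = inv_into UNIV \<pi> j \<longleftrightarrow> i = j" for i j using permutes_inj[OF permutes_inv[OF assms]] by (simp add: inj_eq)
  have lt': "inv_into UNIV \<pi> i < n \<longleftrightarrow> i < n" for i using permutes_in_image[OF permutes_inv[OF assms]] by simp
  have "?P * ?Q = 1\<^sub>m n"
    by (rule eq_matI) (auto simp: scalar_prod_def if_distrib[of "\<lambda>x. x * _"] sum.delta lt inj cong: if_cong)
  moreover have "?Q * ?P = 1\<^sub>m n"
    by (rule eq_matI) (auto simp: scalar_prod_def if_distrib[of "\<lambda>x. x * _"] sum.delta surj lt' inj' permutes_inverses[OF assms] cong: if_cong)
  ultimately show "?P \<in> GL n" "?Q \<in> GL n" unfolding GL_iff by (auto intro: bexI[of _ ?P] bexI[of _ ?Q])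
qed

lemma mequiv_permute:
  fixes A :: "'a::comm_ring_1 mat"
  assumes A: "A \<in> carrier_mat n m" and p: "\<pi> permutes {..<n}" and s: "\<sigma> permutes {..<m}"
  shows "mequiv A (mat n m (\<lambda>(i, j). A $$ (\<pi> i, \<sigma> j)))"
proof (rule mequivI[OF A perm_mat_GL(1)[OF p] perm_mat_GL(2)[OF s]])
  let ?P = "mat n n (\<lambda>(i, j). if j = \<pi> i then 1 else 0) :: 'a mat"
  let ?Q = "mat m m (\<lambda>(i, j). if i = \<sigma> j then 1 else 0) :: 'a mat"
  have lt: "\<pi> i < n \<longleftrightarrow> i < n" "\<sigma> j < m \<longleftrightarrow> j < m" for i j
    using permutes_in_image[OF p] permutes_in_image[OF s] by auto
  have 1: "?P * A = mat n m (\<lambda>(i, j). A $$ (\<pi> i, j))"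
    using A lt by (intro eq_matI) (auto simp: scalar_prod_def if_distrib[of "\<lambda>x. x * _"] sum.delta cong: if_cong)
  show "?P * A * ?Q = mat n m (\<lambda>(i, j). A $$ (\<pi> i, \<sigma> j))"
    unfolding 1 using lt
    by (intro eq_matI) (auto simp: scalar_prod_def if_distrib[of "\<lambda>x. _ * x"] sum.delta cong: if_cong)
qed

section \<open>Cancellation over the local ring\<close>

lemma four_block_mat_inj:
  assumes "A \<in> carrier_mat a c" "B \<in> carrier_mat a d" "C \<in> carrier_mat b c" "D \<in> carrier_mat b d"
    "A' \<in> carrier_mat a c" "B' \<in> carrier_mat a d" "C' \<in> carrier_mat b c" "D' \<in> carrier_mat b d"
    and eq: "four_block_mat A B C D = four_block_mat A' B' C' D'"
  shows "A = A'" "B = B'" "C = C'" "D = D'"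
proof -
  note d = assms(1-8)[THEN carrier_matD(1)] assms(1-8)[THEN carrier_matD(2)]
  have e: "four_block_mat A B C D $$ (i, j) = four_block_mat A' B' C' D' $$ (i, j)" for i j using eq by simp
  show "A = A'"
  proof (rule eq_matI)
    fix i j assume "i < dim_row A'" "j < dim_col A'"
    then show "A $$ (i, j) = A' $$ (i, j)" using e[of i j] d by simp
  qed (use d in auto)
  show "B = B'"
  proof (rule eq_matI)
    fix i j assume "i < dim_row B'" "j < dim_col B'"
    then show "B $$ (i, j) = B' $$ (i, j)" using e[of i "c + j"] d by simp
  qed (use d in auto)
  show "C = C'"
  proof (rule eq_matI)
    fix i j assume "i < dim_row C'" "j < dim_col C'"
    then show "C $$ (i, j) = C' $$ (i, j)" using e[of "a + i" j] d by simp
  qed (use d in auto)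
  show "D = D'"
  proof (rule eq_matI)
    fix i j assume "i < dim_row D'" "j < dim_col D'"
    then show "D $$ (i, j) = D' $$ (i, j)" using e[of "a + i" "c + j"] d by simp
  qed (use d in auto)
qed

lemma GL_lower:
  fixes C :: "'a::idom mat"
  assumes "C \<in> carrier_mat n 1"
  shows "four_block_mat (1\<^sub>m 1) (0\<^sub>m 1 n) C (1\<^sub>m n) \<in> GL (1 + n)"
  unfolding GL_det
  by (subst det_four_block_mat_upper_right_zero[OF _ refl assms]) auto

lemma GL_upper:
  fixes C :: "'a::idom mat"
  assumes "C \<in> carrier_mat 1 n"
  shows "four_block_mat (1\<^sub>m 1) C (0\<^sub>m n 1) (1\<^sub>m n) \<in> GL (1 + n)"
  unfolding GL_det
  by (subst det_four_block_mat_lower_left_zero[OF _ assms refl]) auto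

text \<open>
  Elimination of \<open>U21\<close> by a row operation turns the determinant into \<open>U11\<close> times that of the Schur
  complement.
\<close>

lemma schur_GL:
  fixes U11 :: "'a::idom mat"
  assumes c: "U11 \<in> carrier_mat 1 1" "U12 \<in> carrier_mat 1 n" "U21 \<in> carrier_mat n 1" "U22 \<in> carrier_mat n n"
    and U: "four_block_mat U11 U12 U21 U22 \<in> GL (1 + n)" and w: "w * U11 $$ (0, 0) = 1"
  shows "(- w) \<cdot>\<^sub>m U21 * U12 + U22 \<in> GL n"
proof -
  let ?L = "four_block_mat (1\<^sub>m 1) (0\<^sub>m 1 n) ((- w) \<cdot>\<^sub>m U21) (1\<^sub>m n)"
  let ?U = "four_block_mat U11 U12 U21 U22" and ?S = "(- w) \<cdot>\<^sub>m U21 * U12 + U22"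
  have L: "?L \<in> GL (1 + n)" by (rule GL_lower) (use c in simp)
  have z: "(- w) \<cdot>\<^sub>m U21 * U11 + U21 = 0\<^sub>m n 1"
    using c w by (intro eq_matI) (auto simp: scalar_prod_def algebra_simps)
  have "?L * ?U = four_block_mat U11 U12 (0\<^sub>m n 1) ?S"
    using c by (subst mult_four_block_mat[of _ 1 1 _ n _ n _ _ 1 _ n]) (simp_all add: z[simplified])
  moreover have "Determinant.det (four_block_mat U11 U12 (0\<^sub>m n 1) ?S) = Determinant.det U11 * Determinant.det ?S"
    using c by (intro det_four_block_mat_lower_left_zero[of _ 1 _ n]) auto
  moreover have "Determinant.det (?L * ?U) dvd 1" using GL_mult[OF L U] unfolding GL_det by simp
  ultimately have "Determinant.det ?S dvd 1" by (metis dvd_mult_right)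
  then show ?thesis unfolding GL_det using c by simp
qed

definition one_plus :: "'a::comm_ring_1 mat \<Rightarrow> 'a mat" where
  "one_plus A = four_block_mat (1\<^sub>m 1) (0\<^sub>m 1 (dim_col A)) (0\<^sub>m (dim_row A) 1) A"

lemma one_plus_carrier [simp]: "A \<in> carrier_mat n m \<Longrightarrow> one_plus A \<in> carrier_mat (1 + n) (1 + m)"
  unfolding one_plus_def by (rule four_block_carrier_mat) auto

lemma split_block_corner:
  assumes "U \<in> carrier_mat (1 + n) (1 + m)"
  obtains U11 U12 U21 U22 where "U = four_block_mat U11 U12 U21 U22"
    "U11 \<in> carrier_mat 1 1" "U12 \<in> carrier_mat 1 m" "U21 \<in> carrier_mat n 1" "U22 \<in> carrier_mat n m"
proof -
  obtain U11 U12 U21 U22 where s: "split_block U 1 1 = (U11, U12, U21, U22)" by (metis prod_cases4)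
  show ?thesis using split_block[OF s, of n m] assms by (intro that[of U11 U12 U21 U22]) auto
qed

text \<open>
  Comparing blocks in \<open>U (1 \<oplus> A) = (1 \<oplus> D) W\<close> shows that the Schur complements \<open>U'\<close>, \<open>W'\<close> of the common
  corner entry satisfy \<open>U' A = D W'\<close>.
\<close>

lemma cancel_unit:
  fixes A D :: "'a::idom mat"
  assumes A: "A \<in> carrier_mat n m" and D: "D \<in> carrier_mat n m"
    and U: "U \<in> GL (1 + n)" and W: "W \<in> GL (1 + m)" and eq: "U * one_plus A = one_plus D * W"
    and unit: "W $$ (0, 0) dvd 1"
  shows "mequiv A D"
proof -
  obtain U11 U12 U21 U22 where Ub: "U = four_block_mat U11 U12 U21 U22"
    and Uc: "U11 \<in> carrier_mat 1 1" "U12 \<in> carrier_mat 1 n" "U21 \<in> carrier_mat n 1" "U22 \<in> carrier_mat n n"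
    using split_block_corner[OF GL_carrier[OF U]] .
  obtain W11 W12 W21 W22 where Wb: "W = four_block_mat W11 W12 W21 W22"
    and Wc: "W11 \<in> carrier_mat 1 1" "W12 \<in> carrier_mat 1 m" "W21 \<in> carrier_mat m 1" "W22 \<in> carrier_mat m m"
    using split_block_corner[OF GL_carrier[OF W]] .
  have "U * one_plus A = four_block_mat U11 (U12 * A) U21 (U22 * A)"
    unfolding Ub one_plus_def using A Uc
    by (subst mult_four_block_mat[of _ 1 1 _ n _ n _ _ 1 _ m]) (simp_all)
  moreover have "one_plus D * W = four_block_mat W11 W12 (D * W21) (D * W22)"
    unfolding Wb one_plus_def using D Wc
    by (subst mult_four_block_mat[of _ 1 1 _ m _ n _ _ 1 _ m]) (simp_all)
  ultimately have "four_block_mat U11 (U12 * A) U21 (U22 * A) = four_block_mat W11 W12 (D * W21) (D * W22)"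
    using eq by simp
  note e = four_block_mat_inj[OF _ _ _ _ _ _ _ _ this, of 1 1 m n]
  have e1: "U11 = W11" and e2: "U12 * A = W12" and e3: "U21 = D * W21" and e4: "U22 * A = D * W22"
    by (rule e; use Uc Wc A D in simp)+
  obtain w where "1 = W $$ (0, 0) * w" using unit by (elim dvdE)
  then have w: "w * W11 $$ (0, 0) = 1" "w * U11 $$ (0, 0) = 1"
    using Wc e1 by (auto simp: Wb mult.commute)
  let ?U = "(- w) \<cdot>\<^sub>m U21 * U12 + U22" and ?W = "(- w) \<cdot>\<^sub>m W21 * W12 + W22"
  have U': "?U \<in> GL n" using schur_GL[OF Uc _ w(2)] U Ub by simp
  have W': "?W \<in> GL m" using schur_GL[OF Wc _ w(1)] W Wb by simp
  have c1: "(- w) \<cdot>\<^sub>m U21 \<in> carrier_mat n 1" "(- w) \<cdot>\<^sub>m W21 \<in> carrier_mat m 1" using Uc Wc by auto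
  have "?U * A = (- w) \<cdot>\<^sub>m U21 * U12 * A + U22 * A"
    by (rule add_mult_distrib_mat[OF _ Uc(4) A]) (use Uc in auto)
  also have "(- w) \<cdot>\<^sub>m U21 * U12 * A = D * ((- w) \<cdot>\<^sub>m W21 * W12)"
  proof -
    have "(- w) \<cdot>\<^sub>m U21 * U12 * A = (- w) \<cdot>\<^sub>m U21 * W12"
      unfolding e2[symmetric] by (rule assoc_mult_mat[OF c1(1) Uc(2) A])
    moreover have "(- w) \<cdot>\<^sub>m U21 = D * ((- w) \<cdot>\<^sub>m W21)"
      unfolding e3 by (rule mult_smult_distrib[OF D Wc(3), symmetric])
    moreover have "D * ((- w) \<cdot>\<^sub>m W21) * W12 = D * ((- w) \<cdot>\<^sub>m W21 * W12)"
      by (rule assoc_mult_mat[OF D c1(2) Wc(2)])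
    ultimately show ?thesis by simp
  qed
  also have "D * ((- w) \<cdot>\<^sub>m W21 * W12) + U22 * A = D * ?W" unfolding e4
    by (rule mult_add_distrib_mat[OF D _ Wc(4), symmetric]) (use Wc in auto)
  finally have main: "?U * A = D * ?W" .
  obtain V where V: "V \<in> GL m" "?W * V = 1\<^sub>m m" using GL_inverse[OF W'] by metis
  have "?U * A * V = D * (?W * V)" unfolding main
    by (rule assoc_mult_mat[OF D GL_carrier[OF W'] GL_carrier[OF V(1)]])
  then have "?U * A * V = D" unfolding V(2) using D by simp
  then show ?thesis by (rule mequivI[OF A U' V(1)])
qed

text \<open>
  Cancellation holds because the ring is local. Write the equivalence as \<open>U (1 \<oplus> A) = (1 \<oplus> D) W\<close>; the
  first row of the invertible matrix \<open>W\<close> contains a unit. If the corner entry is not a unit, a column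
  operation \<open>Q\<close> adds a unit to it, which makes it one. This \<open>Q\<close> is compatible with the equation: there
  is a row operation \<open>P\<close> with \<open>P (1 \<oplus> A) = (1 \<oplus> A) Q\<close>, so \<open>(U P, W Q)\<close> is another solution.
\<close>

lemma cancel_one_plus:
  fixes A D :: "'p::prime_card padic_int mat"
  assumes A: "A \<in> carrier_mat n m" and D: "D \<in> carrier_mat n m"
    and eq: "mequiv (one_plus A) (one_plus D)"
  shows "mequiv A D"
proof -
  obtain U V where UV: "U \<in> GL (1 + n)" "V \<in> GL (1 + m)" "U * one_plus A * V = one_plus D"
    using mequivE[OF eq one_plus_carrier[OF A]] .
  obtain W where W: "W \<in> GL (1 + m)" "V * W = 1\<^sub>m (1 + m)" "W * V = 1\<^sub>m (1 + m)" using GL_inverse[OF UV(2)] .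
  note c = UV(1)[THEN GL_carrier] UV(2)[THEN GL_carrier] W(1)[THEN GL_carrier] one_plus_carrier[OF A] one_plus_carrier[OF D]
  have "one_plus D * W = (U * one_plus A) * (V * W)"
    unfolding UV(3)[symmetric] by (rule assoc_mult_mat) (use c in auto)
  then have eq: "U * one_plus A = one_plus D * W" unfolding W(2) using c by simp
  show ?thesis
  proof (cases "red (W $$ (0, 0)) = 0")
    case False
    then show ?thesis using cancel_unit[OF A D UV(1) W(1) eq] by (simp add: unit_iff_red)
  next
    case True
    have "\<exists>j<1 + m. red (W $$ (0, j)) \<noteq> 0"
    proof (rule ccontr)
      assume "\<not> (\<exists>j<1 + m. red (W $$ (0, j)) \<noteq> 0)"
      then have z: "red (W $$ (0, j)) = 0" if "j < 1 + m" for j using that by auto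
      have "1 = red ((W * V) $$ (0, 0))" unfolding W(3) by simp
      also have "(W * V) $$ (0, 0) = (\<Sum>j = 0..<1 + m. W $$ (0, j) * V $$ (j, 0))"
        using c by (simp add: scalar_prod_def)
      also have "red \<dots> = (\<Sum>j = 0..<1 + m. red (W $$ (0, j) * V $$ (j, 0)))"
        by (rule red.hom_sum)
      also have "\<dots> = 0" by (rule sum.neutral) (use z in \<open>simp add: red.hom_mult\<close>)
      finally show False by simp
    qed
    then obtain j where j: "j < m" "red (W $$ (0, Suc j)) \<noteq> 0"
      using True by (metis add.commute less_Suc_eq_0_disj plus_1_eq_Suc)
    let ?q = "mat m 1 (\<lambda>(i, _). if i = j then 1 else 0) :: 'p padic_int mat"
    let ?Q = "four_block_mat (1\<^sub>m 1) (0\<^sub>m 1 m) ?q (1\<^sub>m m)"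
    let ?P = "four_block_mat (1\<^sub>m 1) (0\<^sub>m 1 n) (A * ?q) (1\<^sub>m n)"
    have Q: "?Q \<in> GL (1 + m)" and P: "?P \<in> GL (1 + n)" using A by (intro GL_lower, simp)+
    have PQ: "?P * one_plus A = one_plus A * ?Q"
    proof -
      have "?P * one_plus A = four_block_mat (1\<^sub>m 1) (0\<^sub>m 1 m) (A * ?q) A"
        unfolding one_plus_def using A
        by (subst mult_four_block_mat[of _ 1 1 _ n _ n _ _ 1 _ m]) simp_all
      moreover have "one_plus A * ?Q = four_block_mat (1\<^sub>m 1) (0\<^sub>m 1 m) (A * ?q) A"
        unfolding one_plus_def using A
        by (subst mult_four_block_mat[of _ 1 1 _ m _ n _ _ 1 _ m]) simp_all
      ultimately show ?thesis by simp
    qed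
    note c' = c Q[THEN GL_carrier] P[THEN GL_carrier]
    have "U * ?P * one_plus A = U * (?P * one_plus A)"
      by (rule assoc_mult_mat) (use c' in auto)
    also have "\<dots> = U * one_plus A * ?Q" unfolding PQ
      by (rule assoc_mult_mat[symmetric]) (use c' in auto)
    also have "\<dots> = one_plus D * (W * ?Q)" unfolding eq
      by (rule assoc_mult_mat) (use c' in auto)
    finally have eq': "U * ?P * one_plus A = one_plus D * (W * ?Q)" .
    have "(W * ?Q) $$ (0, 0) = (\<Sum>k = 0..<1 + m. W $$ (0, k) * ?Q $$ (k, 0))"
      using c' by (simp add: scalar_prod_def)
    also have "\<dots> = (\<Sum>k = 0..<1 + m. (if k = 0 then W $$ (0, 0) else 0) + (if k = Suc j then W $$ (0, Suc j) else 0))"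
      by (rule sum.cong) auto
    also have "\<dots> = W $$ (0, 0) + W $$ (0, Suc j)" using j by (simp add: sum.distrib)
    finally have "red ((W * ?Q) $$ (0, 0)) \<noteq> 0" using True j by (simp add: red.hom_add)
    then show ?thesis
      using cancel_unit[OF A D GL_mult[OF UV(1) P] GL_mult[OF W(1) Q] eq'] by (simp add: unit_iff_red)
  qed
qed

section \<open>Smith normal forms over the p-adic integers\<close>

definition pdiag :: "nat \<Rightarrow> nat \<Rightarrow> int list \<Rightarrow> 'p::prime_card padic_int mat" where
  "pdiag n m lam = mat n m (\<lambda>(i, j). if i = j then pp ^ nat (lam ! i) else 0)"

lemma pdiag_carrier [simp]: "pdiag n m lam \<in> carrier_mat n m"
  by (simp add: pdiag_def)

text \<open>
  The determinant reduces to \<open>1\<close> in the residue field.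
\<close>

lemma GL_one_add:
  fixes Y :: "'p::prime_card padic_int mat"
  assumes Y: "Y \<in> carrier_mat m m" and red: "\<And>i j. i < m \<Longrightarrow> j < m \<Longrightarrow> red (Y $$ (i, j)) = 0"
  shows "1\<^sub>m m + Y \<in> GL m"
proof -
  have "map_mat red (1\<^sub>m m + Y) = 1\<^sub>m m"
    using Y by (intro eq_matI) (auto simp: red.hom_add red)
  then have "red (Determinant.det (1\<^sub>m m + Y)) = 1" unfolding red.hom_det[symmetric] by simp
  then show ?thesis unfolding GL_det using Y by (simp add: unit_iff_red)
qed

definition cong_mat :: "nat \<Rightarrow> 'p::prime_card padic_int mat \<Rightarrow> 'p padic_int mat \<Rightarrow> bool" where
  "cong_mat k A B \<longleftrightarrow> (\<forall>i<dim_row A. \<forall>j<dim_col A. pp ^ k dvd A $$ (i, j) - B $$ (i, j))"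

text \<open>
  The normal form only depends on residues modulo \<open>p^k\<close> if \<open>k\<close> exceeds all parts. For \<open>B = A + p^k X\<close> and
  \<open>U A V = D\<close> one has \<open>U B V = D + p^k U X V = D (1 + Y)\<close>: row \<open>i\<close> of \<open>p^k U X V\<close> is divisible by
  \<open>p * p^lam\<^sub>i\<close>, so that \<open>Y\<close> exists and is divisible by \<open>p\<close>.
\<close>

lemma mequiv_pdiag_cong:
  fixes A B :: "'p::prime_card padic_int mat"
  assumes A: "A \<in> carrier_mat n m" and B: "B \<in> carrier_mat n m" and nm: "n \<le> m"
    and k: "\<And>i. i < n \<Longrightarrow> nat (lam ! i) < k" and AB: "cong_mat k B A"
    and eq: "mequiv A (pdiag n m lam)"
  shows "mequiv B (pdiag n m lam)"
proof -
  obtain U V where UV: "U \<in> GL n" "V \<in> GL m" "U * A * V = pdiag n m lam" using mequivE[OF eq A] .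
  note c = GL_carrier[OF UV(1)] GL_carrier[OF UV(2)] A B
  have "\<forall>i j. i < n \<longrightarrow> j < m \<longrightarrow> (\<exists>x. B $$ (i, j) - A $$ (i, j) = pp ^ k * x)"
    using AB B by (auto simp: cong_mat_def dvd_def)
  then obtain x where x: "B $$ (i, j) - A $$ (i, j) = pp ^ k * x i j" if "i < n" "j < m" for i j by metis
  let ?X = "mat n m (\<lambda>(i, j). x i j)"
  have Xc: "?X \<in> carrier_mat n m" by simp
  have BX: "B = A + pp ^ k \<cdot>\<^sub>m ?X"
  proof (rule eq_matI)
    fix i j assume "i < dim_row (A + pp ^ k \<cdot>\<^sub>m ?X)" "j < dim_col (A + pp ^ k \<cdot>\<^sub>m ?X)"
    then show "B $$ (i, j) = (A + pp ^ k \<cdot>\<^sub>m ?X) $$ (i, j)" using A x[of i j] by (simp add: algebra_simps)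
  qed (use A B in auto)
  let ?X' = "U * ?X * V"
  have X'c: "?X' \<in> carrier_mat n m"
    by (rule mult_carrier_mat[OF mult_carrier_mat[OF c(1) Xc] c(2)])
  have "U * B * V = U * A * V + pp ^ k \<cdot>\<^sub>m ?X'"
  proof -
    have "U * B = U * A + pp ^ k \<cdot>\<^sub>m (U * ?X)"
      unfolding BX using c Xc
      by (simp add: mult_add_distrib_mat[OF c(1) A] mult_smult_distrib[OF c(1) Xc])
    also have "\<dots> * V = U * A * V + (pp ^ k \<cdot>\<^sub>m (U * ?X)) * V"
      by (rule add_mult_distrib_mat) (use c in auto)
    also have "(pp ^ k \<cdot>\<^sub>m (U * ?X)) * V = pp ^ k \<cdot>\<^sub>m ?X'"
      by (rule mult_smult_assoc_mat) (use c in auto)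
    finally show ?thesis .
  qed
  define Y where "Y = mat m m (\<lambda>(i, j). if i < n then pp ^ (k - nat (lam ! i)) * ?X' $$ (i, j) else 0)"
  have Yc: "Y \<in> carrier_mat m m" by (simp add: Y_def)
  have DY: "pdiag n m lam * Y = pp ^ k \<cdot>\<^sub>m ?X'"
  proof (rule eq_matI)
    fix i j assume ij: "i < dim_row (pp ^ k \<cdot>\<^sub>m ?X')" "j < dim_col (pp ^ k \<cdot>\<^sub>m ?X')"
    then have ij: "i < n" "j < m" using X'c by auto
    have "(pdiag n m lam * Y) $$ (i, j) = (\<Sum>l = 0..<m. (if i = l then pp ^ nat (lam ! i) else 0) * Y $$ (l, j))"
      using ij Yc by (simp add: scalar_prod_def pdiag_def)
    also have "\<dots> = (\<Sum>l = 0..<m. if i = l then pp ^ nat (lam ! i) * Y $$ (i, j) else 0)"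
      by (rule sum.cong) auto
    also have "\<dots> = pp ^ nat (lam ! i) * Y $$ (i, j)" using ij nm by simp
    also have "\<dots> = pp ^ (nat (lam ! i) + (k - nat (lam ! i))) * ?X' $$ (i, j)"
      using ij nm by (simp add: Y_def power_add)
    also have "nat (lam ! i) + (k - nat (lam ! i)) = k" using k[OF ij(1)] by simp
    finally show "(pdiag n m lam * Y) $$ (i, j) = (pp ^ k \<cdot>\<^sub>m ?X') $$ (i, j)"
      using ij X'c[THEN carrier_matD(1)] X'c[THEN carrier_matD(2)] by simp
  qed (use X'c[THEN carrier_matD(1)] X'c[THEN carrier_matD(2)] Yc in \<open>auto simp: pdiag_def\<close>)
  have Y: "1\<^sub>m m + Y \<in> GL m"
  proof (rule GL_one_add[OF Yc])
    fix i j assume "i < m" "j < m"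
    then show "red (Y $$ (i, j)) = 0"
      using k[of i] by (auto simp: Y_def red_eq_0_iff intro!: dvd_mult2 dvd_power)
  qed
  have "U * B * V = pdiag n m lam * (1\<^sub>m m + Y)"
    unfolding \<open>U * B * V = _\<close> UV(3) DY[symmetric]
    by (subst mult_add_distrib_mat[OF pdiag_carrier _ Yc]) (simp_all add: right_mult_one_mat[OF pdiag_carrier])
  moreover obtain Z where Z: "Z \<in> GL m" "(1\<^sub>m m + Y) * Z = 1\<^sub>m m" using GL_inverse[OF Y] by metis
  ultimately have "U * B * V * Z = pdiag n m lam * ((1\<^sub>m m + Y) * Z)"
    using assoc_mult_mat[OF pdiag_carrier GL_carrier[OF Y] GL_carrier[OF Z(1)]] by metis
  moreover have "U * B * V * Z = U * B * (V * Z)"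
    by (rule assoc_mult_mat) (use c Z GL_carrier in auto)
  ultimately have "U * B * (V * Z) = pdiag n m lam" unfolding Z(2) right_mult_one_mat[OF pdiag_carrier] by simp
  then show ?thesis by (rule mequivI[OF B UV(1) GL_mult[OF UV(2) Z(1)]])
qed

lemma smult_GL:
  fixes A :: "'a::comm_ring_1 mat"
  assumes "A \<in> carrier_mat n m" "U \<in> GL n" "V \<in> GL m"
  shows "U * (x \<cdot>\<^sub>m A) * V = x \<cdot>\<^sub>m (U * A * V)"
proof -
  note c = assms(1) GL_carrier[OF assms(2)] GL_carrier[OF assms(3)]
  have "U * (x \<cdot>\<^sub>m A) = x \<cdot>\<^sub>m (U * A)" by (rule mult_smult_distrib) (use c in auto)
  also have "\<dots> * V = x \<cdot>\<^sub>m (U * A * V)" by (rule mult_smult_assoc_mat) (use c in auto)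
  finally show ?thesis .
qed

text \<open>
  The entries of the normal form of \<open>p A\<close> are divisible by \<open>p\<close>, which can then be cancelled.
\<close>

lemma mequiv_smult_pp:
  fixes A :: "'p::prime_card padic_int mat"
  assumes A: "A \<in> carrier_mat n m" and nm: "n \<le> m" and l: "length lam = n" and nn: "\<forall>x\<in>set lam. 0 \<le> x"
  shows "mequiv (pp \<cdot>\<^sub>m A) (pdiag n m lam) \<longleftrightarrow>
    (\<forall>x\<in>set lam. 1 \<le> x) \<and> mequiv A (pdiag n m (map (\<lambda>x. x - 1) lam))"
proof -
  have pd: "pdiag n m lam = pp \<cdot>\<^sub>m (pdiag n m (map (\<lambda>x. x - 1) lam) :: 'p padic_int mat)"
    if "\<forall>x\<in>set lam. 1 \<le> x"
  proof (rule eq_matI)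
    fix i j assume "i < dim_row (pp \<cdot>\<^sub>m (pdiag n m (map (\<lambda>x. x - 1) lam) :: 'p padic_int mat))"
      "j < dim_col (pp \<cdot>\<^sub>m (pdiag n m (map (\<lambda>x. x - 1) lam) :: 'p padic_int mat))"
    then have ij: "i < n" "j < m" by (auto simp: pdiag_def)
    then have "1 \<le> lam ! i" using that l by auto
    then have "nat (lam ! i) = Suc (nat (lam ! i - 1))" by simp
    then show "pdiag n m lam $$ (i, j) = (pp \<cdot>\<^sub>m (pdiag n m (map (\<lambda>x. x - 1) lam) :: 'p padic_int mat)) $$ (i, j)"
      using ij l by (auto simp: pdiag_def)
  qed (auto simp: pdiag_def)
  show ?thesis
  proof
    assume "mequiv (pp \<cdot>\<^sub>m A) (pdiag n m lam)"
    then obtain U V where UV: "U \<in> GL n" "V \<in> GL m" "U * (pp \<cdot>\<^sub>m A) * V = pdiag n m lam"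
      by (rule mequivE) (use A in auto)
    then have eq: "pp \<cdot>\<^sub>m (U * A * V) = pdiag n m lam" using smult_GL[OF A] by simp
    have UVc: "U * A * V \<in> carrier_mat n m" using UV(1,2)[THEN GL_carrier] A by simp
    have ge: "\<forall>x\<in>set lam. 1 \<le> x"
    proof
      fix x assume "x \<in> set lam"
      then obtain i where i: "i < n" "x = lam ! i" using l by (auto simp: in_set_conv_nth)
      have "pp * (U * A * V) $$ (i, i) = pp ^ nat x"
        using arg_cong[OF eq, of "\<lambda>M. M $$ (i, i)"] i nm
          UVc[THEN carrier_matD(1)] UVc[THEN carrier_matD(2)] by (simp add: pdiag_def)
      then have "pp dvd (pp ^ nat x :: 'p padic_int)" by (metis dvd_triv_left)
      then have "nat x \<noteq> 0" using pp_not_dvd_1[where 'p='p] by (intro notI) simp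
      then show "1 \<le> x" by simp
    qed
    have "U * A * V = pdiag n m (map (\<lambda>x. x - 1) lam)"
    proof (rule eq_matI)
      fix i j assume "i < dim_row (pdiag n m (map (\<lambda>x. x - 1) lam) :: 'p padic_int mat)"
        "j < dim_col (pdiag n m (map (\<lambda>x. x - 1) lam) :: 'p padic_int mat)"
      then have ij: "i < n" "j < m" by (auto simp: pdiag_def)
      have "pp * (U * A * V) $$ (i, j) = pp * pdiag n m (map (\<lambda>x. x - 1) lam) $$ (i, j)"
        using arg_cong[OF eq[unfolded pd[OF ge]], of "\<lambda>M. M $$ (i, j)"] ij
          UVc[THEN carrier_matD(1)] UVc[THEN carrier_matD(2)] by (simp add: pdiag_def)
      then show "(U * A * V) $$ (i, j) = pdiag n m (map (\<lambda>x. x - 1) lam) $$ (i, j)"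
        using pp_nonzero[where 'p='p] by (simp add: mult_cancel_left)
    qed (use UVc in \<open>auto simp: pdiag_def\<close>)
    then show "(\<forall>x\<in>set lam. 1 \<le> x) \<and> mequiv A (pdiag n m (map (\<lambda>x. x - 1) lam))"
      using ge mequivI[OF A UV(1,2)] by blast
  next
    assume *: "(\<forall>x\<in>set lam. 1 \<le> x) \<and> mequiv A (pdiag n m (map (\<lambda>x. x - 1) lam))"
    then obtain U V where UV: "U \<in> GL n" "V \<in> GL m" "U * A * V = pdiag n m (map (\<lambda>x. x - 1) lam)"
      using A by (blast elim: mequivE)
    then have "U * (pp \<cdot>\<^sub>m A) * V = pdiag n m lam" using smult_GL[OF A UV(1,2)] pd * by simp
    then show "mequiv (pp \<cdot>\<^sub>m A) (pdiag n m lam)" using A by (intro mequivI[OF _ UV(1,2)]) auto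
  qed
qed

text \<open>
  Column operations clear the first row.
\<close>

lemma mequiv_pivot:
  fixes A :: "'a::idom mat"
  assumes A: "A \<in> carrier_mat n m" and w: "w \<in> carrier_mat 1 m"
  shows "mequiv (four_block_mat (1\<^sub>m 1) w (0\<^sub>m n 1) A) (one_plus A)"
proof -
  let ?V = "four_block_mat (1\<^sub>m 1) (- w) (0\<^sub>m m 1) (1\<^sub>m m)"
  have V: "?V \<in> GL (1 + m)" using w by (intro GL_upper) auto
  have "four_block_mat (1\<^sub>m 1) w (0\<^sub>m n 1) A * ?V = one_plus A"
    unfolding one_plus_def using A w
    by (subst mult_four_block_mat[of _ 1 1 _ m _ n _ _ 1 _ m]) (auto simp: uminus_l_inv_mat)
  moreover have "mequiv (four_block_mat (1\<^sub>m 1) w (0\<^sub>m n 1) A) (four_block_mat (1\<^sub>m 1) w (0\<^sub>m n 1) A * ?V)"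
    by (rule mequiv_mult_right[OF _ V, of _ "1 + n"]) (use A in \<open>auto intro!: four_block_carrier_mat[of _ 1 1]\<close>)
  ultimately show ?thesis by simp
qed

lemma rotate_permutes: "(\<lambda>i. if i = 0 then n else if i \<le> n then i - 1 else i) permutes {..<Suc n}"
proof (rule bij_imp_permutes)
  show "bij_betw (\<lambda>i. if i = 0 then n else if i \<le> n then i - 1 else i) {..<Suc n} {..<Suc n}"
    by (rule bij_betwI[of _ _ _ "\<lambda>i. if i = n then 0 else Suc i"]) auto
qed auto

text \<open>
  The part \<open>0\<close> stands for the diagonal entry \<open>p^0 = 1\<close>; a cyclic permutation of rows and columns moves
  it from the end of the diagonal to the front.
\<close>

lemma pdiag_snoc_0:
  assumes l: "length lam = n" and nm: "n \<le> m"
  shows "mequiv (pdiag (Suc n) (Suc m) (lam @ [0])) (one_plus (pdiag n m lam) :: 'p::prime_card padic_int mat)"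
proof -
  let ?p = "\<lambda>n i. if i = 0 then n else if i \<le> n then i - 1 else (i::nat)"
  have s: "?p n permutes {..<Suc m}"
    by (rule permutes_subset[OF rotate_permutes]) (use nm in auto)
  have e: "mat (Suc n) (Suc m) (\<lambda>(i, j). pdiag (Suc n) (Suc m) (lam @ [0]) $$ (?p n i, ?p n j)) =
    (one_plus (pdiag n m lam) :: 'p padic_int mat)"
    unfolding one_plus_def using l nm
    by (intro eq_matI) (auto simp: pdiag_def nth_append)
  show ?thesis unfolding e[symmetric] by (rule mequiv_permute[OF pdiag_carrier rotate_permutes s])
qed

text \<open>
  The matrix has an entry \<open>1\<close>, so its normal form cannot be divisible by \<open>p\<close>; hence the smallest part is
  \<open>0\<close>. The rest is \<open>cancel_one_plus\<close>.
\<close>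

lemma mequiv_pivot_iff:
  fixes A :: "'p::prime_card padic_int mat"
  assumes A: "A \<in> carrier_mat n m" and w: "w \<in> carrier_mat 1 m" and nm: "n \<le> m"
    and lam: "lam \<in> Sig_nonneg (Suc n)"
  shows "mequiv (four_block_mat (1\<^sub>m 1) w (0\<^sub>m n 1) A) (pdiag (Suc n) (Suc m) lam) \<longleftrightarrow>
    last lam = 0 \<and> mequiv A (pdiag n m (butlast lam))"
proof -
  let ?B = "four_block_mat (1\<^sub>m 1) w (0\<^sub>m n 1) A"
  have B: "?B \<in> carrier_mat (1 + n) (1 + m)" using A by (auto intro!: four_block_carrier_mat)
  have l: "length lam = Suc n" "lam \<noteq> []" and nn: "\<forall>x\<in>set lam. 0 \<le> x" and srt: "sorted_wrt (\<ge>) lam"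
    using lam by (auto simp: Sig_nonneg_def Sig_def)
  have last0: "last lam = 0" if eq: "mequiv ?B (pdiag (Suc n) (Suc m) lam)"
  proof (rule ccontr)
    assume "last lam \<noteq> 0"
    then have "0 < last lam" using nn l by (simp add: order_less_le)
    moreover have "last lam \<le> x" if "x \<in> set lam" for x
      using srt that by (induction lam) (auto split: if_splits)
    ultimately have "\<forall>x\<in>set lam. 1 \<le> x" by force
    then have "mequiv (pp \<cdot>\<^sub>m pdiag (Suc n) (Suc m) (map (\<lambda>x. x - 1) lam)) (pdiag (Suc n) (Suc m) lam :: 'p padic_int mat)"
      using mequiv_smult_pp[of "pdiag (Suc n) (Suc m) (map (\<lambda>x. x - 1) lam)" "Suc n" "Suc m" lam] l nn nm
      by (simp add: mequiv_refl)
    then have "mequiv (pp \<cdot>\<^sub>m pdiag (Suc n) (Suc m) (map (\<lambda>x. x - 1) lam)) ?B"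
      using mequiv_trans mequiv_sym[OF eq] B by (metis plus_1_eq_Suc pdiag_carrier smult_carrier_mat)
    then obtain U V where UV: "U \<in> GL (Suc n)" "V \<in> GL (Suc m)"
      "U * (pp \<cdot>\<^sub>m pdiag (Suc n) (Suc m) (map (\<lambda>x. x - 1) lam)) * V = ?B"
      by (rule mequivE[of _ _ "Suc n" "Suc m"]) simp
    have "?B = pp \<cdot>\<^sub>m (U * pdiag (Suc n) (Suc m) (map (\<lambda>x. x - 1) lam) * V)"
      using UV smult_GL[OF pdiag_carrier UV(1,2)] by metis
    then have "?B $$ (0, 0) = pp * (U * pdiag (Suc n) (Suc m) (map (\<lambda>x. x - 1) lam) * V) $$ (0, 0)"
      using UV(1,2)[THEN GL_carrier] by simp
    then have "(1::'p padic_int) = pp * (U * pdiag (Suc n) (Suc m) (map (\<lambda>x. x - 1) lam) * V) $$ (0, 0)"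
      using A by simp
    then show False using pp_not_dvd_1 by (metis dvd_triv_left)
  qed
  have main: "mequiv ?B (pdiag (Suc n) (Suc m) lam) \<longleftrightarrow> mequiv A (pdiag n m (butlast lam))" if "last lam = 0"
  proof -
    have lam': "lam = butlast lam @ [0]" using append_butlast_last_id[OF l(2)] that by simp
    have "mequiv (pdiag (Suc n) (Suc m) lam) (one_plus (pdiag n m (butlast lam)) :: 'p padic_int mat)"
      by (subst lam', rule pdiag_snoc_0) (use l nm in auto)
    then have "mequiv ?B (pdiag (Suc n) (Suc m) lam) \<longleftrightarrow> mequiv ?B (one_plus (pdiag n m (butlast lam)))"
      using mequiv_trans[OF _ _ B] mequiv_sym[OF _ pdiag_carrier] by blast
    also have "\<dots> \<longleftrightarrow> mequiv (one_plus A) (one_plus (pdiag n m (butlast lam)))"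
      by (rule mequiv_left_iff[OF mequiv_pivot[OF A w] B])
    also have "\<dots> \<longleftrightarrow> mequiv A (pdiag n m (butlast lam))"
    proof
      assume "mequiv A (pdiag n m (butlast lam))"
      then obtain U V where UV: "U \<in> GL n" "V \<in> GL m" "U * A * V = pdiag n m (butlast lam)"
        using A by (rule mequivE)
      note c = UV(1,2)[THEN GL_carrier]
      have G: "one_plus X \<in> GL (1 + r)" if "X \<in> GL r" for X :: "'p padic_int mat" and r
        using that unfolding GL_det one_plus_def
        by (subst det_four_block_mat_lower_left_zero[of _ 1 _ r]) auto
      have "one_plus U * one_plus A = one_plus (U * A)"
        unfolding one_plus_def using A c
        by (subst mult_four_block_mat[of _ 1 1 _ n _ n _ _ 1 _ m]) auto
      moreover have "one_plus (U * A) * one_plus V = one_plus (U * A * V)"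
        unfolding one_plus_def using A c
        by (subst mult_four_block_mat[of _ 1 1 _ m _ n _ _ 1 _ m]) auto
      ultimately show "mequiv (one_plus A) (one_plus (pdiag n m (butlast lam)))"
        using UV by (intro mequivI[OF one_plus_carrier[OF A] G[OF UV(1)] G[OF UV(2)]]) simp
    qed (rule cancel_one_plus[OF A pdiag_carrier])
    finally show ?thesis .
  qed
  show ?thesis using last0 main by blast
qed

lemma unimodular_GL_unit:
  fixes x :: "'p::prime_card padic_int vec"
  assumes x: "x \<in> carrier_vec (Suc n)" and u: "x $ 0 dvd 1"
  shows "\<exists>U\<in>GL (Suc n). U *\<^sub>v x = unit_vec (Suc n) 0"
proof -
  obtain w where w: "1 = x $ 0 * w" using u by (elim dvdE)
  let ?U = "mat (Suc n) (Suc n) (\<lambda>(i, j). if j = 0 then (if i = 0 then w else - w * x $ i) else if i = j then 1 else 0)"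
  have "Determinant.det ?U = prod_list (diag_mat ?U)"
    by (rule det_lower_triangular[of "Suc n"]) auto
  also have "diag_mat ?U = w # replicate n 1"
    by (rule nth_equalityI) (auto simp: diag_mat_def nth_Cons' simp del: upt_Suc)
  finally have "Determinant.det ?U = w" by simp
  then have "?U \<in> GL (Suc n)" unfolding GL_det using w by (simp, metis dvd_triv_right)
  moreover have "?U *\<^sub>v x = unit_vec (Suc n) 0"
  proof (rule eq_vecI)
    fix i assume "i < dim_vec (unit_vec (Suc n) 0 :: 'p padic_int vec)"
    then have i: "i < Suc n" by simp
    have "(?U *\<^sub>v x) $ i = (\<Sum>j = 0..<Suc n. ?U $$ (i, j) * x $ j)"
      using i x by (simp add: scalar_prod_def)
    also have "\<dots> = (\<Sum>j = 0..<Suc n. (if j = 0 then (if i = 0 then w else - w * x $ i) * x $ 0 else 0)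
        + (if j = i then (if i = 0 then 0 else x $ i) else 0))"
      by (rule sum.cong) (use i in auto)
    also have "\<dots> = (if i = 0 then w else - w * x $ i) * x $ 0 + (if i = 0 then 0 else x $ i)"
      using i by (simp add: sum.distrib del: sum.op_ivl_Suc)
    also have "\<dots> = (if i = 0 then 1 else 0)"
    proof -
      have "- w * x $ i * x $ 0 = - (x $ 0 * w) * x $ i" by simp
      then show ?thesis using w[symmetric] by (simp add: mult.commute)
    qed
    finally show "(?U *\<^sub>v x) $ i = (unit_vec (Suc n) 0 :: 'p padic_int vec) $ i" using i by simp
  qed simp
  ultimately show ?thesis by blast
qed

text \<open>
  If the first entry is not a unit, adding an entry that is one makes it a unit.
\<close>

lemma unimodular_GL:
  fixes x :: "'p::prime_card padic_int vec"
  assumes x: "x \<in> carrier_vec (Suc n)" and u: "\<exists>i<Suc n. \<not> pp dvd x $ i"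
  shows "\<exists>U\<in>GL (Suc n). U *\<^sub>v x = unit_vec (Suc n) 0"
proof (cases "pp dvd x $ 0")
  case False
  then show ?thesis using unimodular_GL_unit[OF x] by (simp add: unit_iff_red red_eq_0_iff)
next
  case True
  then obtain l where l: "l < Suc n" "\<not> pp dvd x $ l" "l \<noteq> 0" using u by metis
  let ?E = "addrow_mat (Suc n) 1 0 l :: 'p padic_int mat"
  have E: "?E \<in> GL (Suc n)" unfolding GL_det using l by (simp add: det_addrow_mat)
  have Ex: "?E *\<^sub>v x \<in> carrier_vec (Suc n)"
    by (rule mult_mat_vec_carrier[OF addrow_mat_carrier x])
  have "(?E *\<^sub>v x) $ 0 = (\<Sum>j = 0..<Suc n. ?E $$ (0, j) * x $ j)"
    using x by (simp add: scalar_prod_def)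
  also have "\<dots> = (\<Sum>j = 0..<Suc n. (if j = 0 then x $ 0 else 0) + (if j = l then x $ l else 0))"
    by (rule sum.cong) (use l in auto)
  also have "\<dots> = x $ 0 + x $ l" using l by (simp add: sum.distrib del: sum.op_ivl_Suc)
  finally have "(?E *\<^sub>v x) $ 0 dvd 1"
    using True l(2) by (simp add: unit_iff_red red.hom_add flip: red_eq_0_iff)
  from unimodular_GL_unit[OF Ex this] obtain U where U: "U \<in> GL (Suc n)" "U *\<^sub>v (?E *\<^sub>v x) = unit_vec (Suc n) 0"
    by blast
  have "U * ?E *\<^sub>v x = unit_vec (Suc n) 0"
    using U x by (subst assoc_mult_mat_vec[of _ "Suc n" "Suc n" _ "Suc n"]) (auto dest: GL_carrier)
  then show ?thesis using GL_mult[OF U(1) E] by blast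
qed

text \<open>
  The parts are nonnegative, so the normal form has entries in the ring, where \<open>to_fract\<close> is injective.
\<close>

lemma has_SN_iff:
  fixes A :: "'p::prime_card padic_int mat"
  assumes A: "A \<in> carrier_mat n m" and nm: "n \<le> m" and lam: "lam \<in> Sig_nonneg n"
  shows "has_SN (map_mat to_fract A) lam \<longleftrightarrow> mequiv A (pdiag n m lam)"
proof -
  interpret tf: comm_ring_hom "to_fract :: 'p padic_int \<Rightarrow> 'p padic"
    by standard simp_all
  have inj: "map_mat to_fract X = map_mat to_fract Y \<Longrightarrow> X = Y" for X Y :: "'p padic_int mat"
    by (metis eq_matI index_map_mat to_fract_eq_iff)
  have "mat n m (\<lambda>(i, j). if i = j then of_nat CARD('p) powi (lam ! i) else 0) =
      (map_mat to_fract (pdiag n m lam :: 'p padic_int mat) :: 'p padic mat)"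
  proof (rule eq_matI)
    fix i j assume "i < dim_row (map_mat to_fract (pdiag n m lam :: 'p padic_int mat) :: 'p padic mat)"
      "j < dim_col (map_mat to_fract (pdiag n m lam :: 'p padic_int mat) :: 'p padic mat)"
    then have ij: "i < n" "j < m" by (auto simp: pdiag_def)
    then have "0 \<le> lam ! i" using lam by (auto simp: Sig_nonneg_def Sig_def)
    then show "mat n m (\<lambda>(i, j). if i = j then of_nat CARD('p) powi (lam ! i) else 0) $$ (i, j) =
      (map_mat to_fract (pdiag n m lam :: 'p padic_int mat) :: 'p padic mat) $$ (i, j)"
      using ij by (auto simp: pdiag_def power_int_def pp_def tf.hom_power tf.hom_of_nat)
  qed (auto simp: pdiag_def)
  moreover have "map_mat to_fract U * map_mat to_fract A * map_mat to_fract V =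
      (map_mat to_fract (U * A * V) :: 'p padic mat)" if "U \<in> GL n" "V \<in> GL m" for U V
    using that[THEN GL_carrier] A
    by (simp add: tf.mat_hom_mult[of _ n n _ m] tf.mat_hom_mult[of _ n m _ m])
  ultimately have "map_mat to_fract U * map_mat to_fract A * map_mat to_fract V =
      mat n m (\<lambda>(i, j). if i = j then of_nat CARD('p) powi (lam ! i) else 0) \<longleftrightarrow> U * A * V = pdiag n m lam"
    if "U \<in> GL n" "V \<in> GL m" for U V
    using that inj[of "U * A * V" "pdiag n m lam"] by auto
  moreover have "dim_row A = n" "dim_col A = m" "lam \<in> Sig n" using A lam by (auto simp: Sig_nonneg_def)
  ultimately show ?thesis
    unfolding has_SN_def mequiv_def Let_def using nm by (simp cong: bex_cong)
qed

section \<open>Averages over residues\<close>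

definition avg1 :: "nat \<Rightarrow> ('p::prime_card padic_int \<Rightarrow> real) \<Rightarrow> real" where
  "avg1 k g = (\<Sum>a<CARD('p) ^ k. g (of_nat a)) / real CARD('p) ^ k"

text \<open>
  Averages over vectors and over lists of columns are iterated, so that conditioning on the first
  entry or on the first column is a matter of unfolding.
\<close>

primrec avgv :: "nat \<Rightarrow> nat \<Rightarrow> ('p::prime_card padic_int vec \<Rightarrow> real) \<Rightarrow> real" where
  "avgv k 0 g = g vNil"
| "avgv k (Suc n) g = avg1 k (\<lambda>x. avgv k n (\<lambda>v. g (vCons x v)))"

primrec avgl :: "nat \<Rightarrow> nat \<Rightarrow> nat \<Rightarrow> ('p::prime_card padic_int vec list \<Rightarrow> real) \<Rightarrow> real" where
  "avgl k n 0 g = g []"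
| "avgl k n (Suc m) g = avgv k n (\<lambda>v. avgl k n m (\<lambda>vs. g (v # vs)))"

lemma card_pos: "0 < CARD('p::prime_card)"
  using p_pos[where 'p='p] by simp

lemma avg1_const [simp]: "avg1 k (\<lambda>_::'p::prime_card padic_int. c) = c"
  using card_pos[where 'p='p] by (simp add: avg1_def)

lemma avg1_add: "avg1 k (\<lambda>x. g x + h x) = avg1 k g + avg1 k h"
  by (simp add: avg1_def sum.distrib add_divide_distrib)

lemma avg1_cmult: "avg1 k (\<lambda>x. c * g x) = c * avg1 k g"
  by (simp add: avg1_def sum_distrib_left)

lemma avg1_divide: "avg1 k (\<lambda>x. g x / c) = avg1 k g / c"
  by (simp add: avg1_def sum_divide_distrib[symmetric])

lemma avg1_swap: "avg1 k (\<lambda>x. avg1 k (\<lambda>y. g x y)) = avg1 k (\<lambda>y. avg1 k (\<lambda>x. g x y))"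
  unfolding avg1_def by (simp add: sum_divide_distrib[symmetric] divide_simps) (rule sum.swap)

lemma avgv_cong:
  assumes "\<And>v. v \<in> carrier_vec n \<Longrightarrow> g v = h v"
  shows "avgv k n g = avgv k n h"
  using assms
proof (induction n arbitrary: g h)
  case (Suc n)
  have "avgv k n (\<lambda>v. g (vCons x v)) = avgv k n (\<lambda>v. h (vCons x v))" for x
    by (rule Suc.IH) (simp add: Suc.prems)
  then show ?case by simp
next
  case 0
  have "vNil \<in> carrier_vec 0" by simp
  then have "g vNil = h vNil" by (rule 0)
  then show ?case by simp
qed

lemma avgv_const [simp]: "avgv k n (\<lambda>_. c) = c"
  by (induction n) simp_all

lemma avgv_add: "avgv k n (\<lambda>x. g x + h x) = avgv k n g + avgv k n h"
  by (induction n arbitrary: g h) (simp_all add: avg1_add)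

lemma avgv_cmult: "avgv k n (\<lambda>x. c * g x) = c * avgv k n g"
  by (induction n arbitrary: g) (simp_all add: avg1_cmult)

lemma avg1_avgv_swap: "avg1 k (\<lambda>x. avgv k n (\<lambda>v. g x v)) = avgv k n (\<lambda>v. avg1 k (\<lambda>x. g x v))"
proof (induction n arbitrary: g)
  case (Suc n)
  have "avg1 k (\<lambda>x. avgv k (Suc n) (g x)) = avg1 k (\<lambda>y. avg1 k (\<lambda>x. avgv k n (\<lambda>v. g x (vCons y v))))"
    unfolding avgv.simps by (rule avg1_swap)
  then show ?case unfolding Suc.IH by simp
qed simp

lemma avgv_swap: "avgv k n (\<lambda>u. avgv k n' (\<lambda>v. g u v)) = avgv k n' (\<lambda>v. avgv k n (\<lambda>u. g u v))"
  by (induction n arbitrary: g) (simp_all add: avg1_avgv_swap)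

lemma avgl_cong:
  assumes "\<And>vs. set vs \<subseteq> carrier_vec n \<Longrightarrow> length vs = m \<Longrightarrow> g vs = h vs"
  shows "avgl k n m g = avgl k n m h"
  using assms
proof (induction m arbitrary: g h)
  case (Suc m)
  have "avgl k n m (\<lambda>vs. g (v # vs)) = avgl k n m (\<lambda>vs. h (v # vs))" if "v \<in> carrier_vec n" for v
    by (rule Suc.IH) (simp add: Suc.prems that)
  then show ?case by (auto intro!: avgv_cong)
qed simp

lemma avgl_const [simp]: "avgl k n m (\<lambda>_. c) = c"
  by (induction m) simp_all

lemma avgv_avgl_swap: "avgv k n (\<lambda>v. avgl k n m (\<lambda>vs. g v vs)) = avgl k n m (\<lambda>vs. avgv k n (\<lambda>v. g v vs))"
proof (induction m arbitrary: g)
  case (Suc m)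
  have "avgv k n (\<lambda>v. avgl k n (Suc m) (g v)) = avgv k n (\<lambda>w. avgv k n (\<lambda>v. avgl k n m (\<lambda>vs. g v (w # vs))))"
    unfolding avgl.simps by (rule avgv_swap)
  then show ?case unfolding Suc.IH by simp
qed simp

text \<open>
  The functions to be averaged are periodic modulo \<open>p^k\<close>, that is, constant on classes of \<open>congv k\<close>.
\<close>

definition congv :: "nat \<Rightarrow> 'p::prime_card padic_int vec \<Rightarrow> 'p padic_int vec \<Rightarrow> bool" where
  "congv k u v \<longleftrightarrow> dim_vec u = dim_vec v \<and> (\<forall>i<dim_vec v. pp ^ k dvd u $ i - v $ i)"

lemma congv_refl [simp]: "congv k v v"
  by (simp add: congv_def)

lemma congv_sym: "congv k u v \<Longrightarrow> congv k v u"
  unfolding congv_def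
proof (intro conjI allI impI; elim conjE)
  fix i assume "i < dim_vec u" "dim_vec u = dim_vec v" "\<forall>i<dim_vec v. pp ^ k dvd u $ i - v $ i"
  then have "pp ^ k dvd - (u $ i - v $ i)" by (simp only: dvd_minus_iff)
  then show "pp ^ k dvd v $ i - u $ i" by simp
qed simp

lemma congv_trans: "congv k u v \<Longrightarrow> congv k v w \<Longrightarrow> congv k u w"
  unfolding congv_def
proof (intro conjI allI impI; elim conjE)
  fix i assume i: "i < dim_vec w" and d: "dim_vec u = dim_vec v" "dim_vec v = dim_vec w"
    and "\<forall>i<dim_vec v. pp ^ k dvd u $ i - v $ i" "\<forall>i<dim_vec w. pp ^ k dvd v $ i - w $ i"
  then have "pp ^ k dvd (u $ i - v $ i) + (v $ i - w $ i)" by (intro dvd_add) auto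
  then show "pp ^ k dvd u $ i - w $ i" by simp
qed simp

lemma congv_mult:
  assumes "congv k u v" "u \<in> carrier_vec m" "U \<in> carrier_mat n m"
  shows "congv k (U *\<^sub>v u) (U *\<^sub>v v)"
  unfolding congv_def
proof (intro conjI allI impI)
  have d: "dim_vec u = dim_vec v" "\<forall>i<dim_vec v. pp ^ k dvd u $ i - v $ i" using assms(1) by (simp_all add: congv_def)
  have v: "v \<in> carrier_vec m" by (rule carrier_vecI) (use d(1) assms(2) in simp)
  fix i assume "i < dim_vec (U *\<^sub>v v)"
  then have i: "i < n" using assms by simp
  have "(U *\<^sub>v u) $ i - (U *\<^sub>v v) $ i = (\<Sum>j = 0..<m. U $$ (i, j) * (u $ j - v $ j))"
    using i assms(2,3) v by (simp add: scalar_prod_def right_diff_distrib sum_subtractf)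
  also have "pp ^ k dvd \<dots>"
    using d(2) v by (intro dvd_sum dvd_mult) auto
  finally show "pp ^ k dvd (U *\<^sub>v u) $ i - (U *\<^sub>v v) $ i" .
qed (use assms(3) in simp)

definition trunc :: "nat \<Rightarrow> 'p::prime_card padic_int \<Rightarrow> 'p padic_int" where
  "trunc k x = of_nat (nat (residue_seq x k))"

definition reps :: "nat \<Rightarrow> 'p::prime_card padic_int set" where
  "reps k = of_nat ` {..<CARD('p) ^ k}"

lemma residue_seq_bounds: "0 \<le> residue_seq x k" "residue_seq (x :: 'p::prime_card padic_int) k < int CARD('p) ^ k"
  using residue_seq[of x] by auto

lemma trunc_reps: "trunc k (x :: 'p::prime_card padic_int) \<in> reps k"
  unfolding trunc_def reps_def
  by (rule imageI) (use residue_seq_bounds[of x k] in \<open>simp add: nat_less_iff\<close>)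

lemma pp_power_dvd_diff_iff:
  "pp ^ k dvd x - y \<longleftrightarrow> residue_seq x k = residue_seq (y :: 'p::prime_card padic_int) k"
proof -
  have "residue_seq (x - y) k = 0 \<longleftrightarrow> residue_seq x k mod int CARD('p) ^ k = residue_seq y k mod int CARD('p) ^ k"
    unfolding minus_padic_int.rep_eq mod_eq_dvd_iff dvd_eq_mod_eq_0 ..
  then show ?thesis by (simp add: pp_power_dvd_iff)
qed

lemma residue_seq_of_nat: "a < CARD('p) ^ k \<Longrightarrow> residue_seq (of_nat a :: 'p::prime_card padic_int) k = int a"
  using residue_seq_of_int[of "int a" k, where 'p='p] by (simp flip: of_nat_power)

lemma trunc_cong: "pp ^ k dvd trunc k x - (x :: 'p::prime_card padic_int)"
  unfolding pp_power_dvd_diff_iff trunc_def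
  using residue_seq_bounds[of x k] by (subst residue_seq_of_nat) (auto simp: nat_less_iff)

lemma reps_cong_eq: "x \<in> reps k \<Longrightarrow> y \<in> reps k \<Longrightarrow> pp ^ k dvd x - (y :: 'p::prime_card padic_int) \<Longrightarrow> x = y"
  unfolding pp_power_dvd_diff_iff reps_def by (auto simp: residue_seq_of_nat)

lemma inj_of_nat_reps: "inj_on (of_nat :: nat \<Rightarrow> 'p::prime_card padic_int) {..<CARD('p) ^ k}"
proof (rule inj_onI)
  fix a b :: nat
  assume a: "a \<in> {..<CARD('p) ^ k}" and b: "b \<in> {..<CARD('p) ^ k}" and e: "(of_nat a :: 'p padic_int) = of_nat b"
  have "int a = residue_seq (of_nat a :: 'p padic_int) k"
    by (rule residue_seq_of_nat[symmetric]) (use a in simp)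
  also have "\<dots> = residue_seq (of_nat b :: 'p padic_int) k" by (simp only: e)
  also have "\<dots> = int b" by (rule residue_seq_of_nat) (use b in simp)
  finally show "a = b" by simp
qed

lemma finite_reps [simp]: "finite (reps k)"
  by (simp add: reps_def)

lemma avg1_reps: "avg1 k g = (\<Sum>x\<in>reps k. g (x :: 'p::prime_card padic_int)) / real CARD('p) ^ k"
  unfolding avg1_def reps_def by (simp add: sum.reindex[OF inj_of_nat_reps])

text \<open>
  Averages as sums over a finite set of representatives are needed only for changes of variables.
\<close>

definition vreps :: "nat \<Rightarrow> nat \<Rightarrow> 'p::prime_card padic_int vec set" where
  "vreps k n = {v \<in> carrier_vec n. \<forall>i<n. v $ i \<in> reps k}"

lemma vreps_0: "vreps k 0 = {vNil}"
  by (auto simp: vreps_def)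

lemma vreps_Suc: "vreps k (Suc n) = (\<lambda>(x, v). vCons x v) ` (reps k \<times> vreps k n)"
proof (rule subset_antisym; rule subsetI)
  fix v :: "'a padic_int vec" assume v: "v \<in> vreps k (Suc n)"
  then obtain x w where w: "v = vCons x w" by (cases v) (auto simp: vreps_def)
  have "x \<in> reps k" using v w by (force simp: vreps_def)
  moreover have "w \<in> vreps k n" using v w by (force simp: vreps_def)
  ultimately show "v \<in> (\<lambda>(x, v). vCons x v) ` (reps k \<times> vreps k n)" using w by auto
qed (auto simp: vreps_def vec_index_vCons)

lemma finite_vreps [simp]: "finite (vreps k n)"
  by (induction n) (simp_all add: vreps_0 vreps_Suc)

lemma avgv_vreps:
  "avgv k n g = (\<Sum>v\<in>vreps k n. g (v :: 'p::prime_card padic_int vec)) / real CARD('p) ^ (k * n)"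
proof (induction n arbitrary: g)
  case (Suc n)
  have "inj_on (\<lambda>(x, v). vCons x v) (reps k \<times> vreps k n :: ('p padic_int \<times> 'p padic_int vec) set)"
    by (auto simp: inj_on_def)
  then have "(\<Sum>v\<in>vreps k (Suc n). g v) = (\<Sum>x\<in>reps k. \<Sum>v\<in>vreps k n. g (vCons x v))"
    by (simp add: vreps_Suc sum.reindex sum.cartesian_product case_prod_unfold)
  then show ?case
    by (simp add: Suc avg1_reps sum_divide_distrib[symmetric] power_add)
qed (simp add: vreps_0)

text \<open>
  Multiplication by \<open>U\<close> followed by \<open>trunc\<close> permutes the representatives.
\<close>

lemma avgv_GL:
  fixes g :: "'p::prime_card padic_int vec \<Rightarrow> real"
  assumes U: "U \<in> GL n"
    and g: "\<And>u v. u \<in> carrier_vec n \<Longrightarrow> v \<in> carrier_vec n \<Longrightarrow> congv k u v \<Longrightarrow> g u = g v"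
  shows "avgv k n (\<lambda>v. g (U *\<^sub>v v)) = avgv k n g"
proof -
  obtain W where W: "W \<in> GL n" "U * W = 1\<^sub>m n" "W * U = 1\<^sub>m n" using GL_inverse[OF U] .
  define tv where "tv v = map_vec (trunc k) v" for v :: "'p padic_int vec"
  \<comment> \<open>\<open>tv\<close> picks the representative of a class.\<close>
  have tvc: "congv k (tv v) v" for v by (auto simp: tv_def congv_def trunc_cong)
  have tvr: "tv v \<in> vreps k n" if "v \<in> carrier_vec n" for v
    using that by (auto simp: tv_def vreps_def trunc_reps)
  have cr: "v \<in> carrier_vec n" if "v \<in> vreps k n" for v :: "'p padic_int vec"
    using that by (simp add: vreps_def)
  have eq: "u = v" if "u \<in> vreps k n" "v \<in> vreps k n" "congv k u v" for u v :: "'p padic_int vec"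
  proof (rule eq_vecI)
    fix i assume "i < dim_vec v"
    then have "u $ i \<in> reps k" "v $ i \<in> reps k" "pp ^ k dvd u $ i - v $ i"
      using that by (auto simp: vreps_def congv_def)
    then show "u $ i = v $ i" by (rule reps_cong_eq)
  qed (use that in \<open>simp add: congv_def\<close>)
  have inv: "tv (X *\<^sub>v tv (Y *\<^sub>v v)) = v"
    if XY: "X \<in> GL n" "Y \<in> GL n" "X * Y = 1\<^sub>m n" and v: "v \<in> vreps k n" for X Y v
  proof (rule eq)
    note c = XY(1,2)[THEN GL_carrier] cr[OF v]
    have Yv: "Y *\<^sub>v v \<in> carrier_vec n" using c by simp
    show "tv (X *\<^sub>v tv (Y *\<^sub>v v)) \<in> vreps k n"
      by (rule tvr, rule mult_mat_vec_carrier[OF c(1)], rule cr, rule tvr, rule Yv)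
    have "congv k (X *\<^sub>v tv (Y *\<^sub>v v)) (X *\<^sub>v (Y *\<^sub>v v))"
      by (rule congv_mult[OF tvc cr[OF tvr[OF Yv]] c(1)])
    also have "X *\<^sub>v (Y *\<^sub>v v) = v" using c XY(3) by (simp flip: assoc_mult_mat_vec)
    finally show "congv k (tv (X *\<^sub>v tv (Y *\<^sub>v v))) v" using congv_trans[OF tvc] by blast
  qed (rule v)
  have mem: "tv (X *\<^sub>v v) \<in> vreps k n" if "X \<in> GL n" "v \<in> vreps k n" for X and v :: "'p padic_int vec"
    by (rule tvr, rule mult_mat_vec_carrier[OF GL_carrier[OF that(1)] cr[OF that(2)]])
  have "(\<Sum>v\<in>vreps k n. g v) = (\<Sum>v\<in>vreps k n. g (tv (U *\<^sub>v v)))"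
    by (rule sum.reindex_bij_witness[of _ "\<lambda>v. tv (U *\<^sub>v v)" "\<lambda>v. tv (W *\<^sub>v v)"])
       (use inv mem U W in auto)
  also have "\<dots> = (\<Sum>v\<in>vreps k n. g (U *\<^sub>v v))"
  proof (rule sum.cong[OF refl])
    fix v :: "'p padic_int vec" assume "v \<in> vreps k n"
    then have "U *\<^sub>v v \<in> carrier_vec n" using cr GL_carrier[OF U] by simp
    then show "g (tv (U *\<^sub>v v)) = g (U *\<^sub>v v)" using cr tvr tvc by (intro g) auto
  qed
  finally show ?thesis by (simp add: avgv_vreps)
qed

lemma avgl_GL:
  fixes g :: "'p::prime_card padic_int vec list \<Rightarrow> real"
  assumes U: "U \<in> GL n"
    and g: "\<And>us vs. set us \<subseteq> carrier_vec n \<Longrightarrow> set vs \<subseteq> carrier_vec n \<Longrightarrow> length vs = m \<Longrightarrow>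
      list_all2 (congv k) us vs \<Longrightarrow> g us = g vs"
  shows "avgl k n m (\<lambda>vs. g (map (\<lambda>v. U *\<^sub>v v) vs)) = avgl k n m g"
  using g
proof (induction m arbitrary: g)
  case (Suc m)
  have Uv: "U *\<^sub>v v \<in> carrier_vec n" for v
    by (rule carrier_vecI) (use GL_carrier[OF U] in simp)
  have "avgl k n (Suc m) (\<lambda>vs. g (map (\<lambda>v. U *\<^sub>v v) vs)) =
      avgv k n (\<lambda>v. avgl k n m (\<lambda>vs. g ((U *\<^sub>v v) # map (\<lambda>v. U *\<^sub>v v) vs)))" by simp
  also have "\<dots> = avgv k n (\<lambda>v. avgl k n m (\<lambda>vs. g ((U *\<^sub>v v) # vs)))"
  proof (rule avgv_cong, rule Suc.IH)
    fix v :: "'p padic_int vec" and us vs :: "'p padic_int vec list"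
    assume "set us \<subseteq> carrier_vec n" "set vs \<subseteq> carrier_vec n" "length vs = m" "list_all2 (congv k) us vs"
    then show "g ((U *\<^sub>v v) # us) = g ((U *\<^sub>v v) # vs)"
      using Uv by (intro Suc.prems) simp_all
  qed
  also have "\<dots> = avgv k n (\<lambda>v. avgl k n m (\<lambda>vs. g (v # vs)))"
  proof (rule avgv_GL[OF U], rule avgl_cong)
    fix u v :: "'p padic_int vec" and vs :: "'p padic_int vec list"
    assume "u \<in> carrier_vec n" "v \<in> carrier_vec n" "congv k u v" "set vs \<subseteq> carrier_vec n" "length vs = m"
    then show "g (u # vs) = g (v # vs)"
      by (intro Suc.prems) (simp_all add: list_all2_refl)
  qed
  finally show ?case by simp
qed simp

lemma pp_dvd_of_nat_iff:
  "pp dvd (of_nat a :: 'p::prime_card padic_int) \<longleftrightarrow> CARD('p) dvd a"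
proof -
  have "residue_seq (of_nat a :: 'p padic_int) 1 = int a mod int CARD('p)"
    using residue_seq_of_int[of "int a" 1, where 'p='p] by simp
  then show ?thesis using pp_power_dvd_iff[of 1 "of_nat a :: 'p padic_int"]
    by (simp flip: of_nat_mod add: dvd_eq_mod_eq_0)
qed

text \<open>
  Both sides sum \<open>g\<close> over the residues divisible by \<open>p\<close>; on the right each of them occurs \<open>p\<close> times.
\<close>

lemma avg1_pp:
  fixes g :: "'p::prime_card padic_int \<Rightarrow> real"
  assumes k: "1 \<le> k" and g: "\<And>x y. pp ^ k dvd x - y \<Longrightarrow> g x = g y"
  shows "avg1 k (\<lambda>x. if pp dvd x then g x else 0) = avg1 k (\<lambda>x. g (pp * x)) / real CARD('p)"
proof -
  let ?p = "CARD('p)"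
  obtain l where l: "k = Suc l" using k by (cases k) auto
  have p: "0 < ?p" by (rule card_pos)
  have "(\<Sum>a<?p ^ k. if pp dvd (of_nat a :: 'p padic_int) then g (of_nat a) else 0) =
      (\<Sum>a | a < ?p ^ k \<and> ?p dvd a. g (of_nat a))"
    unfolding pp_dvd_of_nat_iff by (subst sum.inter_filter[symmetric]) (auto intro!: sum.cong)
  also have "\<dots> = (\<Sum>b<?p ^ l. g (pp * of_nat b))"
    by (rule sum.reindex_bij_witness[of _ "\<lambda>b. ?p * b" "\<lambda>a. a div ?p"])
       (use p in \<open>auto simp: l pp_def elim!: dvdE\<close>)
  finally have 1: "(\<Sum>a<?p ^ k. if pp dvd (of_nat a :: 'p padic_int) then g (of_nat a) else 0) =
      (\<Sum>b<?p ^ l. g (pp * of_nat b))" .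
  have "(\<Sum>a<?p ^ k. g (pp * of_nat a)) = (\<Sum>(c, b)\<in>{..<?p} \<times> {..<?p ^ l}. g (pp * of_nat (b + c * ?p ^ l)))"
  proof (rule sum.reindex_bij_witness[of _ "\<lambda>(c, b). b + c * ?p ^ l" "\<lambda>a. (a div ?p ^ l, a mod ?p ^ l)"])
    fix x assume "x \<in> {..<?p} \<times> {..<?p ^ l}"
    then obtain c b where x: "x = (c, b)" "c < ?p" "b < ?p ^ l" by auto
    have "b + c * ?p ^ l < (c + 1) * ?p ^ l" using x by simp
    also have "\<dots> \<le> ?p * ?p ^ l" using x by (intro mult_right_mono) auto
    finally show "(case x of (c, b) \<Rightarrow> b + c * ?p ^ l) \<in> {..<?p ^ k}" using x by (simp add: l)
  qed (use p in \<open>auto simp: l less_mult_imp_div_less mult.commute simp del: of_nat_add of_nat_mult of_nat_power\<close>)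
  also have "\<dots> = (\<Sum>(c, b)\<in>{..<?p} \<times> {..<?p ^ l}. g (pp * of_nat b))"
  proof (rule sum.cong[OF refl], clarify)
    fix c b
    have "pp * of_nat (b + c * ?p ^ l) - pp * of_nat b = (pp ^ k * of_nat c :: 'p padic_int)"
      by (simp add: l pp_def algebra_simps)
    then show "g (pp * of_nat (b + c * ?p ^ l)) = g (pp * of_nat b)" by (intro g) simp
  qed
  also have "\<dots> = real ?p * (\<Sum>b<?p ^ l. g (pp * of_nat b))"
    by (simp flip: sum.cartesian_product)
  finally show ?thesis using 1 p by (simp add: avg1_def)
qed

lemma avgv_pp:
  fixes g :: "'p::prime_card padic_int vec \<Rightarrow> real"
  assumes k: "1 \<le> k" and g: "\<And>u v. u \<in> carrier_vec n \<Longrightarrow> v \<in> carrier_vec n \<Longrightarrow> congv k u v \<Longrightarrow> g u = g v"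
  shows "avgv k n (\<lambda>v. if \<forall>i<n. pp dvd v $ i then g v else 0) = avgv k n (\<lambda>v. g (pp \<cdot>\<^sub>v v)) / real CARD('p) ^ n"
  using g
proof (induction n arbitrary: g)
  case 0
  have "pp \<cdot>\<^sub>v vNil = (vNil :: 'p padic_int vec)" by (rule eq_vecI) auto
  then show ?case by simp
next
  case (Suc n)
  have sm: "pp \<cdot>\<^sub>v vCons x v = vCons (pp * x) (pp \<cdot>\<^sub>v v)" for x :: "'p padic_int" and v
    by (rule eq_vecI) (auto simp: vec_index_vCons)
  have cg: "congv k (vCons x u) (vCons y v)" if "pp ^ k dvd x - y" "congv k u v" for x y :: "'p padic_int" and u v
    using that by (auto simp: congv_def vec_index_vCons)
  have "avgv k (Suc n) (\<lambda>v. if \<forall>i<Suc n. pp dvd v $ i then g v else 0) =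
      avg1 k (\<lambda>x. if pp dvd x then avgv k n (\<lambda>v. if \<forall>i<n. pp dvd v $ i then g (vCons x v) else 0) else 0)"
    unfolding avgv.simps
  proof (rule arg_cong[of _ _ "avg1 k"], rule ext)
    fix x :: "'p padic_int"
    show "avgv k n (\<lambda>v. if \<forall>i<Suc n. pp dvd vCons x v $ i then g (vCons x v) else 0) =
      (if pp dvd x then avgv k n (\<lambda>v. if \<forall>i<n. pp dvd v $ i then g (vCons x v) else 0) else 0)"
      by (auto simp: All_less_Suc2)
  qed
  also have "\<dots> = avg1 k (\<lambda>x. if pp dvd x then avgv k n (\<lambda>v. g (vCons x (pp \<cdot>\<^sub>v v))) / real CARD('p) ^ n else 0)"
    by (subst Suc.IH) (auto intro!: Suc.prems cg)
  also have "\<dots> = avg1 k (\<lambda>x. avgv k n (\<lambda>v. g (vCons (pp * x) (pp \<cdot>\<^sub>v v))) / real CARD('p) ^ n) / real CARD('p)"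
    by (rule avg1_pp[OF k], rule arg_cong2[of _ _ _ _ "(/)"], rule avgv_cong)
       (auto intro!: Suc.prems cg)
  also have "\<dots> = avgv k (Suc n) (\<lambda>v. g (pp \<cdot>\<^sub>v v)) / real CARD('p) ^ Suc n"
    by (simp add: sm avg1_divide)
  finally show ?case .
qed

definition vtail :: "'a vec \<Rightarrow> 'a vec" where
  "vtail v = vec (dim_vec v - 1) (\<lambda>i. v $ Suc i)"

lemma vtail_vCons [simp]: "vtail (vCons x v) = v"
  by (rule eq_vecI) (auto simp: vtail_def)

lemma avgl_vtail: "avgl k (Suc n) m (\<lambda>vs. g (map vtail vs)) = avgl k n m g"
proof (induction m arbitrary: g)
  case (Suc m)
  have "avgl k (Suc n) (Suc m) (\<lambda>vs. g (map vtail vs)) = avgv k (Suc n) (\<lambda>v. avgl k (Suc n) m (\<lambda>vs. g (vtail v # map vtail vs)))"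
    by (simp del: avgv.simps)
  also have "\<dots> = avgv k (Suc n) (\<lambda>v. avgl k n m (\<lambda>vs. g (vtail v # vs)))"
    by (subst Suc.IH[of "\<lambda>vs. g (vtail _ # vs)"]) (rule refl)
  finally show ?case by simp
qed simp

section \<open>A recursion over the columns\<close>

definition snf_ind :: "nat \<Rightarrow> int list \<Rightarrow> 'p::prime_card padic_int vec list \<Rightarrow> real" where
  "snf_ind n lam cl = of_bool (mequiv (mat_of_cols n cl) (pdiag n (length cl) lam))"

lemma snf_ind_cong:
  assumes "set us \<subseteq> carrier_vec n" "set vs \<subseteq> carrier_vec n" "list_all2 (congv k) us vs"
    and nm: "n \<le> length vs" and k: "\<And>i. i < n \<Longrightarrow> nat (lam ! i) < k"
  shows "snf_ind n lam us = snf_ind n lam vs"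
proof -
  have l: "length us = length vs" using assms(3) by (rule list_all2_lengthD)
  have sub: "mequiv (mat_of_cols n us) (pdiag n (length us) lam)"
    if "mequiv (mat_of_cols n vs) (pdiag n (length vs) lam)" "length us = length vs" "n \<le> length vs"
      "list_all2 (congv k) us vs" "set us \<subseteq> carrier_vec n" "set vs \<subseteq> carrier_vec n"
    for us vs :: "'a padic_int vec list"
  proof -
    have "cong_mat k (mat_of_cols n us) (mat_of_cols n vs)"
      unfolding cong_mat_def
    proof (intro allI impI)
      fix i j assume ij: "i < dim_row (mat_of_cols n us)" "j < dim_col (mat_of_cols n us)"
      then have "congv k (us ! j) (vs ! j)" using that by (auto simp: list_all2_conv_all_nth)
      moreover have "vs ! j \<in> carrier_vec n" using ij that by auto
      ultimately have "pp ^ k dvd us ! j $ i - vs ! j $ i" using ij by (simp add: congv_def)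
      then show "pp ^ k dvd mat_of_cols n us $$ (i, j) - mat_of_cols n vs $$ (i, j)"
        using ij that by (simp add: mat_of_cols_index)
    qed
    moreover have "mat_of_cols n us \<in> carrier_mat n (length vs)" using that(2) by (auto simp: mat_of_cols_def)
    ultimately show ?thesis using mequiv_pdiag_cong[OF mat_of_cols_carrier(1) _ that(3) k _ that(1)] that(2) by simp
  qed
  have "list_all2 (congv k) vs us"
    using assms(3) by (simp add: list_all2_conv_all_nth congv_sym)
  then have "mequiv (mat_of_cols n us) (pdiag n (length us) lam) \<longleftrightarrow> mequiv (mat_of_cols n vs) (pdiag n (length vs) lam)"
    using sub[OF _ l nm assms(3,1,2)] sub[OF _ l[symmetric] _ _ assms(2,1)] l nm by metis
  then show ?thesis unfolding snf_ind_def by (simp only:)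
qed

lemma snf_ind_GL:
  assumes U: "U \<in> GL n" and c: "set cl \<subseteq> carrier_vec n"
  shows "snf_ind n lam (map (\<lambda>v. U *\<^sub>v v) cl) = snf_ind n lam cl"
proof -
  have Uc: "U \<in> carrier_mat n n" using U by (rule GL_carrier)
  have "mat_of_cols n (map (\<lambda>v. U *\<^sub>v v) cl) = U * mat_of_cols n cl"
  proof (rule eq_matI)
    fix i j assume "i < dim_row (U * mat_of_cols n cl)" "j < dim_col (U * mat_of_cols n cl)"
    then have ij: "i < n" "j < length cl" using Uc by auto
    then have "cl ! j \<in> carrier_vec n" using c by auto
    then show "mat_of_cols n (map (\<lambda>v. U *\<^sub>v v) cl) $$ (i, j) = (U * mat_of_cols n cl) $$ (i, j)"
      using ij Uc by (simp add: mat_of_cols_index)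
  qed (use Uc in auto)
  then show ?thesis unfolding snf_ind_def
    using mequiv_left_iff[OF mequiv_mult_left[OF mat_of_cols_carrier(1) U] mat_of_cols_carrier(1)] by simp
qed

text \<open>
  Serves to move a column that is divisible by \<open>p\<close> behind the free columns.
\<close>

lemma snf_ind_move:
  assumes "set (x # bs @ cs) \<subseteq> carrier_vec n"
  shows "snf_ind n lam (x # bs @ cs) = snf_ind n lam (bs @ x # cs)"
proof -
  let ?a = "length bs" and ?m = "length (bs @ x # cs)"
  let ?p = "\<lambda>j. if j < ?a then Suc j else if j = ?a then 0 else j"
  have p: "?p permutes {..<?m}"
  proof (rule bij_imp_permutes)
    show "bij_betw ?p {..<?m} {..<?m}"
      by (rule bij_betwI[of _ _ _ "\<lambda>j. if j = 0 then ?a else if j \<le> ?a then j - 1 else j"]) auto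
  qed auto
  have id: "(\<lambda>i. i) permutes {..<n}" using permutes_id[of "{..<n}"] by (simp add: id_def)
  have c: "mat_of_cols n (x # bs @ cs) \<in> carrier_mat n ?m" by (auto simp: mat_of_cols_def)
  have "mat n ?m (\<lambda>(i, j). mat_of_cols n (x # bs @ cs) $$ (i, ?p j)) = mat_of_cols n (bs @ x # cs)"
    by (rule eq_matI) (auto simp: mat_of_cols_index nth_append nth_Cons')
  then have "mequiv (mat_of_cols n (x # bs @ cs)) (mat_of_cols n (bs @ x # cs))"
    using mequiv_permute[OF c id p] by (simp only:)
  from mequiv_left_iff[OF this c] show ?thesis
    by (simp add: snf_ind_def)
qed

lemma snf_ind_pivot:
  assumes c: "set cl \<subseteq> carrier_vec (Suc n)" and nm: "n \<le> length cl" and lam: "lam \<in> Sig_nonneg (Suc n)"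
  shows "snf_ind (Suc n) lam (unit_vec (Suc n) 0 # cl) =
    (if last lam = 0 then snf_ind n (butlast lam) (map vtail cl) else 0)"
proof -
  let ?w = "mat 1 (length cl) (\<lambda>(_, j). cl ! j $ 0)"
  let ?A = "mat_of_cols n (map vtail cl)"
  have A: "?A \<in> carrier_mat n (length cl)" by (auto simp: mat_of_cols_def)
  have e: "mat_of_cols (Suc n) (unit_vec (Suc n) 0 # cl) = four_block_mat (1\<^sub>m 1) ?w (0\<^sub>m n 1) ?A"
  proof (rule eq_matI)
    fix i j assume "i < dim_row (four_block_mat (1\<^sub>m 1) ?w (0\<^sub>m n 1) ?A)"
      "j < dim_col (four_block_mat (1\<^sub>m 1) ?w (0\<^sub>m n 1) ?A)"
    then have ij: "i < Suc n" "j < Suc (length cl)" by auto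
    show "mat_of_cols (Suc n) (unit_vec (Suc n) 0 # cl) $$ (i, j) =
      four_block_mat (1\<^sub>m 1) ?w (0\<^sub>m n 1) ?A $$ (i, j)"
    proof (cases j)
      case 0
      then show ?thesis using ij by (auto simp: mat_of_cols_index)
    next
      case (Suc l)
      then have "cl ! l \<in> carrier_vec (Suc n)" using c ij by auto
      then show ?thesis using Suc ij by (auto simp: mat_of_cols_index vtail_def)
    qed
  qed auto
  show ?thesis unfolding snf_ind_def e
    using mequiv_pivot_iff[OF A _ nm lam, of ?w] by simp
qed

lemma snf_ind_smult:
  assumes c: "set cl \<subseteq> carrier_vec n" and nm: "n \<le> length cl" and lam: "lam \<in> Sig_nonneg n"
  shows "snf_ind n lam (map (\<lambda>v. pp \<cdot>\<^sub>v v) cl) =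
    (if \<forall>x\<in>set lam. 1 \<le> x then snf_ind n (map (\<lambda>x. x - 1) lam) cl else 0)"
proof -
  have "mat_of_cols n (map (\<lambda>v. pp \<cdot>\<^sub>v v) cl) = pp \<cdot>\<^sub>m mat_of_cols n cl"
  proof (rule eq_matI)
    fix i j assume "i < dim_row (pp \<cdot>\<^sub>m mat_of_cols n cl)" "j < dim_col (pp \<cdot>\<^sub>m mat_of_cols n cl)"
    then have ij: "i < n" "j < length cl" by auto
    then have "cl ! j \<in> carrier_vec n" using c by auto
    then show "mat_of_cols n (map (\<lambda>v. pp \<cdot>\<^sub>v v) cl) $$ (i, j) = (pp \<cdot>\<^sub>m mat_of_cols n cl) $$ (i, j)"
      using ij by (simp add: mat_of_cols_index)
  qed auto
  then show ?thesis unfolding snf_ind_def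
    using mequiv_smult_pp[of "mat_of_cols n cl" n "length cl" lam] nm lam
    by (simp add: Sig_nonneg_def Sig_def)
qed

text \<open>
  The average runs over matrices with \<open>a\<close> free columns followed by \<open>b\<close> columns divisible by \<open>p\<close>. The
  \<open>itself\<close> argument names the ring, which the result type does not determine.
\<close>

definition snf_avg :: "'p::prime_card itself \<Rightarrow> nat \<Rightarrow> nat \<Rightarrow> nat \<Rightarrow> nat \<Rightarrow> int list \<Rightarrow> real" where
  "snf_avg _ k n a b lam = avgl k n a (\<lambda>bs. avgl k n b (\<lambda>cs.
     snf_ind n lam (bs @ map (\<lambda>v. pp \<cdot>\<^sub>v v) cs :: 'p padic_int vec list)))"

lemma snf_avg_dim_0: "snf_avg TYPE('p::prime_card) k 0 a b [] = 1"
proof -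
  have "mequiv (mat_of_cols 0 cl) (pdiag 0 (length cl) [])" for cl :: "'p padic_int vec list"
  proof -
    have "mat_of_cols 0 cl = pdiag 0 (length cl) []" by (rule eq_matI) (auto simp: pdiag_def)
    then show ?thesis by (simp add: mequiv_refl)
  qed
  then have "snf_ind 0 [] cl = 1" for cl :: "'p padic_int vec list" by (simp add: snf_ind_def)
  then show ?thesis by (simp add: snf_avg_def)
qed

text \<open>
  Without free columns the whole matrix is divisible by \<open>p\<close>, and the quotient has only free columns.
\<close>

lemma snf_avg_0:
  assumes "n \<le> b" "lam \<in> Sig_nonneg n"
  shows "snf_avg TYPE('p::prime_card) k n 0 b lam =
    (if \<forall>x\<in>set lam. 1 \<le> x then snf_avg TYPE('p) k n b 0 (map (\<lambda>x. x - 1) lam) else 0)"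
proof -
  have e: "snf_ind n lam (map (\<lambda>v. pp \<cdot>\<^sub>v v) cs) =
      (if \<forall>x\<in>set lam. 1 \<le> x then snf_ind n (map (\<lambda>x. x - 1) lam) cs else 0)"
    if "set cs \<subseteq> carrier_vec n" "length cs = b" for cs :: "'p padic_int vec list"
    using that assms by (intro snf_ind_smult) auto
  show ?thesis
  proof (cases "\<forall>x\<in>set lam. 1 \<le> x")
    case True
    then show ?thesis unfolding snf_avg_def using e by (auto intro!: avgl_cong)
  next
    case False
    then have "snf_avg TYPE('p) k n 0 b lam = avgl k n b (\<lambda>_ :: 'p padic_int vec list. 0)"
      unfolding snf_avg_def avgl.simps append_Nil
    proof (intro avgl_cong)
      fix cs :: "'p padic_int vec list" assume "set cs \<subseteq> carrier_vec n" "length cs = b"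
      from e[OF this] False show "snf_ind n lam (map (\<lambda>v. pp \<cdot>\<^sub>v v) cs) = 0" by (simp only: if_False)
    qed
    then show ?thesis unfolding if_not_P[OF False] by simp
  qed
qed

lemma Sig_nonneg_butlast:
  "lam \<in> Sig_nonneg (Suc n) \<Longrightarrow> butlast lam \<in> Sig_nonneg n"
  by (auto simp: Sig_nonneg_def Sig_def sorted_wrt_iff_nth_less nth_butlast dest: in_set_butlastD)

lemma mult_mat_vec_smult:
  fixes U :: "'a::comm_ring_1 mat"
  assumes "U \<in> carrier_mat n m" "v \<in> carrier_vec m"
  shows "U *\<^sub>v (c \<cdot>\<^sub>v v) = c \<cdot>\<^sub>v (U *\<^sub>v v)"
  using assms by (intro eq_vecI) (auto simp: scalar_prod_def sum_distrib_left mult_ac)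

text \<open>
  The first free column is divisible by \<open>p\<close> with probability \<open>t^(n+1)\<close>; it then behaves like one more
  column of the second kind. Otherwise some \<open>U\<close>, depending on this column only, maps it to the first
  unit vector. The remaining columns keep their distribution when they are multiplied by \<open>U\<close>, and
  \<open>snf_ind_pivot\<close> removes the first row and column.
\<close>

lemma snf_avg_Suc:
  assumes nm: "n \<le> a + b" and lam: "lam \<in> Sig_nonneg (Suc n)" and k: "\<And>i. i < Suc n \<Longrightarrow> nat (lam ! i) < k"
  shows "snf_avg TYPE('p::prime_card) k (Suc n) (Suc a) b lam =
    snf_avg TYPE('p) k (Suc n) a (Suc b) lam / real CARD('p) ^ Suc n +
    (1 - 1 / real CARD('p) ^ Suc n) * (if last lam = 0 then snf_avg TYPE('p) k n a b (butlast lam) else 0)"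
proof -
  let ?N = "Suc n" and ?s = "\<lambda>v :: 'p padic_int vec. pp \<cdot>\<^sub>v v"
  let ?c = "if last lam = 0 then snf_avg TYPE('p) k n a b (butlast lam) else 0"
  define F where "F x = avgl k ?N a (\<lambda>bs. avgl k ?N b (\<lambda>cs. snf_ind ?N lam (x # bs @ map ?s cs)))" for x :: "'p padic_int vec"
  define D where "D x \<longleftrightarrow> (\<forall>i<?N. pp dvd (x $ i))" for x :: "'p padic_int vec"
  have k1: "1 \<le> k" using k[of 0] by simp
  have s_cong: "congv k (?s u) (?s v)" if "congv k u v" for u v
    using that by (auto simp: congv_def simp flip: right_diff_distrib)
  have s_cong_list: "list_all2 (congv k) (map ?s us) (map ?s vs)" if "list_all2 (congv k) us vs" for us vs
    using that s_cong by (simp add: list_all2_conv_all_nth)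
  have sc: "set (map ?s vs) \<subseteq> carrier_vec ?N" if "set vs \<subseteq> carrier_vec ?N" for vs
    using that by auto
  have F_cong: "F u = F v" if "u \<in> carrier_vec ?N" "v \<in> carrier_vec ?N" "congv k u v" for u v
    unfolding F_def
    by (intro avgl_cong snf_ind_cong[OF _ _ _ _ k])
       (use that nm sc in \<open>auto intro!: list_all2_appendI list.rel_refl\<close>)
  have F_dvd: "avgv k ?N (\<lambda>x. F (?s x)) = snf_avg TYPE('p) k ?N a (Suc b) lam"
  proof -
    have "F (?s x) = avgl k ?N a (\<lambda>bs. avgl k ?N b (\<lambda>cs. snf_ind ?N lam (bs @ map ?s (x # cs))))"
      if "x \<in> carrier_vec ?N" for x
      unfolding F_def
    proof (intro avgl_cong)
      fix bs cs :: "'p padic_int vec list"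
      assume "set bs \<subseteq> carrier_vec ?N" "set cs \<subseteq> carrier_vec ?N"
      then have "set (?s x # bs @ map ?s cs) \<subseteq> carrier_vec ?N" using that sc by auto
      from snf_ind_move[OF this, of lam]
      show "snf_ind ?N lam (?s x # bs @ map ?s cs) = snf_ind ?N lam (bs @ map ?s (x # cs))" by simp
    qed
    then have "avgv k ?N (\<lambda>x. F (?s x)) =
        avgv k ?N (\<lambda>x. avgl k ?N a (\<lambda>bs. avgl k ?N b (\<lambda>cs. snf_ind ?N lam (bs @ map ?s (x # cs)))))"
      by (intro avgv_cong)
    also have "\<dots> = snf_avg TYPE('p) k ?N a (Suc b) lam"
      unfolding avgv_avgl_swap snf_avg_def avgl.simps ..
    finally show ?thesis .
  qed
  have F_unit: "F x = ?c" if x: "x \<in> carrier_vec ?N" "\<not> D x" for x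
  proof -
    obtain U where U: "U \<in> GL ?N" "U *\<^sub>v x = unit_vec ?N 0"
      using unimodular_GL[OF x(1)] x(2) by (auto simp: D_def)
    note Uc = GL_carrier[OF U(1)]
    let ?e = "unit_vec ?N 0 :: 'p padic_int vec" and ?U = "\<lambda>v. U *\<^sub>v v"
    have ec: "?e \<in> carrier_vec ?N" by simp
    have "F x = avgl k ?N a (\<lambda>bs. avgl k ?N b (\<lambda>cs. snf_ind ?N lam (?e # map ?U bs @ map ?s (map ?U cs))))"
      unfolding F_def
    proof (intro avgl_cong)
      fix bs cs :: "'p padic_int vec list"
      assume c: "set bs \<subseteq> carrier_vec ?N" "set cs \<subseteq> carrier_vec ?N"
      have "map ?s (map ?U cs) = map ?U (map ?s cs)"
        using c(2) by (auto simp: mult_mat_vec_smult[OF Uc] subset_iff)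
      then have e: "?e # map ?U bs @ map ?s (map ?U cs) = map ?U (x # bs @ map ?s cs)" using U(2) by simp
      have "set (x # bs @ map ?s cs) \<subseteq> carrier_vec ?N" using x(1) c sc[OF c(2)] by simp
      then show "snf_ind ?N lam (x # bs @ map ?s cs) = snf_ind ?N lam (?e # map ?U bs @ map ?s (map ?U cs))"
        unfolding e by (rule snf_ind_GL[OF U(1), symmetric])
    qed
    also have "\<dots> = avgl k ?N a (\<lambda>bs. avgl k ?N b (\<lambda>cs. snf_ind ?N lam (?e # map ?U bs @ map ?s cs)))"
    proof (rule avgl_cong, rule avgl_GL[OF U(1), where g = "\<lambda>cs. snf_ind ?N lam (?e # map ?U _ @ map ?s cs)"])
      fix bs us vs :: "'p padic_int vec list"
      assume "set bs \<subseteq> carrier_vec ?N" "length bs = a" "set us \<subseteq> carrier_vec ?N" "set vs \<subseteq> carrier_vec ?N"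
        "length vs = b" "list_all2 (congv k) us vs"
      then show "snf_ind ?N lam (?e # map ?U bs @ map ?s us) = snf_ind ?N lam (?e # map ?U bs @ map ?s vs)"
        using nm Uc by (intro snf_ind_cong[OF _ _ _ _ k, of _ ?N])
          (auto intro!: list_all2_appendI list.rel_refl s_cong_list)
    qed
    also have "\<dots> = avgl k ?N a (\<lambda>bs. avgl k ?N b (\<lambda>cs. snf_ind ?N lam (?e # bs @ map ?s cs)))"
    proof (rule avgl_GL[OF U(1), where g = "\<lambda>bs. avgl k ?N b (\<lambda>cs. snf_ind ?N lam (?e # bs @ map ?s cs))"], rule avgl_cong)
      fix cs us vs :: "'p padic_int vec list"
      assume "set cs \<subseteq> carrier_vec ?N" "length cs = b" "set us \<subseteq> carrier_vec ?N" "set vs \<subseteq> carrier_vec ?N"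
        "length vs = a" "list_all2 (congv k) us vs"
      then show "snf_ind ?N lam (?e # us @ map ?s cs) = snf_ind ?N lam (?e # vs @ map ?s cs)"
        using nm by (intro snf_ind_cong[OF _ _ _ _ k, of _ ?N])
          (auto intro!: list_all2_appendI list.rel_refl)
    qed
    also have "\<dots> = avgl k ?N a (\<lambda>bs. avgl k ?N b (\<lambda>cs. if last lam = 0
        then snf_ind n (butlast lam) (map vtail bs @ map ?s (map vtail cs)) else 0))"
    proof (intro avgl_cong)
      fix bs cs :: "'p padic_int vec list"
      assume c: "set bs \<subseteq> carrier_vec ?N" "length bs = a" "set cs \<subseteq> carrier_vec ?N" "length cs = b"
      have e: "map ?s (map vtail cs) = map vtail (map ?s cs)"
        by (auto simp: vtail_def intro!: eq_vecI)
      show "snf_ind ?N lam (?e # bs @ map ?s cs) =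
          (if last lam = 0 then snf_ind n (butlast lam) (map vtail bs @ map ?s (map vtail cs)) else 0)"
        using snf_ind_pivot[of "bs @ map ?s cs" n lam] c sc[OF c(3)] nm lam unfolding e map_append[symmetric]
        by (simp del: map_append map_map)
    qed
    also have "\<dots> = ?c"
    proof (cases "last lam = 0")
      case True
      have "avgl k ?N a (\<lambda>bs. avgl k ?N b (\<lambda>cs. snf_ind n (butlast lam) (map vtail bs @ map ?s (map vtail cs)))) =
        avgl k ?N a (\<lambda>bs. avgl k n b (\<lambda>cs. snf_ind n (butlast lam) (map vtail bs @ map ?s cs)))"
        by (intro avgl_cong avgl_vtail[of _ _ _ "\<lambda>cs. snf_ind n (butlast lam) (map vtail _ @ map ?s cs)"])
      also have "\<dots> = snf_avg TYPE('p) k n a b (butlast lam)"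
        unfolding snf_avg_def
        by (rule avgl_vtail[of _ _ _ "\<lambda>bs. avgl k n b (\<lambda>cs. snf_ind n (butlast lam) (bs @ map ?s cs))"])
      finally show ?thesis using True by simp
    qed simp
    finally show ?thesis .
  qed
  have D_avg: "avgv k ?N (\<lambda>x. if D x then g x else 0) = avgv k ?N (\<lambda>x. g (?s x)) / real CARD('p) ^ ?N"
    if "\<And>u v. u \<in> carrier_vec ?N \<Longrightarrow> v \<in> carrier_vec ?N \<Longrightarrow> congv k u v \<Longrightarrow> g u = g v" for g
    unfolding D_def by (rule avgv_pp[OF k1 that])
  have DF: "avgv k ?N (\<lambda>x. if D x then F x else 0) = avgv k ?N (\<lambda>x. F (?s x)) / real CARD('p) ^ ?N"
    by (rule D_avg, rule F_cong)
  have "snf_avg TYPE('p) k ?N (Suc a) b lam = avgv k ?N F"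
    by (simp add: snf_avg_def F_def[abs_def] del: avgv.simps)
  \<comment> \<open>Outside \<open>D\<close> the function \<open>F\<close> is the constant \<open>?c\<close>.\<close>
  also have "\<dots> = avgv k ?N (\<lambda>x. (if D x then F x else 0) + (?c + (- ?c) * (if D x then 1 else 0)))"
  proof (rule avgv_cong)
    fix x :: "'p padic_int vec" assume "x \<in> carrier_vec ?N"
    then show "F x = (if D x then F x else 0) + (?c + (- ?c) * (if D x then 1 else 0))"
      using F_unit[of x] by (cases "D x") simp_all
  qed
  also have "\<dots> = avgv k ?N (\<lambda>x. F (?s x)) / real CARD('p) ^ ?N + (?c + (- ?c) * (1 / real CARD('p) ^ ?N))"
    unfolding avgv_add avgv_cmult avgv_const DF D_avg[of "\<lambda>_. 1", OF refl] ..
  also have "\<dots> = snf_avg TYPE('p) k (Suc n) a (Suc b) lam / real CARD('p) ^ Suc n +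
    (1 - 1 / real CARD('p) ^ Suc n) * ?c"
    unfolding F_dvd by (simp add: algebra_simps)
  finally show ?thesis .
qed

section \<open>Solution of the recursion\<close>

text \<open>
  Up to powers of \<open>t\<close>, \<open>falling t a r\<close> is the dependence on \<open>a\<close> of the probability that \<open>a\<close> free columns
  have rank \<open>r\<close> modulo \<open>p\<close>. The second \<open>falling\<close> belongs to the complementary matrix with \<open>n - r\<close> rows
  and \<open>a + b - r\<close> columns, whose normal form consists of the positive parts.
\<close>

definition snf_formula :: "real \<Rightarrow> nat \<Rightarrow> nat \<Rightarrow> nat \<Rightarrow> int list \<Rightarrow> real" where
  "snf_formula t n a b lam = (let r = count_list lam 0 in
     t powi (2 * nstat lam + (int (a + b) - int n + 1) * sum_list lam - int (n - r) * int b) *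
     falling t a r * falling t (a + b - r) (n - r) * qfact t n / mult_prod t lam)"

lemma nstat_snoc: "nstat (lam @ [x]) = nstat lam + int (length lam) * x"
  by (simp add: nstat_def nth_append)

lemma mult_prod_snoc: "mult_prod t (lam @ [x]) = mult_prod t lam * (1 - t ^ Suc (count_list lam x))"
proof -
  have "mult_prod t (lam @ [x]) = (\<Prod>v\<in>insert x (set lam - {x}). qfact t (count_list (lam @ [x]) v))"
    by (rule mult_prod_eq) auto
  also have "\<dots> = qfact t (Suc (count_list lam x)) * (\<Prod>v\<in>set lam - {x}. qfact t (count_list lam v))"
    by (subst prod.insert) (auto intro!: prod.cong)
  also have "\<dots> = (1 - t ^ Suc (count_list lam x)) * (\<Prod>v\<in>insert x (set lam - {x}). qfact t (count_list lam v))"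
    by (subst prod.insert) (auto simp: qfact_Suc)
  also have "(\<Prod>v\<in>insert x (set lam - {x}). qfact t (count_list lam v)) = mult_prod t lam"
    by (rule mult_prod_eq[symmetric]) auto
  finally show ?thesis by simp
qed

lemma Sig_nonneg_count_0:
  assumes "lam \<in> Sig_nonneg (Suc n)"
  shows "count_list lam 0 = 0 \<longleftrightarrow> last lam \<noteq> 0"
proof -
  have ne: "lam \<noteq> []" and s: "sorted_wrt (\<ge>) lam" and nn: "\<forall>x\<in>set lam. 0 \<le> x"
    using assms by (auto simp: Sig_nonneg_def Sig_def)
  have le: "last lam \<le> x" if "x \<in> set lam" for x
    using s that by (induction lam) (auto split: if_splits)
  have "0 \<in> set lam \<longleftrightarrow> last lam = 0"
  proof
    assume "0 \<in> set lam"
    then show "last lam = 0" using le[of 0] nn last_in_set[OF ne] by (intro antisym) auto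
  qed (use last_in_set[OF ne] in auto)
  then show ?thesis by (simp add: count_list_0_iff)
qed

text \<open>
  Let \<open>r + 1\<close> be the number of parts \<open>0\<close>. After division by the common factors \<open>C\<close> and \<open>falling t a r\<close>
  the claim is \<open>1 - t^(a+1) = (1 - t^(a-r)) t^(r+1) + (1 - t^(r+1))\<close>.
\<close>

lemma snf_formula_Suc:
  assumes t: "0 < t" "t < 1" and lam: "lam \<in> Sig_nonneg (Suc n)" and nm: "n \<le> a + b"
  shows "snf_formula t (Suc n) (Suc a) b lam =
    snf_formula t (Suc n) a (Suc b) lam * t ^ Suc n +
    (1 - t ^ Suc n) * (if last lam = 0 then snf_formula t n a b (butlast lam) else 0)"
proof (cases "last lam = 0")
  case False
  then have r: "count_list lam 0 = 0" using Sig_nonneg_count_0[OF lam] by simp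
  have e: "t powi (2 * nstat lam + (int (Suc a + b) - int (Suc n) + 1) * sum_list lam - int (Suc n - 0) * int b) =
      t powi (2 * nstat lam + (int (a + Suc b) - int (Suc n) + 1) * sum_list lam - int (Suc n - 0) * int (Suc b)) * t ^ Suc n"
    using t by (subst power_int_of_nat[symmetric], subst power_int_add[symmetric]) (auto simp: algebra_simps)
  show ?thesis using False unfolding snf_formula_def Let_def r e by simp
next
  case True
  have ne: "lam \<noteq> []" and l: "length lam = Suc n" using lam by (auto simp: Sig_nonneg_def Sig_def)
  define \<mu> where "\<mu> = butlast lam"
  have lam_eq: "lam = \<mu> @ [0]" using append_butlast_last_id[OF ne] True by (simp add: \<mu>_def)
  define r where "r = count_list \<mu> 0"
  have rl: "count_list lam 0 = Suc r" by (simp add: lam_eq r_def)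
  have rn: "r \<le> n" using count_le_length[of \<mu> 0] l by (simp add: lam_eq r_def)
  define X where "X = 2 * nstat lam + (int (a + b) - int n + 1) * sum_list lam - int (n - r) * int b"
  define C where "C = t powi X * falling t (a + b - r) (n - r) * qfact t (Suc n) / mult_prod t lam"
  have pr: "1 - t ^ Suc r > 0" "1 - t ^ Suc n > 0" using t by (simp_all add: power_Suc_less_one del: power_Suc)
  \<comment> \<open>The three values of \<open>snf_formula\<close> as multiples of \<open>C\<close>.\<close>
  have 1: "snf_formula t (Suc n) (Suc a) b lam = C * ((1 - t ^ Suc a) * falling t a r)"
    unfolding snf_formula_def Let_def rl C_def X_def by (simp add: falling_Suc_Suc del: power_Suc)
  have "t powi (X - int (n - r)) * t powi int (Suc n) = t powi (X - int (n - r) + int (Suc n))"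
    by (rule power_int_add[symmetric]) (use t in simp)
  also have "X - int (n - r) + int (Suc n) = X + int (Suc r)" using rn by simp
  also have "t powi (X + int (Suc r)) = t powi X * t powi int (Suc r)"
    by (rule power_int_add) (use t in simp)
  finally have "t powi (X - int (n - r)) * t ^ Suc n = t powi X * t ^ Suc r"
    unfolding power_int_of_nat .
  moreover have "2 * nstat lam + (int (a + Suc b) - int (Suc n) + 1) * sum_list lam - int (Suc n - Suc r) * int (Suc b) = X - int (n - r)"
    by (simp add: X_def algebra_simps)
  ultimately have 2: "snf_formula t (Suc n) a (Suc b) lam * t ^ Suc n = C * (falling t a r * (1 - t ^ (a - r)) * t ^ Suc r)"
    unfolding snf_formula_def Let_def rl C_def by (simp add: falling_Suc mult_ac del: power_Suc)
  have "nstat \<mu> = nstat lam" "sum_list \<mu> = sum_list lam" by (simp_all add: lam_eq nstat_snoc)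
  then have 3: "(1 - t ^ Suc n) * snf_formula t n a b \<mu> = C * (falling t a r * (1 - t ^ Suc r))"
    unfolding snf_formula_def Let_def r_def[symmetric] C_def X_def
    using pr mult_prod_pos[OF t, of \<mu>]
    by (simp add: lam_eq mult_prod_snoc r_def[symmetric] qfact_Suc del: power_Suc)
  \<comment> \<open>For \<open>a < r\<close> the difference \<open>a - r\<close> is truncated, but then \<open>falling t a r\<close> vanishes.\<close>
  have 4: "falling t a r * (1 - t ^ (a - r)) * t ^ Suc r = falling t a r * (t ^ Suc r - t ^ Suc a)"
  proof (cases "a < r")
    case False
    then have "t ^ Suc a = t ^ (a - r) * t ^ Suc r" by (simp flip: power_add)
    then show ?thesis by (simp only: left_diff_distrib mult.assoc mult_1)
  qed (simp add: falling_eq_0)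
  have 5: "(1 - t ^ Suc n) * (if last lam = 0 then snf_formula t n a b \<mu> else 0) = C * (falling t a r * (1 - t ^ Suc r))"
    using 3 True by simp
  show ?thesis unfolding \<mu>_def[symmetric] 1 2 4 5 by (simp add: algebra_simps del: power_Suc)
qed

lemma nstat_shift: "2 * nstat (map (\<lambda>x. x - 1) lam) = 2 * nstat lam - int (length lam) * (int (length lam) - 1)"
proof -
  have g: "2 * (\<Sum>i<n. int i) = int n * (int n - 1)" for n
    by (induction n) (auto simp: algebra_simps)
  have "nstat (map (\<lambda>x. x - 1) lam) = nstat lam - (\<Sum>i<length lam. int i)"
    by (simp add: nstat_def algebra_simps sum_subtractf)
  then show ?thesis using g[of "length lam"] by simp
qed

lemma mult_prod_shift: "mult_prod t (map (\<lambda>x. x - 1) lam) = mult_prod t lam"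
proof -
  have inj: "inj (\<lambda>x::int. x - 1)" by (simp add: inj_def)
  have "count_list (map (\<lambda>x. x - 1) lam) (v - 1) = count_list lam v" for v
    by (induction lam) auto
  then show ?thesis
    unfolding mult_prod_def by (simp add: prod.reindex[OF inj_on_subset[OF inj]])
qed

lemma snf_formula_0:
  assumes t: "0 < t" "t < 1" and lam: "lam \<in> Sig_nonneg n" and nb: "n \<le> b"
  shows "snf_formula t n 0 b lam =
    (if \<forall>x\<in>set lam. 1 \<le> x then snf_formula t n b 0 (map (\<lambda>x. x - 1) lam) else 0)"
proof (cases "\<forall>x\<in>set lam. 1 \<le> x")
  case True
  then have "0 \<notin> set lam" by force
  then have r: "count_list lam 0 = 0" by (simp add: count_list_0_iff)
  have l: "length lam = n" using lam by (simp add: Sig_nonneg_def Sig_def)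
  define \<mu> where "\<mu> = map (\<lambda>x. x - 1) lam"
  define s where "s = count_list \<mu> 0"
  have s: "s \<le> n" using count_le_length[of \<mu> 0] l by (simp add: s_def \<mu>_def)
  have sum: "sum_list \<mu> = sum_list lam - int n" using l unfolding \<mu>_def by (induction lam arbitrary: n) auto
  have f: "falling t b s * falling t (b - s) (n - s) = falling t b n"
  proof -
    have "falling t b (s + m) = falling t b s * falling t (b - s) m" for m
      by (induction m) (simp_all add: falling_Suc)
    from this[of "n - s"] show ?thesis using s by simp
  qed
  have "2 * nstat \<mu> + (int b - int n + 1) * sum_list \<mu> = 2 * nstat lam + (int b - int n + 1) * sum_list lam - int n * int b"
  proof -
    have "2 * nstat \<mu> = 2 * nstat lam - int n * (int n - 1)"
      using nstat_shift[of lam] l by (simp add: \<mu>_def)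
    then show ?thesis unfolding sum by (simp add: algebra_simps)
  qed
  moreover have "mult_prod t \<mu> = mult_prod t lam" unfolding \<mu>_def by (rule mult_prod_shift)
  ultimately have "snf_formula t n 0 b lam = snf_formula t n b 0 \<mu>"
    unfolding snf_formula_def Let_def r s_def[symmetric] using f by simp
  then show ?thesis unfolding if_P[OF True] \<mu>_def .
next
  case False
  then obtain x where "x \<in> set lam" "\<not> 1 \<le> x" by blast
  moreover have "0 \<le> x" using lam \<open>x \<in> set lam\<close> by (simp add: Sig_nonneg_def)
  ultimately have "0 \<in> set lam" by (cases "x = 0") auto
  then have "0 < count_list lam 0" by (metis count_list_0_iff neq0_conv)
  then show ?thesis unfolding if_not_P[OF False] snf_formula_def Let_def by (simp add: falling_eq_0)
qed

lemma snf_formula_dim_0: "snf_formula t 0 a b [] = 1"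
  by (simp add: snf_formula_def nstat_def mult_prod_def)

text \<open>
  The recursion terminates: dividing by \<open>p\<close> lowers the sum of the parts, and the treatment of a free
  column keeps that sum and lowers \<open>n + a\<close>.
\<close>

lemma snf_avg_eq_formula:
  assumes "t = 1 / real CARD('p::prime_card)" and "lam \<in> Sig_nonneg n" "n \<le> a + b"
    and "\<And>i. i < n \<Longrightarrow> nat (lam ! i) < k"
  shows "snf_avg TYPE('p) k n a b lam = snf_formula t n a b lam"
  using assms(2-)
proof (induction "(nat (sum_list lam), n + a)" arbitrary: n a b lam rule: wf_induct_rule[OF wf_lex_prod[OF wf_less_than wf_less_than]])
  case 1
  note IH = 1(1) and lam = 1(2) and nm = 1(3) and k = 1(4)
  have t: "0 < t" "t < 1" using p_gt_1[where 'p='p] assms(1) by auto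
  have tp: "1 / real CARD('p) ^ j = t ^ j" for j using assms(1) by (simp add: power_one_over)
  have l: "length lam = n" and nn: "\<forall>x\<in>set lam. 0 \<le> x" using lam by (auto simp: Sig_nonneg_def Sig_def)
  show ?case
  proof (cases n)
    case 0
    then show ?thesis using l by (simp add: snf_avg_dim_0 snf_formula_dim_0)
  next
    case (Suc n')
    show ?thesis
    proof (cases a)
      case (Suc a')
      have lam': "lam \<in> Sig_nonneg (Suc n')" and nm': "n' \<le> a' + b" using lam nm \<open>n = Suc n'\<close> Suc by auto
      have A: "snf_avg TYPE('p) k (Suc n') a' (Suc b) lam = snf_formula t (Suc n') a' (Suc b) lam"
        by (rule IH) (use Suc \<open>n = Suc n'\<close> lam nm k in auto)
      have B: "snf_avg TYPE('p) k n' a' b (butlast lam) = snf_formula t n' a' b (butlast lam)" if "last lam = 0"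
      proof (rule IH)
        have "lam \<noteq> []" using l \<open>n = Suc n'\<close> by auto
        then have "lam = butlast lam @ [0]" using append_butlast_last_id[of lam] that by simp
        then have "sum_list lam = sum_list (butlast lam)" by (metis add.right_neutral sum_list.Cons sum_list.Nil sum_list.append)
        then show "((nat (sum_list (butlast lam)), n' + a'), nat (sum_list lam), n + a) \<in> less_than <*lex*> less_than"
          using Suc \<open>n = Suc n'\<close> by simp
        show "butlast lam \<in> Sig_nonneg n'" by (rule Sig_nonneg_butlast[OF lam'])
        show "nat (butlast lam ! i) < k" if "i < n'" for i
          using k[of i] that l \<open>n = Suc n'\<close> by (simp add: nth_butlast)
      qed (rule nm')
      have "snf_avg TYPE('p) k (Suc n') (Suc a') b lam =
          snf_avg TYPE('p) k (Suc n') a' (Suc b) lam * t ^ Suc n' +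
          (1 - t ^ Suc n') * (if last lam = 0 then snf_avg TYPE('p) k n' a' b (butlast lam) else 0)"
        using snf_avg_Suc[OF nm' lam', of k, where 'p='p] k \<open>n = Suc n'\<close>
        by (simp only: tp[symmetric]) (simp del: power_Suc)
      also have "\<dots> = snf_formula t (Suc n') (Suc a') b lam"
        unfolding snf_formula_Suc[OF t lam' nm'] using A B by (simp del: power_Suc)
      finally show ?thesis using Suc \<open>n = Suc n'\<close> by simp
    next
      case 0
      have nb: "n \<le> b" using nm 0 by simp
      have "snf_avg TYPE('p) k n b 0 (map (\<lambda>x. x - 1) lam) = snf_formula t n b 0 (map (\<lambda>x. x - 1) lam)"
        if ge: "\<forall>x\<in>set lam. 1 \<le> x"
      proof (rule IH)
        have s: "sum_list (map (\<lambda>x. x - 1) lam) = sum_list lam - int (length lam)" by (induction lam) auto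
        have "int (length lam) \<le> sum_list lam" using ge by (induction lam) auto
        then show "((nat (sum_list (map (\<lambda>x. x - 1) lam)), n + b), nat (sum_list lam), n + a) \<in> less_than <*lex*> less_than"
          using l \<open>n = Suc n'\<close> unfolding s by simp
        have "sorted_wrt (\<ge>) (map (\<lambda>x. x - 1) lam)"
          unfolding sorted_wrt_map
          by (rule sorted_wrt_mono_rel[of _ "(\<ge>)"]) (use lam in \<open>auto simp: Sig_nonneg_def Sig_def\<close>)
        then show "map (\<lambda>x. x - 1) lam \<in> Sig_nonneg n"
          using lam ge by (auto simp: Sig_nonneg_def Sig_def)
        show "nat (map (\<lambda>x. x - 1) lam ! i) < k" if "i < n" for i
        proof -
          have "nat (map (\<lambda>x. x - 1) lam ! i) \<le> nat (lam ! i)" using that l by (simp add: nat_mono)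
          then show ?thesis using k[OF that] by linarith
        qed
      qed (use nb in simp)
      then show ?thesis
        unfolding 0 snf_avg_0[OF nb lam] snf_formula_0[OF t lam nb] by (simp only: split: if_split) blast
    qed
  qed
qed

section \<open>From Haar measure to averages\<close>

text \<open>
  The residue classes modulo \<open>p^k\<close> are translates of each other and partition the space.
\<close>

lemma haar_residue:
  fixes \<mu> :: "'p::prime_card padic_int measure"
  assumes haar: "haar_prob \<mu>" and a: "a \<in> {0..<int CARD('p) ^ k}"
  shows "{x. residue_seq x k = a} \<in> sets \<mu>" and "measure \<mu> {x. residue_seq x k = a} = 1 / real CARD('p) ^ k"
proof -
  interpret prob_space \<mu> using haar by (simp add: haar_prob_def)
  let ?B = "\<lambda>a. {x :: 'p padic_int. residue_seq x k = a}" and ?I = "{0..<int CARD('p) ^ k}"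
  have sets: "sets \<mu> = sets borel" and space: "space \<mu> = UNIV"
    using haar by (auto simp: haar_prob_def dest: sets_eq_imp_space_eq)
  have open_B: "open (?B a)" for a
    unfolding open_padic_int_def by (auto intro!: exI[of _ k])
  have B: "?B a \<in> sets borel" for a by (rule borel_open[OF open_B])
  then show "?B a \<in> sets \<mu>" using sets by simp
  have res: "residue_seq (of_int a + x) k = (a + residue_seq x k) mod int CARD('p) ^ k" for a and x :: "'p padic_int"
    by (simp add: plus_padic_int.rep_eq residue_seq_of_int mod_simps)
  have same: "measure \<mu> (?B a) = measure \<mu> (?B 0)" if a: "a \<in> ?I" for a
  proof -
    have "?B a = (+) (of_int a) ` ?B 0"
    proof (rule subset_antisym; rule subsetI)
      fix x assume x: "x \<in> ?B a"
      have "residue_seq (of_int (- a) + x) k = 0" using x by (simp only: res) simp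
      then have "- of_int a + x \<in> ?B 0" by simp
      moreover have "x = of_int a + (- of_int a + x)" by simp
      ultimately show "x \<in> (+) (of_int a) ` ?B 0" by blast
    qed (use a res in auto)
    then have "emeasure \<mu> (?B a) = emeasure \<mu> (?B 0)"
      using haar B unfolding haar_prob_def by simp
    then show ?thesis by (simp add: measure_def)
  qed
  have "(\<Union>a\<in>?I. ?B a) = UNIV" using residue_seq_bounds by auto
  then have "1 = measure \<mu> (\<Union>a\<in>?I. ?B a)" using prob_space space by simp
  also have "\<dots> = (\<Sum>a\<in>?I. measure \<mu> (?B a))"
    by (rule finite_measure_finite_Union) (use B sets in \<open>auto simp: disjoint_family_on_def\<close>)
  also have "\<dots> = (\<Sum>a\<in>?I. measure \<mu> (?B 0))" by (rule sum.cong[OF refl same])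
  also have "\<dots> = real CARD('p) ^ k * measure \<mu> (?B 0)" by simp
  finally have "measure \<mu> (?B 0) = 1 / real CARD('p) ^ k"
    using card_pos[where 'p='p] by (simp add: field_simps)
  then show "measure \<mu> (?B a) = 1 / real CARD('p) ^ k" using same[OF a] by simp
qed

definition mreps :: "nat \<Rightarrow> nat \<Rightarrow> nat \<Rightarrow> 'p::prime_card padic_int mat set" where
  "mreps k n m = {B \<in> carrier_mat n m. \<forall>i<n. \<forall>j<m. B $$ (i, j) \<in> reps k}"

lemma avgl_mreps:
  fixes g :: "'p::prime_card padic_int mat \<Rightarrow> real"
  shows "finite (mreps k n m :: 'p padic_int mat set)"
    and "avgl k n m (\<lambda>vs. g (mat_of_cols n vs)) = (\<Sum>B\<in>mreps k n m. g B) / real CARD('p) ^ (k * n * m)"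
proof -
  let ?L = "\<lambda>m. {vs. set vs \<subseteq> vreps k n \<and> length vs = m} :: 'p padic_int vec list set"
  have fin: "finite (?L m)" for m by (rule finite_lists_length_eq) simp
  have avg: "avgl k n m h = (\<Sum>vs\<in>?L m. h vs) / real CARD('p) ^ (k * n * m)" for h m
  proof (induction m arbitrary: h)
    case 0
    have "?L 0 = {[]}" by auto
    then show ?case by simp
  next
    case (Suc m)
    have "?L (Suc m) = (\<lambda>(v, vs). v # vs) ` (vreps k n \<times> ?L m)"
      by (auto simp: length_Suc_conv image_iff)
    moreover have "inj_on (\<lambda>(v, vs). v # vs) (vreps k n \<times> ?L m)" by (auto simp: inj_on_def)
    ultimately have "(\<Sum>vs\<in>?L (Suc m). h vs) = (\<Sum>v\<in>vreps k n. \<Sum>vs\<in>?L m. h (v # vs))"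
      by (simp add: sum.reindex sum.cartesian_product case_prod_unfold)
    then show ?case
      by (simp add: Suc avgv_vreps sum_divide_distrib[symmetric] power_add)
  qed
  have bij: "bij_betw (mat_of_cols n) (?L m) (mreps k n m)"
  proof (rule bij_betwI[of _ _ _ cols])
    show "mat_of_cols n \<in> ?L m \<rightarrow> mreps k n m"
    proof
      fix vs assume "vs \<in> ?L m"
      then have "length vs = m" "\<And>j. j < m \<Longrightarrow> vs ! j \<in> vreps k n" by auto
      then show "mat_of_cols n vs \<in> mreps k n m"
        by (auto simp: mreps_def vreps_def mat_of_cols_index)
    qed
    show "cols \<in> mreps k n m \<rightarrow> ?L m"
      by (auto simp: mreps_def vreps_def cols_def)
    show "cols (mat_of_cols n vs) = vs" if "vs \<in> ?L m" for vs
      by (rule cols_mat_of_cols) (use that in \<open>auto simp: vreps_def\<close>)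
    show "mat_of_cols n (cols B) = B" if "B \<in> mreps k n m" for B
      using that mat_of_cols_cols[of B] by (auto simp: mreps_def)
  qed
  show "finite (mreps k n m :: 'p padic_int mat set)"
    using bij fin bij_betw_finite by blast
  show "avgl k n m (\<lambda>vs. g (mat_of_cols n vs)) = (\<Sum>B\<in>mreps k n m. g B) / real CARD('p) ^ (k * n * m)"
    unfolding avg by (subst sum.reindex_bij_betw[OF bij]) simp
qed

text \<open>
  The event is the disjoint union of the events that the residues of the entries are those of a given
  matrix of representatives, and by independence all of these are equally likely.
\<close>

lemma prob_eq_avgl:
  fixes M :: "'w measure" and A :: "'w \<Rightarrow> 'p::prime_card padic_int mat" and \<mu> :: "'p padic_int measure"
  assumes "1 \<le> n" "1 \<le> m" "prob_space M"
    and carr: "\<And>\<omega>. \<omega> \<in> space M \<Longrightarrow> A \<omega> \<in> carrier_mat n m"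
    and haar: "haar_prob \<mu>"
    and indep: "prob_space.indep_vars M (\<lambda>_. borel) (\<lambda>(i, j) \<omega>. A \<omega> $$ (i, j)) ({..<n} \<times> {..<m})"
    and distr: "\<And>i j. i < n \<Longrightarrow> j < m \<Longrightarrow> distr M borel (\<lambda>\<omega>. A \<omega> $$ (i, j)) = \<mu>"
    and P: "\<And>B C. B \<in> carrier_mat n m \<Longrightarrow> C \<in> carrier_mat n m \<Longrightarrow> cong_mat k B C \<Longrightarrow> P B \<longleftrightarrow> P C"
  shows "measure M {\<omega> \<in> space M. P (A \<omega>)} = avgl k n m (\<lambda>vs. of_bool (P (mat_of_cols n vs)))"
proof -
  interpret prob_space M by fact
  let ?I = "{..<n} \<times> {..<m}" and ?X = "\<lambda>(i, j) \<omega>. A \<omega> $$ (i, j)"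
  define Ball where "Ball b = {x :: 'p padic_int. residue_seq x k = residue_seq b k}" for b :: "'p padic_int"
  have res_in: "residue_seq b k \<in> {0..<int CARD('p) ^ k}" for b :: "'p padic_int"
    using residue_seq_bounds by auto
  have Ball: "Ball b \<in> sets borel" "measure \<mu> (Ball b) = 1 / real CARD('p) ^ k" for b :: "'p padic_int"
    using haar_residue[OF haar res_in, of b] haar by (auto simp: Ball_def haar_prob_def)
  have rv: "random_variable borel (?X ij)" if "ij \<in> ?I" for ij
    using indep that unfolding indep_vars_def by auto
  define E where "E B = (\<Inter>ij\<in>?I. ?X ij -` Ball (B $$ ij) \<inter> space M)" for B :: "'p padic_int mat"
  have I: "finite ?I" "?I \<noteq> {}" using assms(1,2) by (auto simp: lessThan_empty_iff)
  have E_sets: "E B \<in> sets M" for B :: "'p padic_int mat"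
    unfolding E_def by (rule sets.finite_INT[OF I]) (rule measurable_sets[OF rv Ball(1)])
  have E_prob: "prob (E B) = 1 / real CARD('p) ^ (k * n * m)" for B :: "'p padic_int mat"
  proof -
    have "prob (E B) = (\<Prod>ij\<in>?I. prob (?X ij -` Ball (B $$ ij) \<inter> space M))"
      unfolding E_def by (rule indep_varsD[OF indep I(2,1)]) (use Ball(1) in auto)
    also have "\<dots> = (\<Prod>ij\<in>?I. 1 / real CARD('p) ^ k)"
    proof (rule prod.cong[OF refl])
      fix ij assume ij: "ij \<in> ?I"
      then have "distr M borel (?X ij) = \<mu>" using distr by auto
      then show "prob (?X ij -` Ball (B $$ ij) \<inter> space M) = 1 / real CARD('p) ^ k"
        using measure_distr[OF rv[OF ij] Ball(1)] Ball(2) by simp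
    qed
    finally show ?thesis by (simp add: power_one_over power_mult mult_ac flip: power_mult)
  qed
  have E_iff: "\<omega> \<in> E B \<longleftrightarrow> \<omega> \<in> space M \<and> cong_mat k (A \<omega>) B" if "B \<in> carrier_mat n m" for \<omega> and B :: "'p padic_int mat"
    using I(2) carr[of \<omega>] that
    by (auto simp: E_def Ball_def cong_mat_def pp_power_dvd_diff_iff)
  let ?R = "{B \<in> mreps k n m. P B}"
  have carr_R: "B \<in> carrier_mat n m" if "B \<in> mreps k n m" for B :: "'p padic_int mat"
    using that by (simp add: mreps_def)
  have "{\<omega> \<in> space M. P (A \<omega>)} = (\<Union>B\<in>?R. E B)"
  proof (rule subset_antisym; rule subsetI)
    fix \<omega> assume "\<omega> \<in> {\<omega> \<in> space M. P (A \<omega>)}"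
    then have \<omega>: "\<omega> \<in> space M" "P (A \<omega>)" by auto
    let ?B = "map_mat (trunc k) (A \<omega>)"
    have B: "?B \<in> mreps k n m" using carr[OF \<omega>(1)] by (auto simp: mreps_def trunc_reps)
    have c: "cong_mat k (A \<omega>) ?B"
      by (simp add: cong_mat_def pp_power_dvd_diff_iff trunc_cong[unfolded pp_power_dvd_diff_iff])
    then have "P ?B" using P[OF carr[OF \<omega>(1)] carr_R[OF B] c] \<omega>(2) by simp
    then show "\<omega> \<in> (\<Union>B\<in>?R. E B)" using B c \<omega>(1) E_iff[OF carr_R[OF B]] by blast
  next
    fix \<omega> assume "\<omega> \<in> (\<Union>B\<in>?R. E B)"
    then obtain B where B: "B \<in> mreps k n m" "P B" "\<omega> \<in> E B" by auto
    then have "\<omega> \<in> space M" "cong_mat k (A \<omega>) B" using E_iff[OF carr_R[OF B(1)]] by auto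
    then show "\<omega> \<in> {\<omega> \<in> space M. P (A \<omega>)}"
      using P[OF carr carr_R[OF B(1)]] B(2) by simp
  qed
  moreover have disj: "disjoint_family_on E ?R"
  proof (unfold disjoint_family_on_def, clarify)
    fix B C :: "'p padic_int mat" assume B: "B \<in> mreps k n m" and C: "C \<in> mreps k n m" and ne: "B \<noteq> C"
    have "B = C" if "\<omega> \<in> E B" "\<omega> \<in> E C" for \<omega>
    proof (rule eq_matI)
      fix i j assume "i < dim_row C" "j < dim_col C"
      then have ij: "i < n" "j < m" using C by (auto simp: mreps_def)
      have "residue_seq (B $$ (i, j)) k = residue_seq (C $$ (i, j)) k"
      proof -
        have "cong_mat k (A \<omega>) B" "cong_mat k (A \<omega>) C" "A \<omega> \<in> carrier_mat n m"
          using that E_iff[OF carr_R[OF B]] E_iff[OF carr_R[OF C]] carr by auto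
        then have "residue_seq (A \<omega> $$ (i, j)) k = residue_seq (B $$ (i, j)) k"
            "residue_seq (A \<omega> $$ (i, j)) k = residue_seq (C $$ (i, j)) k"
          using ij by (auto simp: cong_mat_def pp_power_dvd_diff_iff)
        then show ?thesis by simp
      qed
      then show "B $$ (i, j) = C $$ (i, j)"
        using B C ij by (intro reps_cong_eq[of _ k]) (auto simp: mreps_def pp_power_dvd_diff_iff)
    qed (use B C in \<open>auto simp: mreps_def\<close>)
    then show "E B \<inter> E C = {}" using ne by blast
  qed
  moreover have "prob (\<Union>B\<in>?R. E B) = (\<Sum>B\<in>?R. prob (E B))"
  proof (rule finite_measure_finite_Union[OF _ _ disj])
    show "finite ?R" by (rule finite_subset[OF _ avgl_mreps(1)[of k n m]]) auto
  qed (use E_sets in auto)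
  ultimately have "measure M {\<omega> \<in> space M. P (A \<omega>)} = (\<Sum>B\<in>?R. prob (E B))" by simp
  also have "\<dots> = (\<Sum>B\<in>mreps k n m. of_bool (P B)) / real CARD('p) ^ (k * n * m)"
    unfolding sum_divide_distrib
    by (rule sum.mono_neutral_cong_left[OF avgl_mreps(1)]) (auto simp: E_prob)
  also have "\<dots> = avgl k n m (\<lambda>vs. of_bool (P (mat_of_cols n vs)))"
    by (rule avgl_mreps(2)[symmetric])
  finally show ?thesis .
qed

section \<open>The distribution of the singular numbers\<close>

theorem corollary1p4:
  fixes M :: "'w measure"
    and A :: "'w \<Rightarrow> 'p::prime_card padic_int mat"
    and \<mu> :: "'p padic_int measure"
    and n m p :: nat and t :: real and lam :: "int list"
  assumes "p = CARD('p)" and "t = 1 / real p"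
    and "1 \<le> n" and "n \<le> m"
    and "prob_space M"
    and "\<And>\<omega>. \<omega> \<in> space M \<Longrightarrow> A \<omega> \<in> carrier_mat n m"
    and "haar_prob \<mu>"
    and "prob_space.indep_vars M (\<lambda>_. borel) (\<lambda>(i, j) \<omega>. A \<omega> $$ (i, j)) ({..<n} \<times> {..<m})"
    and "\<And>i j. i < n \<Longrightarrow> j < m \<Longrightarrow> distr M borel (\<lambda>\<omega>. A \<omega> $$ (i, j)) = \<mu>"
    and "lam \<in> Sig_nonneg n"
  shows "measure M {\<omega> \<in> space M. has_SN (map_mat to_fract (A \<omega>)) lam} =
    hl_P lam (\<lambda>i. t ^ i) t * hl_Q lam (\<lambda>j. t ^ (m - n + 1 + j)) t /
    cauchy_kernel n (\<lambda>i. t ^ i) (\<lambda>j. t ^ (m - n + 1 + j)) t"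
proof -
  have t: "0 < t" "t < 1" using p_gt_1[where 'p='p] assms(1,2) by auto
  have tp: "t = 1 / real CARD('p)" using assms(1,2) by simp
  have l: "length lam = n" and srt: "sorted_wrt (\<ge>) lam" and nn: "\<forall>x\<in>set lam. 0 \<le> x"
    using assms(10) by (auto simp: Sig_nonneg_def Sig_def)
  \<comment> \<open>Any \<open>k\<close> above all parts would do.\<close>
  define k where "k = Suc (nat (sum_list lam))"
  have k: "nat (lam ! i) < k" if "i < n" for i
  proof -
    have "x \<le> sum_list lam" if "x \<in> set lam" for x
      using that nn member_le_sum_list[of x lam] by simp
    then show ?thesis using that l by (simp add: k_def less_Suc_eq_le nat_mono)
  qed
  let ?P = "\<lambda>B :: 'p padic_int mat. mequiv B (pdiag n m lam)"
  have P_cong: "?P B \<longleftrightarrow> ?P C" if "B \<in> carrier_mat n m" "C \<in> carrier_mat n m" "cong_mat k B C"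
    for B C :: "'p padic_int mat"
  proof -
    have "cong_mat k C B" using that by (auto simp: cong_mat_def pp_power_dvd_diff_iff)
    then show ?thesis using mequiv_pdiag_cong[OF _ _ assms(4) k] that by blast
  qed
  have "measure M {\<omega> \<in> space M. has_SN (map_mat to_fract (A \<omega>)) lam} = measure M {\<omega> \<in> space M. ?P (A \<omega>)}"
    using has_SN_iff[OF assms(6,4,10)] by (intro arg_cong[of _ _ "measure M"]) auto
  also have "\<dots> = avgl k n m (\<lambda>vs. of_bool (?P (mat_of_cols n vs)))"
    by (rule prob_eq_avgl[OF assms(3) _ assms(5,6,7,8,9) P_cong]) (use assms(3,4) in auto)
  also have "\<dots> = snf_avg TYPE('p) k n m 0 lam"
    unfolding snf_avg_def snf_ind_def by (auto intro!: avgl_cong)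
  also have "\<dots> = snf_formula t n m 0 lam"
    by (rule snf_avg_eq_formula[OF tp assms(10) _ k]) (use assms(4) in auto)
  also have "\<dots> = hl_P lam (\<lambda>i. t ^ i) t * hl_Q lam (\<lambda>j. t ^ (m - n + 1 + j)) t /
    cauchy_kernel n (\<lambda>i. t ^ i) (\<lambda>j. t ^ (m - n + 1 + j)) t"
  proof -
    define r where "r = count_list lam 0"
    have r: "r \<le> n" using count_le_length[of lam 0] l by (simp add: r_def)
    have "falling t m (r + s) = falling t m r * falling t (m - r) s" for s
      by (induction s) (simp_all add: falling_Suc)
    from this[of "n - r"] have f: "falling t m r * falling t (m - r) (n - r) = falling t m n" using r by simp
    have "falling t m n = (\<Prod>i<n. 1 - t ^ (m - n + 1 + i))"
      unfolding falling_def
      by (rule prod.reindex_bij_witness[of _ "\<lambda>i. n - 1 - i" "\<lambda>i. n - 1 - i"]) (use assms(4) in \<open>auto simp: Suc_diff_Suc simp del: power_Suc\<close>)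
    then have kernel: "cauchy_kernel n (\<lambda>i. t ^ i) (\<lambda>j. t ^ (m - n + 1 + j)) t = 1 / falling t m n"
      using cauchy_kernel_principal[OF t, of "m - n + 1" n] by simp
    have "2 * nstat lam + (int (m + 0) - int n + 1) * sum_list lam - int (n - r) * int 0 =
        nstat lam + (int (m - n + 1) * sum_list lam + nstat lam)"
      using assms(4) by (simp add: of_nat_diff)
    moreover have "t powi (nstat lam + (int (m - n + 1) * sum_list lam + nstat lam)) =
        t powi nstat lam * t powi (int (m - n + 1) * sum_list lam + nstat lam)"
      by (rule power_int_add) (use t in simp)
    ultimately have "t powi (2 * nstat lam + (int (m + 0) - int n + 1) * sum_list lam - int (n - r) * int 0) =
        t powi nstat lam * t powi (int (m - n + 1) * sum_list lam + nstat lam)"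
      by (simp only:)
    then show ?thesis
      unfolding hl_P_principal[OF t srt] hl_Q_principal[OF t srt nn] kernel snf_formula_def Let_def r_def[symmetric] l
      using f by (simp add: mult_ac)
  qed
  finally show ?thesis .
qed

end
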